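(* Assume the standing setting described in the context, including (H.1)–(H.4) and the bound (F). Assume moreover that there is $f_0\in L^2(I)$ such that $$\frac{1}{\epsilon^{\gamma+1}}\int_{-\epsilon k^1_\epsilon(x)}^{\epsilon k^2_\epsilon(x)}\chi_{\theta^\epsilon}(x,y)\,f^\epsilon(x,y)\,dy\;\rightharpoonup\; f_0(x)\quad\text{weakly in }L^2(I)\ \text{as }\epsilon\to0.$$ Let $w^\epsilon\in H^1(R^\epsilon)$ be the solution of the problem $(\mathcal P_\epsilon)$ and let $\hat w^\epsilon\in H^1(I)$ be the solution of the reduced problem $(\hat{\mathcal P}_\epsilon)$. Then, as $\epsilon\to0$, $$\hat w^\epsilon\rightharpoonup \hat w\ \text{ weakly in } H^1(I)\qquad\text{and}\qquad |||w^\epsilon-\hat w|||_{L^2(R^\epsilon)}\to0 ,$$ where $\hat w$ is regarded as a function on $R^\epsilon$ that is constant in $y$. Here $\hat w\in H^1(I)$ is the unique function satisfying $$\int_I\Big\{\frac{1}{P}\,\hat w_x\,\phi_x+(K^1+K^2)\,\hat w\,\phi\Big\}\,dx=\int_I f_0\,\phi\,dx\qquad\text{for all }\phi\in H^1(I).$$ This is the weak form of the Neumann problem "$-\frac{1}{P(K^1+K^2)}\hat w_{xx}+\hat w=\hat f$ in $I$, $\hat w_x(a)=\hat w_x(b)=0$", where $\hat f=f_0/(K^1+K^2)$.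
   Context: Let $I=(a,b)\subset\mathbb R$ be a bounded interval and fix $\gamma>0$. For $\epsilon\in(0,1)$ and $i=1,2$, let $k^i_\epsilon:\bar I\to(0,\infty)$ satisfy the following hypotheses. - (H.1) $k^i_\epsilon\in C^1(\bar I)$ and $\sup_{x\in I}\epsilon\,|\tfrac{d}{dx}k^i_\epsilon(x)|\to0$ as $\epsilon\to0$. - (H.2) There are constants $0<C^i_1\le C^i_2$, independent of $\epsilon$, with $C^i_1\le k^i_\epsilon(x)\le C^i_2$ for all $x,\epsilon$. - (H.3) There is $K^i\in L^2(I)$ with $k^i_\epsilon\rightharpoonup K^i$ weakly in $L^2(I)$. - (H.4) There is $P\in L^2(I)$ with $1/(k^1_\epsilon+k^2_\epsilon)\rightharpoonup P$ weakly in $L^2(I)$. Write $K_\epsilon=k^1_\epsilon+k^2_\epsilon$. Define the thin domain $R^\epsilon=\{(x,y)\in\mathbb R^2: x\in I,\ -\epsilon k^1_\epsilon(x)<y<\epsilon k^2_\epsilon(x)\}$. Let $H_\epsilon:\bar I\to\mathbb R$ be $C^1$ functions with constants $0\le H_0\le H_1$, independent of $\epsilon$, such that $H_0\le H_\epsilon(x)\le H_1$. Define the narrow strip $\theta^\epsilon=\{(x,y): x\in I,\ \epsilon[k^2_\epsilon(x)-\epsilon^\gamma H_\epsilon(x)]<y<\epsilon k^2_\epsilon(x)\}$, and let $\chi_{\theta^\epsilon}$ be its characteristic function. Rescaled norms: for $\mathcal O\subset R^\epsilon$, set $|||\varphi|||_{L^2(\mathcal O)}=\epsilon^{-1/2}\|\varphi\|_{L^2(\mathcal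 O)}$ and $|||\varphi|||_{H^1(\mathcal O)}=\epsilon^{-1/2}\|\varphi\|_{H^1(\mathcal O)}$. Let $f^\epsilon\in L^2(R^\epsilon)$ satisfy (F): $\epsilon^{-\gamma}|||f^\epsilon|||^2_{L^2(\theta^\epsilon)}\le c$, with $c$ independent of $\epsilon$. Problem $(\mathcal P_\epsilon)$: $w^\epsilon\in H^1(R^\epsilon)$ is the unique weak solution of $-\Delta w^\epsilon+w^\epsilon=\epsilon^{-\gamma}\chi_{\theta^\epsilon}f^\epsilon$ in $R^\epsilon$, $\partial w^\epsilon/\partial\nu=0$ on $\partial R^\epsilon$. That is, $$\int_{R^\epsilon}(\nabla w^\epsilon\cdot\nabla\varphi+w^\epsilon\varphi)=\epsilon^{-\gamma}\int_{\theta^\epsilon}f^\epsilon\varphi\quad\text{for all }\varphi\in H^1(R^\epsilon).$$ Reduced problem $(\hat{\mathcal P}_\epsilon)$: set $$\hat f^\epsilon(x)=\frac{1}{\epsilon K_\epsilon(x)}\int_{-\epsilon k^1_\epsilon(x)}^{\epsilon k^2_\epsilon(x)}\chi_{\theta^\epsilon}(x,y)f^\epsilon(x,y)\,dy,$$ and let $\hat w^\epsilon\in H^1(I)$ be the unique solution of $$\int_I\{K_\epsilon\hat w^\epsilon_x\phi_x+K_\epsilon\hat w^\epsilon\phi\}\,dx=\epsilon^{-\gamma}\int_I K_\epsilon\hat f^\epsilon\phi\,dx\quad\text{for all }\phi\in H^1(I).$$ This is the weak form of $-\frac{1}{K_\epsilon}(K_\epsilon\hat w_x)_x+\hat w=\epsilon^{-\gamma}\hat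 f^\epsilon$ with $\hat w_x(a)=\hat w_x(b)=0$. *)

theory Defs
  imports "HOL-Analysis.Analysis"
begin

definition L2 :: "'a::euclidean_space set \<Rightarrow> ('a \<Rightarrow> real) \<Rightarrow> bool" where
  "L2 S u \<longleftrightarrow> (\<lambda>x. indicator S x * u x) \<in> borel_measurable lborel
      \<and> integrable lborel (\<lambda>x. indicator S x * (u x)^2)"

abbreviation sint :: "'a::euclidean_space set \<Rightarrow> ('a \<Rightarrow> real) \<Rightarrow> real" where
  "sint S f \<equiv> set_lebesgue_integral lborel S f"

definition test1 :: "real set \<Rightarrow> (real \<Rightarrow> real) \<Rightarrow> bool" where
  "test1 S \<phi> \<longleftrightarrow> (\<forall>x. \<phi> differentiable at x) \<and> continuous_on UNIV (deriv \<phi>)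
      \<and> (\<exists>K. compact K \<and> K \<subseteq> S \<and> (\<forall>x. x \<notin> K \<longrightarrow> \<phi> x = 0))"

definition pdx :: "(real \<times> real \<Rightarrow> real) \<Rightarrow> real \<times> real \<Rightarrow> real" where
  "pdx \<phi> z = deriv (\<lambda>t. \<phi> (t, snd z)) (fst z)"

definition pdy :: "(real \<times> real \<Rightarrow> real) \<Rightarrow> real \<times> real \<Rightarrow> real" where
  "pdy \<phi> z = deriv (\<lambda>t. \<phi> (fst z, t)) (snd z)"

definition test2 :: "(real \<times> real) set \<Rightarrow> (real \<times> real \<Rightarrow> real) \<Rightarrow> bool" where
  "test2 S \<phi> \<longleftrightarrow> (\<forall>z. \<phi> differentiable at z) \<and> continuous_on UNIV (pdx \<phi>)
      \<and> continuous_on UNIV (pdy \<phi>)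
      \<and> (\<exists>K. compact K \<and> K \<subseteq> S \<and> (\<forall>z. z \<notin> K \<longrightarrow> \<phi> z = 0))"

definition is_wderiv :: "real set \<Rightarrow> (real \<Rightarrow> real) \<Rightarrow> (real \<Rightarrow> real) \<Rightarrow> bool" where
  "is_wderiv S u v \<longleftrightarrow> (\<forall>\<phi>. test1 S \<phi> \<longrightarrow>
      sint S (\<lambda>x. u x * deriv \<phi> x) = - sint S (\<lambda>x. v x * \<phi> x))"

definition is_wgrad :: "(real \<times> real) set \<Rightarrow> (real \<times> real \<Rightarrow> real)
    \<Rightarrow> (real \<times> real \<Rightarrow> real) \<Rightarrow> (real \<times> real \<Rightarrow> real) \<Rightarrow> bool" where
  "is_wgrad S u gx gy \<longleftrightarrow> (\<forall>\<phi>. test2 S \<phi> \<longrightarrow>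
      sint S (\<lambda>z. u z * pdx \<phi> z) = - sint S (\<lambda>z. gx z * \<phi> z) \<and>
      sint S (\<lambda>z. u z * pdy \<phi> z) = - sint S (\<lambda>z. gy z * \<phi> z))"

definition H1_1 :: "real set \<Rightarrow> (real \<Rightarrow> real) \<Rightarrow> bool" where
  "H1_1 S u \<longleftrightarrow> L2 S u \<and> (\<exists>v. L2 S v \<and> is_wderiv S u v)"

definition wderiv :: "real set \<Rightarrow> (real \<Rightarrow> real) \<Rightarrow> real \<Rightarrow> real" where
  "wderiv S u = (SOME v. L2 S v \<and> is_wderiv S u v)"

definition H1_2 :: "(real \<times> real) set \<Rightarrow> (real \<times> real \<Rightarrow> real) \<Rightarrow> bool" where
  "H1_2 S u \<longleftrightarrow> L2 S u \<and> (\<exists>gx gy. L2 S gx \<and> L2 S gy \<and> is_wgrad S u gx gy)"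

definition wgrad :: "(real \<times> real) set \<Rightarrow> (real \<times> real \<Rightarrow> real)
    \<Rightarrow> (real \<times> real \<Rightarrow> real) \<times> (real \<times> real \<Rightarrow> real)" where
  "wgrad S u = (SOME g. L2 S (fst g) \<and> L2 S (snd g) \<and> is_wgrad S u (fst g) (snd g))"

definition wconv_L2 :: "real set \<Rightarrow> (real \<Rightarrow> real \<Rightarrow> real) \<Rightarrow> (real \<Rightarrow> real) \<Rightarrow> bool" where
  "wconv_L2 S u U \<longleftrightarrow> (\<forall>g. L2 S g \<longrightarrow>
      ((\<lambda>\<epsilon>. sint S (\<lambda>x. u \<epsilon> x * g x)) \<longlongrightarrow> sint S (\<lambda>x. U x * g x)) (at_right 0))"

definition wconv_H1 :: "real set \<Rightarrow> (real \<Rightarrow> real \<Rightarrow> real) \<Rightarrow> (real \<Rightarrow> real) \<Rightarrow> bool" where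
  "wconv_H1 S u U \<longleftrightarrow> (\<forall>g. H1_1 S g \<longrightarrow>
      ((\<lambda>\<epsilon>. sint S (\<lambda>x. u \<epsilon> x * g x + wderiv S (u \<epsilon>) x * wderiv S g x))
        \<longlongrightarrow> sint S (\<lambda>x. U x * g x + wderiv S U x * wderiv S g x)) (at_right 0))"

definition Rdom :: "real \<Rightarrow> real \<Rightarrow> real \<Rightarrow> (real \<Rightarrow> real) \<Rightarrow> (real \<Rightarrow> real) \<Rightarrow> (real \<times> real) set" where
  "Rdom a b \<epsilon> k1 k2 = {(x,y). a < x \<and> x < b \<and> - \<epsilon> * k1 x < y \<and> y < \<epsilon> * k2 x}"

definition theta :: "real \<Rightarrow> real \<Rightarrow> real \<Rightarrow> real \<Rightarrow> (real \<Rightarrow> real) \<Rightarrow> (real \<Rightarrow> real) \<Rightarrow> (real \<times> real) set" where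
  "theta a b \<gamma> \<epsilon> k2 H = {(x,y). a < x \<and> x < b \<and> \<epsilon> * (k2 x - \<epsilon> powr \<gamma> * H x) < y \<and> y < \<epsilon> * k2 x}"

definition rnorm_L2 :: "real \<Rightarrow> (real \<times> real) set \<Rightarrow> (real \<times> real \<Rightarrow> real) \<Rightarrow> real" where
  "rnorm_L2 \<epsilon> Om u = \<epsilon> powr (-1/2) * sqrt (sint Om (\<lambda>z. (u z)^2))"

definition C1_on :: "real set \<Rightarrow> (real \<Rightarrow> real) \<Rightarrow> bool" where
  "C1_on T k \<longleftrightarrow> (\<exists>k'. continuous_on T k' \<and> (\<forall>x\<in>T. (k has_real_derivative k' x) (at x within T)))"

end

theory Submission
  imports Defs "HOL-Complex_Analysis.Great_Picard" "HOL-Real_Asymp.Real_Asymp"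
begin

text \<open>
  For fixed \<open>\<epsilon>\<close> the solution of the reduced problem is the \<open>H\<^sup>1\<close>-projection of \<open>w\<close> onto the functions of
  \<open>x\<close> alone. Hence \<open>z = w - wh\<close> is orthogonal to its own fibre average, whose derivative differs from
  the average of \<open>z\<^sub>x\<close> only by a term controlled by \<open>\<epsilon> sup |k'|\<close>; together with a Poincare inequality along
  the fibres this bounds the energy norm of \<open>z\<close> by \<open>\<epsilon> sup |k'| + \<epsilon>\<close>.

  For the reduced problems the flux \<open>G = K wh'\<close> is a primitive of \<open>K wh - h\<close>, so the pairs \<open>(wh, G)\<close> are
  bounded and equicontinuous, and Arzela-Ascoli gives uniform limits. In \<open>wh' = G / K\<close> and
  \<open>G' = K wh - h\<close> every product has one uniformly and one weakly convergent factor, so both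
  equations pass to the limit, which explains the coefficient \<open>1 / P\<close>. Uniqueness of the limit problem
  upgrades subsequences to the full family.
\<close>

subsection \<open>Square-integrable functions\<close>

text \<open>The concentrated load is the obstacle: the strip has thickness of order
  \<open>\<epsilon> powr (\<gamma> + 1)\<close>, and the \<open>L2\<close> norm of \<open>z\<close>
  on the whole domain says nothing about its size on so thin a set. What saves the estimate is that
  the fibre average of \<open>z\<close> and the bound on its oscillation are both functions of
  \<open>x\<close> alone. By Fubini such functions gain a factor \<open>sqrt \<tau>\<close> on the
  strip, where \<open>\<tau> = \<epsilon> powr (\<gamma> + 1) * H1\<close>. Hypothesis (F) gives the
  norm of \<open>f\<close> on the strip the same scale, so the weight
  \<open>\<epsilon> powr (-\<gamma>)\<close> is used up and, after rescaling,
  \<open>sqrt (c * H1)\<close> times the slope and thickness terms remains. The same duality bounds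
  the loads of the reduced problems in \<open>L2\<close>. Weak derivatives are \<open>SOME\<close>
  choices, fixed only almost everywhere, so the variational equations are first transferred to
  explicit representatives by uniqueness. In one variable every weak derivative is traded for a
  primitive; this supplies continuous representatives with values at the endpoints, and the Neumann
  condition becomes a statement about means, without any trace theory.\<close>

abbreviation lon :: "'a::euclidean_space set \<Rightarrow> 'a measure" where
  "lon S \<equiv> restrict_space lborel S"

definition L2norm :: "'a::euclidean_space set \<Rightarrow> ('a \<Rightarrow> real) \<Rightarrow> real" where
  "L2norm S u = sqrt (sint S (\<lambda>x. (u x)^2))"

lemma sint_lon: "S \<in> sets borel \<Longrightarrow> sint S f = integral\<^sup>L (lon S) f"
  by (simp add: set_lebesgue_integral_def integral_restrict_space)

lemma set_integrable_lon: "S \<in> sets borel \<Longrightarrow> set_integrable lborel S f = integrable (lon S) f"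
  for f :: "_ \<Rightarrow> real"
  by (simp add: set_integrable_def integrable_restrict_space)

lemma L2_iff:
  assumes "S \<in> sets borel"
  shows "L2 S u \<longleftrightarrow> u \<in> borel_measurable (lon S) \<and> integrable (lon S) (\<lambda>x. (u x)^2)"
  using assms by (simp add: L2_def borel_measurable_restrict_space_iff integrable_restrict_space)

lemma AE_lon:
  assumes "S \<in> sets borel"
  shows "(AE x in lon S. Q x) \<longleftrightarrow> (AE x in lborel. x \<in> S \<longrightarrow> Q x)"
  using assms by (simp add: AE_restrict_space_iff)

lemma L2_measurable: "S \<in> sets borel \<Longrightarrow> L2 S u \<Longrightarrow> u \<in> borel_measurable (lon S)"
  by (simp add: L2_iff)

lemma L2_mult_integrable:
  assumes S: "S \<in> sets borel" and "L2 S u" "L2 S v"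
  shows "integrable (lon S) (\<lambda>x. u x * v x)"
proof -
  have [measurable]: "u \<in> borel_measurable (lon S)" "v \<in> borel_measurable (lon S)"
    using assms by (auto simp: L2_iff)
  have "integrable (lon S) (\<lambda>x. (u x)^2 + (v x)^2)"
    using assms by (auto simp: L2_iff)
  then show ?thesis
  proof (rule Bochner_Integration.integrable_bound)
    show "AE x in lon S. norm (u x * v x) \<le> norm ((u x)\<^sup>2 + (v x)\<^sup>2)"
    proof (rule AE_I2)
      fix x
      have "2 * (\<bar>u x\<bar> * \<bar>v x\<bar>) \<le> (u x)\<^sup>2 + (v x)\<^sup>2"
        using sum_squares_bound[of "\<bar>u x\<bar>" "\<bar>v x\<bar>"] by simp
      moreover have "0 \<le> \<bar>u x\<bar> * \<bar>v x\<bar>" by simp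
      ultimately show "norm (u x * v x) \<le> norm ((u x)\<^sup>2 + (v x)\<^sup>2)"
        unfolding real_norm_def abs_mult by linarith
    qed
  qed measurable
qed

lemma L2_add:
  assumes S: "S \<in> sets borel" and u: "L2 S u" and v: "L2 S v"
  shows "L2 S (\<lambda>x. u x + v x)"
proof -
  have "integrable (lon S) (\<lambda>x. (u x)^2 + (v x)^2 + 2 * (u x * v x))"
    using assms L2_mult_integrable[OF assms] by (auto simp: L2_iff)
  moreover have "(\<lambda>x. (u x)^2 + (v x)^2 + 2 * (u x * v x)) = (\<lambda>x. (u x + v x)^2)"
    by (auto simp: power2_sum)
  ultimately show ?thesis using assms by (auto simp: L2_iff)
qed

lemma L2_AE_bounded_mult:
  assumes S: "S \<in> sets borel" and u: "L2 S u" and g[measurable]: "g \<in> borel_measurable (lon S)"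
    and C: "AE x in lon S. \<bar>g x\<bar> \<le> C"
  shows "L2 S (\<lambda>x. g x * u x)"
proof -
  have [measurable]: "u \<in> borel_measurable (lon S)" using assms by (simp add: L2_iff)
  have "integrable (lon S) (\<lambda>x. C^2 * (u x)^2)" using assms by (simp add: L2_iff)
  then have "integrable (lon S) (\<lambda>x. (g x * u x)^2)"
  proof (rule Bochner_Integration.integrable_bound)
    show "AE x in lon S. norm ((g x * u x)\<^sup>2) \<le> norm (C\<^sup>2 * (u x)\<^sup>2)"
      using C
    proof eventually_elim
      case (elim x)
      then have "(g x)^2 \<le> C^2" by (metis abs_le_square_iff abs_of_nonneg abs_ge_zero order_trans)
      then show "norm ((g x * u x)\<^sup>2) \<le> norm (C\<^sup>2 * (u x)\<^sup>2)"
        by (simp add: power_mult_distrib mult_right_mono)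
    qed
  qed measurable
  then show ?thesis using S by (simp add: L2_iff)
qed

lemma L2_bounded_mult:
  assumes S: "S \<in> sets borel" and u: "L2 S u" and g: "g \<in> borel_measurable (lon S)"
    and C: "\<And>x. x \<in> S \<Longrightarrow> \<bar>g x\<bar> \<le> C"
  shows "L2 S (\<lambda>x. g x * u x)"
  by (rule L2_AE_bounded_mult[OF S u g AE_I2]) (use C in \<open>simp add: space_restrict_space\<close>)

lemma L2_cmult: "S \<in> sets borel \<Longrightarrow> L2 S u \<Longrightarrow> L2 S (\<lambda>x. c * u x)"
  by (rule L2_bounded_mult[where C="\<bar>c\<bar>"]) auto

lemma L2_diff: "S \<in> sets borel \<Longrightarrow> L2 S u \<Longrightarrow> L2 S v \<Longrightarrow> L2 S (\<lambda>x. u x - v x)"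
  using L2_add[of S u "\<lambda>x. (-1) * v x"] L2_cmult[of S v "-1"] by simp

lemma L2_subset:
  assumes "S \<in> sets borel" "T \<in> sets borel" "T \<subseteq> S" "L2 S u" shows "L2 T u"
proof -
  have "set_integrable lborel S (\<lambda>x. (u x)^2)"
    using assms by (simp add: L2_iff set_integrable_lon)
  then have "set_integrable lborel T (\<lambda>x. (u x)^2)"
    by (rule set_integrable_subset) (use assms in auto)
  moreover have "u \<in> borel_measurable (lon T)"
  proof -
    have "set_borel_measurable lborel S u"
      using assms by (simp add: L2_def set_borel_measurable_def)
    then have "set_borel_measurable lborel T u"
      by (rule set_borel_measurable_subset) (use assms in auto)
    then show ?thesis
      using assms by (simp add: set_borel_measurable_def borel_measurable_restrict_space_iff)
  qed
  ultimately show ?thesis using assms by (simp add: L2_iff set_integrable_lon)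
qed

lemma finite_measure_lon:
  assumes "S \<in> sets borel" "bounded S" shows "finite_measure (lon S)"
proof
  show "emeasure (lon S) (space (lon S)) \<noteq> \<infinity>"
    using assms emeasure_bounded_finite[of S]
    by (simp add: space_restrict_space emeasure_restrict_space less_top[symmetric])
qed

lemma L2_bounded:
  assumes S: "S \<in> sets borel" "bounded S" and g: "g \<in> borel_measurable (lon S)"
    and C: "\<And>x. x \<in> S \<Longrightarrow> \<bar>g x\<bar> \<le> C"
  shows "L2 S g"
proof -
  interpret finite_measure "lon S" by (rule finite_measure_lon) fact+
  have "L2 S (\<lambda>x. 1)" using S by (simp add: L2_iff)
  from L2_bounded_mult[OF S(1) this g C] show ?thesis by simp
qed

lemma L2_integrable:
  assumes S: "S \<in> sets borel" "bounded S" and "L2 S u"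
  shows "integrable (lon S) u"
  using L2_mult_integrable[OF S(1) assms(3) L2_bounded[OF S, of "\<lambda>x. 1" 1]] by simp

lemma L2norm_nonneg: "0 \<le> L2norm S u"
  unfolding L2norm_def set_lebesgue_integral_def by (simp add: integral_nonneg_AE)

lemma L2norm_square: "(L2norm S u)^2 = sint S (\<lambda>x. (u x)^2)"
  unfolding L2norm_def set_lebesgue_integral_def by (simp add: integral_nonneg_AE)

lemma L2_Cauchy_Schwarz:
  assumes S: "S \<in> sets borel" and u: "L2 S u" and v: "L2 S v"
  shows "\<bar>sint S (\<lambda>x. u x * v x)\<bar> \<le> L2norm S u * L2norm S v"
proof -
  define A B C where "A = sint S (\<lambda>x. (u x)^2)" and "B = sint S (\<lambda>x. u x * v x)"
    and "C = sint S (\<lambda>x. (v x)^2)"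
  have A0: "0 \<le> A" "0 \<le> C" unfolding A_def C_def
    using L2norm_square[of S] by (metis zero_le_power2)+
  \<comment> \<open>The squared norm of \<open>u + t v\<close>, read as a quadratic in
    \<open>t\<close>; the claim is that its discriminant is not positive.\<close>
  have quad: "0 \<le> A + 2 * t * B + t^2 * C" for t
  proof -
    have "0 \<le> sint S (\<lambda>x. (u x + t * v x)^2)"
      using L2norm_square[of S] by (metis zero_le_power2)
    also have "\<dots> = integral\<^sup>L (lon S) (\<lambda>x. (u x)^2 + 2 * t * (u x * v x) + t^2 * (v x)^2)"
      unfolding sint_lon[OF S] by (rule Bochner_Integration.integral_cong) (auto simp: power2_eq_square algebra_simps)
    also have "\<dots> = A + 2 * t * B + t^2 * C"
      unfolding A_def B_def C_def sint_lon[OF S]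
      using L2_mult_integrable[OF S u v] u v S by (simp add: L2_iff)
    finally show ?thesis .
  qed
  have "B^2 \<le> A * C"
  proof (cases "C = 0")
    case True
    have "B = 0"
    proof (rule ccontr)
      assume "B \<noteq> 0"
      \<comment> \<open>With \<open>C = 0\<close> the quadratic is affine in \<open>t\<close>, and
        this \<open>t\<close> gives it the value \<open>-1\<close>.\<close>
      then have "2 * (-(A+1)/(2*B)) * B = -(A+1)" by (simp add: field_simps)
      then show False using quad[of "-(A+1)/(2*B)"] True by simp
    qed
    then show ?thesis using A0 by simp
  next
    case False
    then have C: "C > 0" using A0 by simp
    have "0 \<le> A - B^2/C"
      using quad[of "-B/C"] C by (simp add: power2_eq_square field_simps)
    then show ?thesis using C by (simp add: field_simps)
  qed
  then have "sqrt (B^2) \<le> sqrt (A * C)" by (rule real_sqrt_le_mono)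
  then show ?thesis unfolding A_def B_def C_def L2norm_def by (simp add: real_sqrt_mult)
qed

lemma L2norm_triangle:
  assumes S: "S \<in> sets borel" and u: "L2 S u" and v: "L2 S v"
  shows "L2norm S (\<lambda>x. u x + v x) \<le> L2norm S u + L2norm S v"
proof (rule power2_le_imp_le)
  have "(L2norm S (\<lambda>x. u x + v x))^2 = integral\<^sup>L (lon S) (\<lambda>x. (u x)^2 + (v x)^2 + 2 * (u x * v x))"
    unfolding L2norm_square sint_lon[OF S] by (simp add: power2_sum algebra_simps)
  also have "\<dots> = (L2norm S u)^2 + (L2norm S v)^2 + 2 * sint S (\<lambda>x. u x * v x)"
    unfolding L2norm_square sint_lon[OF S] using L2_mult_integrable[OF S u v] u v S by (simp add: L2_iff)
  also have "\<dots> \<le> (L2norm S u + L2norm S v)^2"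
    using L2_Cauchy_Schwarz[OF S u v] by (simp add: power2_sum)
  finally show "(L2norm S (\<lambda>x. u x + v x))^2 \<le> (L2norm S u + L2norm S v)^2" .
qed (intro add_nonneg_nonneg L2norm_nonneg)

lemma L2norm_mono:
  assumes S: "S \<in> sets borel" and u: "L2 S u" and v: "L2 S v" and le: "AE x in lon S. \<bar>u x\<bar> \<le> \<bar>v x\<bar>"
  shows "L2norm S u \<le> L2norm S v"
  unfolding L2norm_def sint_lon[OF S]
proof (rule real_sqrt_le_mono, rule integral_mono_AE)
  show "AE x in lon S. (u x)^2 \<le> (v x)^2" using le by eventually_elim (simp add: abs_le_square_iff)
qed (use u v S in \<open>auto simp: L2_iff\<close>)

lemma L2norm_cmult: "L2norm S (\<lambda>x. c * u x) = \<bar>c\<bar> * L2norm S u"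
  unfolding L2norm_def by (simp add: power_mult_distrib real_sqrt_mult)

lemma L2norm_const:
  assumes "a < b" shows "L2norm {a<..<b} (\<lambda>x. c) = \<bar>c\<bar> * sqrt (b - a)"
proof -
  have "sint {a<..<b} (\<lambda>x. c^2) = c^2 * (b - a)"
    using assms by (simp add: set_lebesgue_integral_def)
  then show ?thesis unfolding L2norm_def by (simp add: real_sqrt_mult)
qed

lemma L2_const: "L2 {a<..<b::real} (\<lambda>x. c)"
  by (rule L2_bounded[where C="\<bar>c\<bar>"]) auto

text \<open>The positive and the negative part of \<open>v\<close> are densities of two finite
  measures that agree on boxes. Boxes are stable under intersection and generate the Borel sets, so
  the measures coincide, and finite measures determine their densities almost everywhere.\<close>

lemma AE_zero_if_box_integrals_zero:
  fixes v :: "'a::euclidean_space \<Rightarrow> real"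
  assumes v: "integrable lborel v"
    and z: "\<And>c d. (\<integral>x. indicator (box c d) x * v x \<partial>lborel) = 0"
  shows "AE x in lborel. v x = 0"
proof -
  have [measurable]: "v \<in> borel_measurable borel" using v by auto
  let ?p = "\<lambda>x. ennreal (max 0 (v x))" and ?n = "\<lambda>x. ennreal (max 0 (- v x))"
  have ip: "integrable lborel (\<lambda>x. max 0 (v x))" "integrable lborel (\<lambda>x. max 0 (- v x))"
    using v by auto
  have fin: "(\<integral>\<^sup>+x. ?p x \<partial>lborel) \<noteq> \<infinity>"
    using ip by (simp add: nn_integral_eq_integral)
  have "density lborel ?p = density lborel ?n"
  proof (rule measure_eqI_generator_eq[where \<Omega>=UNIV and E="range (\<lambda>(a,b). box a b :: 'a set)"
        and A="\<lambda>n::nat. box (- (real n *\<^sub>R One)) (real n *\<^sub>R One)"])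
    show "Int_stable (range (\<lambda>(a,b). box a b :: 'a set))"
      by (auto simp: Int_stable_def box_Int_box)
    show "sets (density lborel ?p) = sigma_sets UNIV (range (\<lambda>(a,b). box a b :: 'a set))"
      "sets (density lborel ?n) = sigma_sets UNIV (range (\<lambda>(a,b). box a b :: 'a set))"
      by (simp_all add: borel_eq_box)
    show "(\<Union>i::nat. box (- (real i *\<^sub>R One)) (real i *\<^sub>R One)) = (UNIV::'a set)"
      by (rule UN_box_eq_UNIV)
    fix X assume "X \<in> range (\<lambda>(a,b). box a b :: 'a set)"
    then obtain c d where X: "X = box c d" by auto
    have i: "integrable lborel (\<lambda>x. indicator X x * max 0 (v x))"
      "integrable lborel (\<lambda>x. indicator X x * max 0 (- v x))"
      using integrable_mult_indicator[OF _ ip(1), of X] integrable_mult_indicator[OF _ ip(2), of X]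
      by (auto simp: X)
    have "(\<integral>x. indicator X x * max 0 (v x) \<partial>lborel) - (\<integral>x. indicator X x * max 0 (- v x) \<partial>lborel)
      = (\<integral>x. indicator X x * v x \<partial>lborel)"
      by (subst Bochner_Integration.integral_diff[OF i, symmetric])
         (auto intro!: Bochner_Integration.integral_cong simp: max_def)
    also have "\<dots> = 0" using z by (simp add: X)
    finally have eq: "(\<integral>x. indicator X x * max 0 (v x) \<partial>lborel) = (\<integral>x. indicator X x * max 0 (- v x) \<partial>lborel)"
      by simp
    have "emeasure (density lborel ?p) X = (\<integral>\<^sup>+x. ennreal (indicator X x * max 0 (v x)) \<partial>lborel)"
      by (subst emeasure_density) (auto simp: X intro!: nn_integral_cong split: split_indicator)
    also have "\<dots> = (\<integral>\<^sup>+x. ennreal (indicator X x * max 0 (- v x)) \<partial>lborel)"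
      using i eq by (simp add: nn_integral_eq_integral)
    also have "\<dots> = emeasure (density lborel ?n) X"
      by (subst emeasure_density) (auto simp: X intro!: nn_integral_cong split: split_indicator)
    finally show "emeasure (density lborel ?p) X = emeasure (density lborel ?n) X" .
  next
    fix i :: nat
    have "emeasure (density lborel ?p) (box (- (real i *\<^sub>R One)) (real i *\<^sub>R One)) \<le> (\<integral>\<^sup>+x. ?p x \<partial>lborel)"
      by (subst emeasure_density) (auto intro!: nn_integral_mono split: split_indicator)
    then show "emeasure (density lborel ?p) (box (- (real i *\<^sub>R One)) (real i *\<^sub>R One)) \<noteq> \<infinity>"
      using fin by (auto simp: top_unique)
  qed auto
  then have "AE x in lborel. ?p x = ?n x"
    by (subst (asm) finite_density_unique) (use fin in auto)
  then show ?thesis by eventually_elim (auto simp: max_def split: if_splits)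
qed

section \<open>Cut-off functions of class \<open>C\<^sup>1\<close> and test functions of one
  variable\<close>

definition ramp :: "real \<Rightarrow> real" where
  "ramp t = (max 0 t)^2 / (1 + (max 0 t)^2)"

text \<open>Squaring the positive part removes its kink: away from \<open>0\<close> the square is
  locally \<open>0\<close> or \<open>t^2\<close>, and at \<open>0\<close> the difference quotient is
  at most \<open>\<bar>h\<bar>\<close>.\<close>

lemma ramp_deriv: "(ramp has_real_derivative (2 * max 0 t / (1 + (max 0 t)^2)^2)) (at t)"
proof -
  have q: "((\<lambda>t. (max 0 t)^2) has_real_derivative 2 * max 0 t) (at t)" for t :: real
  proof -
    consider "t < 0" | "t = 0" | "t > 0" by linarith
    then show ?thesis
    proof cases
      case 1
      have "((\<lambda>t::real. 0) has_real_derivative 0) (at t)" by simp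
      then have "((\<lambda>t. (max 0 t)^2) has_real_derivative 0) (at t)"
        by (rule has_field_derivative_transform_within_open[of _ _ _ "{..<0}"]) (use 1 in auto)
      then show ?thesis using 1 by simp
    next
      case 2
      have "((\<lambda>h. ((max 0 (0+h))^2 - (max 0 0)^2) / h) \<longlongrightarrow> (0::real)) (at 0)"
      proof (rule Lim_null_comparison)
        show "\<forall>\<^sub>F h in at 0. norm (((max 0 (0+h))^2 - (max 0 0)^2) / h) \<le> \<bar>h::real\<bar>"
          by (auto simp: max_def power2_eq_square eventually_at_filter)
        show "((\<lambda>h::real. \<bar>h\<bar>) \<longlongrightarrow> 0) (at 0)"
          by (auto intro!: tendsto_eq_intros)
      qed
      then show ?thesis using 2 unfolding DERIV_def by simp
    next
      case 3
      have "((\<lambda>t::real. t^2) has_real_derivative 2 * t) (at t)"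
        by (auto intro!: derivative_eq_intros)
      then have "((\<lambda>t. (max 0 t)^2) has_real_derivative 2 * t) (at t)"
        by (rule has_field_derivative_transform_within_open[of _ _ _ "{0<..}"]) (use 3 in auto)
      then show ?thesis using 3 by simp
    qed
  qed
  have nz: "1 + (max 0 t)^2 \<noteq> (0::real)" by (smt (verit) zero_le_power2)
  have "((\<lambda>t. 1 + (max 0 t)^2) has_real_derivative 2 * max 0 t) (at t)"
    using DERIV_add[OF DERIV_const[of 1] q] by simp
  from DERIV_divide[OF q this nz] show ?thesis unfolding ramp_def
    by (rule DERIV_cong) (use nz in \<open>simp add: field_simps power2_eq_square\<close>)
qed

lemma ramp_bounds: "0 \<le> ramp t" "ramp t \<le> 1"
proof -
  have "0 \<le> (max 0 t)\<^sup>2" by simp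
  then show "0 \<le> ramp t" "ramp t \<le> 1" by (simp_all add: ramp_def divide_simps add_pos_nonneg)
qed

lemma ramp_eq_0: "t \<le> 0 \<Longrightarrow> ramp t = 0"
  by (simp add: ramp_def)

lemma ramp_at_top: "(ramp \<longlongrightarrow> 1) at_top"
proof -
  have "((\<lambda>t::real. t^2 / (1 + t^2)) \<longlongrightarrow> 1) at_top" by real_asymp
  moreover have "eventually (\<lambda>t::real. t^2 / (1 + t^2) = ramp t) at_top"
    using eventually_gt_at_top[of 0] by eventually_elim (simp add: ramp_def)
  ultimately show ?thesis by (rule Lim_transform_eventually)
qed

text \<open>The shift by \<open>-1\<close> makes each factor vanish up to distance
  \<open>1 / Suc n\<close> from its endpoint, so the support is compact in the open interval for
  every \<open>n\<close>. At an interior point both arguments tend to infinity, and the product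
  tends to \<open>1\<close>.\<close>

definition bump :: "real \<Rightarrow> real \<Rightarrow> nat \<Rightarrow> real \<Rightarrow> real" where
  "bump c d n t = ramp (real (Suc n) * (t - c) - 1) * ramp (real (Suc n) * (d - t) - 1)"

lemma test1I:
  assumes d: "\<And>x. (\<phi> has_real_derivative \<phi>' x) (at x)" and c: "continuous_on UNIV \<phi>'"
    and K: "compact K" "K \<subseteq> S" "\<And>x. x \<notin> K \<Longrightarrow> \<phi> x = 0"
  shows "test1 S \<phi>" "deriv \<phi> = \<phi>'"
proof -
  show eq: "deriv \<phi> = \<phi>'" using DERIV_imp_deriv[OF d] by auto
  show "test1 S \<phi>" unfolding test1_def eq
    using assms by (auto simp: real_differentiable_def)
qed

lemma bump_bounds: "0 \<le> bump c d n t" "bump c d n t \<le> 1"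
  unfolding bump_def using ramp_bounds by (auto intro!: mult_le_one)

lemma bump_eq_0: "t \<notin> {c<..<d} \<Longrightarrow> bump c d n t = 0"
proof -
  assume "t \<notin> {c<..<d}"
  then consider "t \<le> c" | "d \<le> t" by force
  then show ?thesis
  proof cases
    case 1
    then have "real (Suc n) * (t - c) \<le> 0" by (simp add: mult_nonneg_nonpos)
    then show ?thesis by (simp add: bump_def ramp_eq_0)
  next
    case 2
    then have "real (Suc n) * (d - t) \<le> 0" by (simp add: mult_nonneg_nonpos)
    then show ?thesis by (simp add: bump_def ramp_eq_0)
  qed
qed

lemma bump_tendsto: "(\<lambda>n. bump c d n t) \<longlonglongrightarrow> indicator {c<..<d} t"
proof (cases "t \<in> {c<..<d}")
  case True
  have "filterlim (\<lambda>n. real (Suc n) * e - 1) at_top sequentially" if "e > 0" for e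
    using that by real_asymp
  then have "(\<lambda>n. ramp (real (Suc n) * (t - c) - 1)) \<longlonglongrightarrow> 1"
    "(\<lambda>n. ramp (real (Suc n) * (d - t) - 1)) \<longlonglongrightarrow> 1"
    using True by (auto intro!: filterlim_compose[OF ramp_at_top])
  from tendsto_mult[OF this] show ?thesis using True by (simp add: bump_def)
next
  case False
  then show ?thesis by (simp add: bump_eq_0)
qed

lemma bump_test1: "test1 {c<..<d} (bump c d n)"
proof -
  define r' where "r' t = 2 * max 0 t / (1 + (max 0 t)^2)^2" for t :: real
  have r: "(ramp has_real_derivative r' t) (at t)" for t unfolding r'_def by (rule ramp_deriv)
  let ?N = "real (Suc n)"
  have [simp]: "1 + (max 0 t)^2 \<noteq> (0::real)" for t by (smt (verit) zero_le_power2)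
  have cr: "continuous_on UNIV r'" unfolding r'_def by (intro continuous_intros) auto
  have cra: "continuous_on UNIV ramp"
    using DERIV_isCont[OF r] by (auto intro: continuous_at_imp_continuous_on)
  let ?d = "\<lambda>t. r' (?N * (t - c) - 1) * ?N * ramp (?N * (d - t) - 1)
     + ramp (?N * (t - c) - 1) * (r' (?N * (d - t) - 1) * (- ?N))"
  show ?thesis
  proof (rule test1I(1)[where \<phi>'="?d" and K="{c + 1/?N..d - 1/?N}"])
    fix t
    have 1: "((\<lambda>t. ramp (?N * (t - c) - 1)) has_real_derivative r' (?N * (t - c) - 1) * ?N) (at t)"
      by (rule DERIV_chain2[OF r]) (auto intro!: derivative_eq_intros)
    have 2: "((\<lambda>t. ramp (?N * (d - t) - 1)) has_real_derivative r' (?N * (d - t) - 1) * (- ?N)) (at t)"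
      by (rule DERIV_chain2[OF r]) (auto intro!: derivative_eq_intros)
    show "(bump c d n has_real_derivative ?d t) (at t)"
      using DERIV_mult[OF 1 2] unfolding bump_def by (simp add: mult.commute add.commute)
  next
    show "continuous_on UNIV ?d"
      by (intro continuous_intros continuous_on_compose2[OF cr] continuous_on_compose2[OF cra]) auto
    show "{c + 1 / ?N..d - 1 / ?N} \<subseteq> {c<..<d}"
    proof
      fix t assume t: "t \<in> {c + 1 / ?N..d - 1 / ?N}"
      have "0 < 1 / ?N" by simp
      then show "t \<in> {c<..<d}" using t by (simp only: atLeastAtMost_iff greaterThanLessThan_iff) linarith
    qed
    fix t assume "t \<notin> {c + 1/?N..d - 1/?N}"
    then have "t < c + 1/?N \<or> d - 1/?N < t" by auto
    then have "?N * (t - c) - 1 \<le> 0 \<or> ?N * (d - t) - 1 \<le> 0" by (auto simp: field_simps)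
    then show "bump c d n t = 0" unfolding bump_def using ramp_eq_0 by auto
  qed auto
qed

lemma test1_DERIV: "test1 S \<phi> \<Longrightarrow> (\<phi> has_real_derivative deriv \<phi> x) (at x)"
  unfolding test1_def by (metis DERIV_deriv_iff_real_differentiable)

lemma test1_continuous: "test1 S \<phi> \<Longrightarrow> continuous_on A \<phi>"
  using test1_DERIV DERIV_isCont continuous_at_imp_continuous_on by blast

lemma test1_deriv_continuous: "test1 S \<phi> \<Longrightarrow> continuous_on A (deriv \<phi>)"
  unfolding test1_def using continuous_on_subset by blast

text \<open>The complement of \<open>K\<close> is open, so \<open>\<phi>\<close> is locally
  \<open>0\<close> there; one compact set thus serves the function and its derivative.\<close>

lemma test1_support:
  assumes "test1 S \<phi>"
  obtains K where "compact K" "K \<subseteq> S" "\<And>x. x \<notin> K \<Longrightarrow> \<phi> x = 0" "\<And>x. x \<notin> K \<Longrightarrow> deriv \<phi> x = 0"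
proof -
  obtain K where K: "compact K" "K \<subseteq> S" "\<And>x. x \<notin> K \<Longrightarrow> \<phi> x = 0"
    using assms unfolding test1_def by auto
  have "deriv \<phi> x = 0" if "x \<notin> K" for x
  proof (rule DERIV_imp_deriv)
    have "((\<lambda>x. 0::real) has_real_derivative 0) (at x)" by simp
    then show "(\<phi> has_real_derivative 0) (at x)"
      by (rule has_field_derivative_transform_within_open[of _ _ _ "-K"])
        (use K that compact_imp_closed in auto)
  qed
  with K show ?thesis using that by blast
qed

lemma test1_bounded:
  assumes "test1 S \<phi>"
  obtains C where "\<And>x. \<bar>\<phi> x\<bar> \<le> C" "\<And>x. \<bar>deriv \<phi> x\<bar> \<le> C"
proof -
  obtain K where K: "compact K" "\<And>x. x \<notin> K \<Longrightarrow> \<phi> x = 0" "\<And>x. x \<notin> K \<Longrightarrow> deriv \<phi> x = 0"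
    using test1_support[OF assms] by metis
  have "bounded (\<phi> ` K)" "bounded (deriv \<phi> ` K)"
    using K(1) assms by (auto intro!: compact_imp_bounded compact_continuous_image test1_continuous test1_deriv_continuous)
  then obtain B1 B2 where B: "\<And>x. x \<in> K \<Longrightarrow> \<bar>\<phi> x\<bar> \<le> B1" "\<And>x. x \<in> K \<Longrightarrow> \<bar>deriv \<phi> x\<bar> \<le> B2"
    by (auto simp: bounded_iff)
  show ?thesis
  proof (rule that[of "max 0 (max B1 B2)"])
    show "\<bar>\<phi> x\<bar> \<le> max 0 (max B1 B2)" for x
      using K(2) B(1)[of x] by (cases "x \<in> K") (auto simp: le_max_iff_disj)
    show "\<bar>deriv \<phi> x\<bar> \<le> max 0 (max B1 B2)" for x
      using K(3) B(2)[of x] by (cases "x \<in> K") (auto simp: le_max_iff_disj)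
  qed
qed

lemma test1_measurable:
  assumes "test1 S \<phi>" shows "\<phi> \<in> borel_measurable borel" "deriv \<phi> \<in> borel_measurable borel"
  using test1_continuous[OF assms] test1_deriv_continuous[OF assms]
  by (auto intro: borel_measurable_continuous_onI)

subsection \<open>The fundamental lemma and Sobolev functions of one variable\<close>

lemma Ioo_borel[simp]: "{a<..<b::real} \<in> sets borel" by simp

lemma id_measurable_lon [measurable]: "(\<lambda>x. x) \<in> borel_measurable (lon S)"
  by (intro measurable_restrict_space1) simp

lemma fst_snd_measurable_lon:
  assumes "f \<in> borel_measurable borel"
  shows "(\<lambda>z. f (fst z)) \<in> borel_measurable (lon (S :: (real \<times> real) set))"
    "(\<lambda>z. f (snd z)) \<in> borel_measurable (lon (S :: (real \<times> real) set))"
proof -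
  have "fst \<in> borel_measurable (lon (S :: (real \<times> real) set))" "snd \<in> borel_measurable (lon (S :: (real \<times> real) set))"
    by (auto intro!: measurable_restrict_space1 borel_measurable_continuous_onI continuous_intros)
  from this[THEN measurable_compose, OF assms] show
    "(\<lambda>z. f (fst z)) \<in> borel_measurable (lon (S :: (real \<times> real) set))"
    "(\<lambda>z. f (snd z)) \<in> borel_measurable (lon (S :: (real \<times> real) set))" by auto
qed

lemma test1_mono: "test1 S \<phi> \<Longrightarrow> S \<subseteq> T \<Longrightarrow> test1 T \<phi>"
  unfolding test1_def by (meson order_trans)

text \<open>Localisation of the global version: \<open>S\<close> is a countable union of boxes
  inside \<open>S\<close>, and cutting \<open>v\<close> off to one of them keeps the hypothesis
  because two boxes meet in a box.\<close>

lemma AE_zero_if_open_box_integrals_zero: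
  fixes v :: "'a::euclidean_space \<Rightarrow> real"
  assumes S: "open S" and v: "integrable (lon S) v"
    and z: "\<And>c d. box c d \<subseteq> S \<Longrightarrow> sint (box c d) v = 0"
  shows "AE x in lon S. v x = 0"
proof -
  have Sb: "S \<in> sets borel" using S by simp
  obtain \<D> where D: "countable \<D>" "\<D> \<subseteq> Pow S" "\<And>X. X \<in> \<D> \<Longrightarrow> \<exists>a b. X = box a b" "\<Union>\<D> = S"
    using open_countable_Union_open_box[OF S] by metis
  have "AE x in lborel. x \<in> X \<longrightarrow> v x = 0" if X: "X \<in> \<D>" for X
  proof -
    obtain p q where pq: "X = box p q" using D(3)[OF X] by auto
    have XS: "X \<subseteq> S" using D(2) X by auto
    have "set_integrable lborel X v"
      by (rule set_integrable_subset[of _ S]) (use v XS Sb pq in \<open>auto simp: set_integrable_lon\<close>)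
    then have i: "integrable lborel (\<lambda>x. indicator X x * v x)" by (simp add: set_integrable_def)
    have "AE x in lborel. indicator X x * v x = 0"
    proof (rule AE_zero_if_box_integrals_zero[OF i])
      fix c d
      obtain e f where ef: "box c d \<inter> X = box e f" unfolding pq box_Int_box by blast
      have "(\<integral>x. indicator (box c d) x * (indicator X x * v x) \<partial>lborel) = sint (box e f) v"
        unfolding set_lebesgue_integral_def
        by (intro Bochner_Integration.integral_cong) (auto simp: ef[symmetric] split: split_indicator)
      also have "\<dots> = 0" using ef XS by (intro z) auto
      finally show "(\<integral>x. indicator (box c d) x * (indicator X x * v x) \<partial>lborel) = 0" .
    qed
    then show ?thesis by eventually_elim (auto simp: indicator_def)
  qed
  then have "AE x in lborel. \<forall>X\<in>\<D>. x \<in> X \<longrightarrow> v x = 0"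
    using D(1) by (subst AE_ball_countable) auto
  then show ?thesis unfolding AE_lon[OF Sb]
    by eventually_elim (use D(4) in auto)
qed

text \<open>Bumps converge boundedly to the indicator of their interval, so dominated convergence
  with majorant \<open>\<bar>v\<bar>\<close> turns test functions into box integrals.\<close>

lemma fundamental_lemma_1:
  assumes v: "integrable (lon {a<..<b}) v"
    and z: "\<And>\<phi>. test1 {a<..<b} \<phi> \<Longrightarrow> sint {a<..<b} (\<lambda>x. v x * \<phi> x) = 0"
  shows "AE x in lon {a<..<b}. v x = 0"
proof (rule AE_zero_if_open_box_integrals_zero[OF _ v])
  fix c d :: real assume cd: "box c d \<subseteq> {a<..<b}"
  let ?I = "{a<..<b}"
  have [measurable]: "v \<in> borel_measurable (lon ?I)" using v by auto
  have [measurable]: "bump c d n \<in> borel_measurable (lon ?I)" for n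
    using test1_measurable(1)[OF bump_test1] by (intro measurable_restrict_space1) simp
  have "(\<lambda>n. integral\<^sup>L (lon ?I) (\<lambda>x. v x * bump c d n x)) \<longlonglongrightarrow> integral\<^sup>L (lon ?I) (\<lambda>x. v x * indicator {c<..<d} x)"
  proof (rule integral_dominated_convergence)
    show "integrable (lon ?I) (\<lambda>x. \<bar>v x\<bar>)" using v by auto
    show "AE x in lon ?I. (\<lambda>i. v x * bump c d i x) \<longlonglongrightarrow> v x * indicator {c<..<d} x"
      by (intro AE_I2 tendsto_intros bump_tendsto)
    show "AE x in lon ?I. norm (v x * bump c d i x) \<le> \<bar>v x\<bar>" for i
      using bump_bounds by (auto simp: abs_mult mult_left_le)
  qed measurable
  moreover have "integral\<^sup>L (lon ?I) (\<lambda>x. v x * bump c d n x) = 0" for n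
  proof -
    have "test1 ?I (bump c d n)"
      using cd by (intro test1_mono[OF bump_test1]) simp
    from z[OF this] show ?thesis by (simp add: sint_lon)
  qed
  ultimately have "integral\<^sup>L (lon ?I) (\<lambda>x. v x * indicator {c<..<d} x) = 0"
    by (simp add: LIMSEQ_const_iff)
  also have "integral\<^sup>L (lon ?I) (\<lambda>x. v x * indicator {c<..<d} x) = sint (box c d) v"
    using cd unfolding sint_lon[OF Ioo_borel, symmetric] set_lebesgue_integral_def
    by (intro Bochner_Integration.integral_cong) (auto split: split_indicator)
  finally show "sint (box c d) v = 0" .
qed simp

text \<open>Products of bumps already converge to indicators of rectangles. Asking for product test
  functions only lets later proofs work with one factor at a time.\<close>

lemma fundamental_lemma_2:
  fixes v :: "real \<times> real \<Rightarrow> real"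
  assumes S: "open S" and v: "integrable (lon S) v"
    and z: "\<And>c d c' d' \<phi> \<psi>. {c<..<d} \<times> {c'<..<d'} \<subseteq> S \<Longrightarrow> test1 {c<..<d} \<phi> \<Longrightarrow> test1 {c'<..<d'} \<psi> \<Longrightarrow>
       sint S (\<lambda>x. v x * (\<phi> (fst x) * \<psi> (snd x))) = 0"
  shows "AE x in lon S. v x = 0"
proof (rule AE_zero_if_open_box_integrals_zero[OF S v])
  fix p q :: "real \<times> real" assume cd: "box p q \<subseteq> S"
  obtain c c' d d' where pq: "p = (c,c')" "q = (d,d')" by (metis surj_pair)
  have box: "box p q = {c<..<d} \<times> {c'<..<d'}" by (simp add: box_prod pq)
  have [simp]: "S \<in> sets borel" using S by simp
  have vm: "v \<in> borel_measurable (lon S)" using v by auto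
  let ?g = "\<lambda>n x. bump c d n (fst x) * bump c' d' n (snd x)"
  have [simp]: "bump c d n \<in> borel_measurable borel" for c d n
    using test1_measurable(1)[OF bump_test1] .
  have gm: "?g n \<in> borel_measurable (lon S)" for n
    by (intro borel_measurable_times fst_snd_measurable_lon) auto
  let ?i = "\<lambda>x. indicator {c<..<d} (fst x) * indicator {c'<..<d'} (snd x) :: real"
  have im: "?i \<in> borel_measurable (lon S)"
    by (intro borel_measurable_times fst_snd_measurable_lon) auto
  have "(\<lambda>n. integral\<^sup>L (lon S) (\<lambda>x. v x * ?g n x)) \<longlonglongrightarrow> integral\<^sup>L (lon S) (\<lambda>x. v x * ?i x)"
  proof (rule integral_dominated_convergence)
    show "integrable (lon S) (\<lambda>x. \<bar>v x\<bar>)" using v by auto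
    show "AE x in lon S. (\<lambda>i. v x * ?g i x) \<longlonglongrightarrow> v x * ?i x"
      by (intro AE_I2 tendsto_intros bump_tendsto)
    show "AE x in lon S. norm (v x * ?g i x) \<le> \<bar>v x\<bar>" for i
      using bump_bounds by (auto simp: abs_mult intro!: mult_left_le mult_le_one)
  qed (use vm gm im in \<open>auto intro!: borel_measurable_times\<close>)
  moreover have "integral\<^sup>L (lon S) (\<lambda>x. v x * ?g n x) = 0" for n
    using z[OF _ bump_test1[of c d n] bump_test1[of c' d' n]] cd by (simp add: box sint_lon)
  ultimately have "integral\<^sup>L (lon S) (\<lambda>x. v x * ?i x) = 0"
    by (simp add: LIMSEQ_const_iff)
  also have "integral\<^sup>L (lon S) (\<lambda>x. v x * ?i x) = sint (box p q) v"
    using cd unfolding sint_lon[of S, symmetric, simplified] set_lebesgue_integral_def box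
    by (intro Bochner_Integration.integral_cong) (auto split: split_indicator)
  finally show "sint (box p q) v = 0" .
qed

text \<open>Writing the upper limit as an indicator makes this a function on all reals: it is
  \<open>0\<close> left of \<open>a\<close> and constant right of \<open>b\<close>. Boundary values
  at \<open>a\<close> and \<open>b\<close> are then plain evaluations.\<close>

definition prim :: "real \<Rightarrow> real \<Rightarrow> (real \<Rightarrow> real) \<Rightarrow> real \<Rightarrow> real" where
  "prim a b v x = integral\<^sup>L (lon {a<..<b}) (\<lambda>t. indicator {..x} t * v t)"

lemma integrable_indicator_mult:
  fixes f :: "'a \<Rightarrow> real"
  assumes "integrable M f" "A \<in> sets borel" "g \<in> borel_measurable M"
  shows "integrable M (\<lambda>x. indicator A (g x) * f x)"
  by (rule Bochner_Integration.integrable_bound[OF assms(1)])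
    (use assms in \<open>auto split: split_indicator\<close>)

lemma integrable_ind_lon:
  fixes f :: "real \<Rightarrow> real"
  assumes "integrable (lon S) f" "A \<in> sets borel"
  shows "integrable (lon S) (\<lambda>x. indicator A x * f x)"
  by (rule integrable_indicator_mult[OF assms id_measurable_lon])

lemma prim_diff:
  assumes v: "integrable (lon {a<..<b}) v" and xy: "x \<le> y"
  shows "prim a b v y - prim a b v x = integral\<^sup>L (lon {a<..<b}) (\<lambda>t. indicator {x<..y} t * v t)"
  unfolding prim_def
  by (subst Bochner_Integration.integral_diff[symmetric])
    (use xy v in \<open>auto intro!: Bochner_Integration.integral_cong integrable_ind_lon split: split_indicator\<close>)

lemma L2norm_indicator_le:
  assumes "a < b" "x \<le> y"
  shows "L2 {a<..<b} (indicator {x<..y})" "L2norm {a<..<b} (indicator {x<..y}) \<le> sqrt (y - x)"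
proof -
  show "L2 {a<..<b} (indicator {x<..y})"
    by (rule L2_bounded[where C=1]) (auto split: split_indicator)
  have "sint {a<..<b} (\<lambda>t. (indicator {x<..y} t)^2) \<le> y - x"
  proof -
    have "sint {a<..<b} (\<lambda>t. (indicator {x<..y} t)^2) = measure lborel ({a<..<b} \<inter> {x<..y})"
      unfolding set_lebesgue_integral_def
      by (subst Bochner_Integration.integral_cong[OF refl, where g="indicator ({a<..<b} \<inter> {x<..y})"])
         (auto split: split_indicator)
    also have "\<dots> \<le> measure lborel {x<..y}"
      by (rule measure_mono_fmeasurable) (use assms in \<open>auto simp: fmeasurable_def\<close>)
    also have "\<dots> = y - x" using assms by simp
    finally show ?thesis .
  qed
  then show "L2norm {a<..<b} (indicator {x<..y}) \<le> sqrt (y - x)"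
    unfolding L2norm_def by simp
qed

text \<open>Cauchy-Schwarz against the indicator of the interval between \<open>x\<close> and
  \<open>y\<close>. The constant involves only the \<open>L2\<close> norm of \<open>v\<close>, which
  makes families of primitives equicontinuous.\<close>

lemma prim_Hoelder:
  assumes ab: "a < b" and v: "L2 {a<..<b} v"
  shows "\<bar>prim a b v y - prim a b v x\<bar> \<le> sqrt \<bar>y - x\<bar> * L2norm {a<..<b} v"
proof -
  have vi: "integrable (lon {a<..<b}) v" using v by (intro L2_integrable) auto
  have *: "\<bar>prim a b v y - prim a b v x\<bar> \<le> sqrt (y - x) * L2norm {a<..<b} v" if "x \<le> y" for x y
    unfolding prim_diff[OF vi that] sint_lon[OF Ioo_borel, symmetric]
    using L2_Cauchy_Schwarz[OF _ L2norm_indicator_le(1)[OF ab that] v]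
      mult_right_mono[OF L2norm_indicator_le(2)[OF ab that] L2norm_nonneg[of "{a<..<b}" v]]
    by simp
  show ?thesis using *[of x y] *[of y x] by (cases "x \<le> y") (auto simp: abs_minus_commute)
qed

lemma prim_continuous:
  assumes ab: "a < b" and v: "L2 {a<..<b} v"
  shows "continuous_on A (prim a b v)"
proof -
  have "isCont (prim a b v) x" for x
    unfolding isCont_def
  proof (rule Lim_transform_within[OF _ zero_less_one], rule LIM_zero_cancel, rule Lim_null_comparison)
    show "\<forall>\<^sub>F y in at x. norm (prim a b v y - prim a b v x) \<le> sqrt \<bar>y - x\<bar> * L2norm {a<..<b} v"
      using prim_Hoelder[OF assms] by simp
    show "((\<lambda>y. sqrt \<bar>y - x\<bar> * L2norm {a<..<b} v) \<longlongrightarrow> 0) (at x)"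
      by (auto intro!: tendsto_eq_intros)
  qed auto
  then show ?thesis by (simp add: continuous_at_imp_continuous_on)
qed

lemma prim_bound:
  assumes v: "integrable (lon {a<..<b}) v"
  shows "\<bar>prim a b v x\<bar> \<le> integral\<^sup>L (lon {a<..<b}) (\<lambda>t. \<bar>v t\<bar>)"
proof -
  have "\<bar>prim a b v x\<bar> \<le> integral\<^sup>L (lon {a<..<b}) (\<lambda>t. \<bar>indicator {..x} t * v t\<bar>)"
    unfolding prim_def using integral_norm_bound[of "lon {a<..<b}" "\<lambda>t. indicator {..x} t * v t"] by simp
  also have "\<dots> \<le> integral\<^sup>L (lon {a<..<b}) (\<lambda>t. \<bar>v t\<bar>)"
    by (rule integral_mono) (use v in \<open>auto intro!: integrable_ind_lon integrable_abs split: split_indicator\<close>)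
  finally show ?thesis .
qed

lemma prim_top: "b \<le> x \<Longrightarrow> prim a b v x = integral\<^sup>L (lon {a<..<b}) v"
  unfolding prim_def
  by (rule Bochner_Integration.integral_cong) (auto simp: space_restrict_space split: split_indicator)

lemma L2_prim:
  assumes ab: "a < b" and v: "L2 {a<..<b} v"
  shows "L2 {a<..<b} (\<lambda>x. c + prim a b v x)"
proof (rule L2_bounded)
  have vi: "integrable (lon {a<..<b}) v" using v by (intro L2_integrable) auto
  show "(\<lambda>x. c + prim a b v x) \<in> borel_measurable (lon {a<..<b})"
    by (intro measurable_restrict_space1 borel_measurable_add borel_measurable_const)
      (simp add: borel_measurable_continuous_onI prim_continuous[OF assms])
  show "\<bar>c + prim a b v x\<bar> \<le> \<bar>c\<bar> + integral\<^sup>L (lon {a<..<b}) (\<lambda>t. \<bar>v t\<bar>)" for x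
    using prim_bound[OF vi, of x] by linarith
qed auto

text \<open>Integration by parts for merely integrable functions: by Fubini the two terms are the
  integrals of \<open>g x * v t\<close> over the triangles \<open>t \<le> x\<close> and
  \<open>x \<le> t\<close>. Together these cover the square and overlap only on the diagonal, which
  is null.\<close>

lemma prim_parts:
  assumes v: "integrable (lon {a<..<b}) v" and g: "integrable (lon {a<..<b}) g"
  shows "integral\<^sup>L (lon {a<..<b}) (\<lambda>x. g x * prim a b v x) + integral\<^sup>L (lon {a<..<b}) (\<lambda>x. v x * prim a b g x)
    = integral\<^sup>L (lon {a<..<b}) v * integral\<^sup>L (lon {a<..<b}) g"
proof -
  let ?M = "lon {a<..<b}"
  interpret finite_measure ?M by (rule finite_measure_lon) auto
  interpret p: pair_sigma_finite ?M ?M ..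
  have [measurable]: "v \<in> borel_measurable ?M" "g \<in> borel_measurable ?M" using v g by auto
  have i: "integrable (?M \<Otimes>\<^sub>M ?M) (\<lambda>(x,t). g x * v t)"
  proof (rule p.Fubini_integrable)
    show "integrable ?M (\<lambda>x. \<integral>y. norm (case (x, y) of (x, t) \<Rightarrow> g x * v t) \<partial>?M)"
      using g by (simp add: abs_mult)
  qed (use v in auto)
  have i1: "integrable (?M \<Otimes>\<^sub>M ?M) (\<lambda>(x,t). g x * (indicator {..x} t * v t))"
    by (rule Bochner_Integration.integrable_bound[OF i]) (simp add: indicator_def, rule AE_I2, auto simp: indicator_def abs_mult)
  have i2: "integrable (?M \<Otimes>\<^sub>M ?M) (\<lambda>(x,t). v t * (indicator {..t} x * g x))"
    by (rule Bochner_Integration.integrable_bound[OF i]) (simp add: indicator_def, rule AE_I2, auto simp: indicator_def abs_mult)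
  have "integral\<^sup>L ?M (\<lambda>x. g x * prim a b v x) = (\<integral>x. (\<integral>t. g x * (indicator {..x} t * v t) \<partial>?M) \<partial>?M)"
    unfolding prim_def by simp
  moreover have "integral\<^sup>L ?M (\<lambda>x. v x * prim a b g x) = (\<integral>x. (\<integral>t. v t * (indicator {..t} x * g x) \<partial>?M) \<partial>?M)"
    unfolding prim_def using p.Fubini_integral[OF i2] by simp
  ultimately have "integral\<^sup>L ?M (\<lambda>x. g x * prim a b v x) + integral\<^sup>L ?M (\<lambda>x. v x * prim a b g x) =
    (\<integral>x. (\<integral>t. g x * (indicator {..x} t * v t) \<partial>?M) + (\<integral>t. v t * (indicator {..t} x * g x) \<partial>?M) \<partial>?M)"
    using p.integrable_fst[OF i1] p.integrable_fst[OF i2] by simp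
  also have "\<dots> = (\<integral>x. (\<integral>t. g x * v t \<partial>?M) \<partial>?M)"
  proof (rule Bochner_Integration.integral_cong[OF refl])
    fix x
    have 1: "integrable ?M (\<lambda>t. g x * (indicator {..x} t * v t))"
      using v by (intro integrable_mult_right integrable_ind_lon) auto
    have 2: "integrable ?M (\<lambda>t. g x * (indicator {x..} t * v t))"
      using v by (intro integrable_mult_right integrable_ind_lon) auto
    have eq: "(\<lambda>t. v t * (indicator {..t} x * g x)) = (\<lambda>t. g x * (indicator {x..} t * v t))"
      by (auto split: split_indicator)
    have "(\<integral>t. g x * (indicator {..x} t * v t) \<partial>?M) + (\<integral>t. v t * (indicator {..t} x * g x) \<partial>?M)
      = (\<integral>t. g x * (indicator {..x} t * v t) + g x * (indicator {x..} t * v t) \<partial>?M)"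
      unfolding eq using 1 2 by simp
    also have "\<dots> = (\<integral>t. g x * v t \<partial>?M)"
    proof (rule integral_cong_AE)
      have "AE t in lborel. t \<noteq> x" by (rule AE_lborel_singleton)
      then have "AE t in ?M. t \<noteq> x" by (subst AE_lon) auto
      then show "AE t in ?M. g x * (indicator {..x} t * v t) + g x * (indicator {x..} t * v t) = g x * v t"
        by eventually_elim (auto split: split_indicator)
    qed (use 1 2 in auto)
    finally show "(\<integral>t. g x * (indicator {..x} t * v t) \<partial>?M) + (\<integral>t. v t * (indicator {..t} x * g x) \<partial>?M) = (\<integral>t. g x * v t \<partial>?M)" .
  qed
  also have "\<dots> = integral\<^sup>L ?M v * integral\<^sup>L ?M g" by simp
  finally show ?thesis .
qed

lemma continuous_support_integrable:
  fixes g :: "'a::euclidean_space \<Rightarrow> real"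
  assumes "continuous_on UNIV g" "compact K" "\<And>x. x \<notin> K \<Longrightarrow> g x = 0"
  shows "integrable lborel g"
proof -
  have "integrable lborel (\<lambda>x. indicator K x *\<^sub>R g x)"
    using assms by (intro borel_integrable_compact) (auto intro: continuous_on_subset)
  also have "(\<lambda>x. indicator K x *\<^sub>R g x) = g" using assms by (auto split: split_indicator)
  finally show ?thesis .
qed

lemma lborel_integral_support:
  fixes g :: "'a::euclidean_space \<Rightarrow> real"
  assumes "S \<in> sets borel" "\<And>x. x \<notin> S \<Longrightarrow> g x = 0"
  shows "integral\<^sup>L (lon S) g = integral\<^sup>L lborel g"
proof -
  have "(\<lambda>x. indicator S x *\<^sub>R g x) = g" using assms by (auto split: split_indicator)
  then show ?thesis using assms by (simp add: integral_restrict_space)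
qed

lemma test1_prim_deriv:
  assumes phi: "test1 {a<..<b} \<phi>" and x: "x \<in> {a<..<b}"
  shows "prim a b (deriv \<phi>) x = \<phi> x" and "integral\<^sup>L (lon {a<..<b}) (deriv \<phi>) = 0"
proof -
  obtain K where K: "compact K" "K \<subseteq> {a<..<b}" "\<And>x. x \<notin> K \<Longrightarrow> \<phi> x = 0" "\<And>x. x \<notin> K \<Longrightarrow> deriv \<phi> x = 0"
    using test1_support[OF phi] by metis
  have cont: "isCont (deriv \<phi>) t" for t
    using phi unfolding test1_def by (simp add: continuous_on_eq_continuous_at)
  have FTC: "(\<integral>t. deriv \<phi> t * indicator {a .. y} t \<partial>lborel) = \<phi> y - \<phi> a" if "a \<le> y" for y
    by (rule integral_FTC_Icc_real[OF that]) (use test1_DERIV[OF phi] cont in auto)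
  have 0: "deriv \<phi> t = 0" "\<phi> t = 0" if "t \<notin> {a<..<b}" for t using K that by blast+
  have "prim a b (deriv \<phi>) x = (\<integral>t. deriv \<phi> t * indicator {a .. x} t \<partial>lborel)"
    unfolding prim_def integral_restrict_space[of "{a<..<b}" lborel, simplified]
    by (rule Bochner_Integration.integral_cong) (use 0 in \<open>auto split: split_indicator\<close>)
  then show "prim a b (deriv \<phi>) x = \<phi> x" using FTC[of x] x 0(2)[of a] by simp
  have "integral\<^sup>L (lon {a<..<b}) (deriv \<phi>) = (\<integral>t. deriv \<phi> t * indicator {a .. b} t \<partial>lborel)"
    unfolding integral_restrict_space[of "{a<..<b}" lborel, simplified]
    by (rule Bochner_Integration.integral_cong) (use 0 in \<open>auto split: split_indicator\<close>)
  then show "integral\<^sup>L (lon {a<..<b}) (deriv \<phi>) = 0" using FTC[of b] x 0(2)[of a] 0(2)[of b] by simp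
qed

lemma test1_integrable:
  assumes "test1 {a<..<b} \<phi>"
  shows "integrable (lon {a<..<b}) \<phi>" "integrable (lon {a<..<b}) (deriv \<phi>)"
    "L2 {a<..<b} \<phi>" "L2 {a<..<b} (deriv \<phi>)"
proof -
  obtain C where C: "\<And>x. \<bar>\<phi> x\<bar> \<le> C" "\<And>x. \<bar>deriv \<phi> x\<bar> \<le> C" using test1_bounded[OF assms] by metis
  show *: "L2 {a<..<b} \<phi>" "L2 {a<..<b} (deriv \<phi>)"
    using test1_measurable[OF assms] C by (auto intro!: L2_bounded[where C=C] measurable_restrict_space1)
  show "integrable (lon {a<..<b}) \<phi>" "integrable (lon {a<..<b}) (deriv \<phi>)"
    using * by (auto intro!: L2_integrable)
qed

text \<open>\<open>prim_parts\<close> applied to \<open>v\<close> and \<open>deriv \<phi>\<close>: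
  the derivative of a test function has mean zero, so the right-hand product vanishes, and its
  primitive is \<open>\<phi>\<close>. Integrability of \<open>v\<close> is the assumption because
  that is what Fubini provides on almost every fibre.\<close>

lemma is_wderiv_prim:
  assumes ab: "a < b" and v: "integrable (lon {a<..<b}) v"
  shows "is_wderiv {a<..<b} (\<lambda>x. c + prim a b v x) v"
  unfolding is_wderiv_def
proof (intro allI impI)
  fix \<phi> assume phi: "test1 {a<..<b} \<phi>"
  let ?M = "lon {a<..<b}"
  obtain C where C: "\<And>x. \<bar>\<phi> x\<bar> \<le> C" "\<And>x. \<bar>deriv \<phi> x\<bar> \<le> C" using test1_bounded[OF phi] by metis
  obtain x where x: "x \<in> {a<..<b}" using ab dense by auto
  note d = test1_prim_deriv[OF phi] and di = test1_integrable(2)[OF phi]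
  have eq: "integral\<^sup>L ?M (\<lambda>x. v x * prim a b (deriv \<phi>) x) = integral\<^sup>L ?M (\<lambda>x. v x * \<phi> x)"
    by (rule Bochner_Integration.integral_cong) (auto simp: space_restrict_space d)
  have main: "integral\<^sup>L ?M (\<lambda>x. deriv \<phi> x * prim a b v x) = - integral\<^sup>L ?M (\<lambda>x. v x * \<phi> x)"
    using prim_parts[OF v di] unfolding eq d(2)[OF x] by simp
  have int: "integrable ?M (\<lambda>x. deriv \<phi> x * prim a b v x)"
  proof (rule Bochner_Integration.integrable_bound)
    show "integrable ?M (\<lambda>x. deriv \<phi> x * integral\<^sup>L ?M (\<lambda>t. \<bar>v t\<bar>))" using di by simp
    have [measurable]: "prim a b v \<in> borel_measurable ?M"
    proof -
      interpret finite_measure ?M by (rule finite_measure_lon) auto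
      have [measurable]: "v \<in> borel_measurable ?M" using v by auto
      have "(\<lambda>x. \<integral>t. indicator {..x} t * v t \<partial>?M) \<in> borel_measurable ?M"
        by (rule borel_measurable_lebesgue_integral) (simp add: indicator_def)
      then show ?thesis unfolding prim_def[abs_def] .
    qed
    show "(\<lambda>x. deriv \<phi> x * prim a b v x) \<in> borel_measurable ?M" using di by auto
    show "AE x in ?M. norm (deriv \<phi> x * prim a b v x) \<le> norm (deriv \<phi> x * integral\<^sup>L ?M (\<lambda>t. \<bar>v t\<bar>))"
      by (rule AE_I2) (simp only: real_norm_def abs_mult, intro mult_left_mono
          order_trans[OF prim_bound[OF v] abs_ge_self] abs_ge_zero)
  qed
  have "sint {a<..<b} (\<lambda>x. (c + prim a b v x) * deriv \<phi> x) = integral\<^sup>L ?M (\<lambda>x. c * deriv \<phi> x + deriv \<phi> x * prim a b v x)"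
    unfolding sint_lon[OF Ioo_borel] by (simp add: algebra_simps)
  also have "\<dots> = - integral\<^sup>L ?M (\<lambda>x. v x * \<phi> x)" using int di d(2)[OF x] main by simp
  finally show "sint {a<..<b} (\<lambda>x. (c + prim a b v x) * deriv \<phi> x) = - sint {a<..<b} (\<lambda>x. v x * \<phi> x)"
    by (simp add: sint_lon)
qed

text \<open>Normalise an antiderivative to vanish at the least point \<open>p\<close> of
  \<open>K\<close>. It is constant to the left of \<open>p\<close> and to the right of the greatest
  point \<open>q\<close>, and the zero mean makes both constants equal, so its support lies in
  \<open>{p..q}\<close>.\<close>

lemma test1_antiderivative:
  assumes g: "continuous_on UNIV g" and K: "compact K" "K \<subseteq> {c<..<d}" "\<And>x. x \<notin> K \<Longrightarrow> g x = 0"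
    and i: "integral\<^sup>L lborel g = 0"
  obtains \<phi> where "test1 {c<..<d} \<phi>" "deriv \<phi> = g"
proof (cases "K = {}")
  case True
  then have "g = (\<lambda>x. 0)" using K by auto
  moreover have "test1 {c<..<d} (\<lambda>x. 0)" "deriv (\<lambda>x. 0::real) = (\<lambda>x. 0)"
    by (rule test1I[where \<phi>'="\<lambda>x. 0" and K="{}"]; auto)+
  ultimately show ?thesis using that by auto
next
  case False
  have gi: "isCont g x" for x using g by (simp add: continuous_on_eq_continuous_at)
  obtain F where F: "\<And>x. (F has_real_derivative g x) (at x)"
    using einterval_antiderivative[of "-\<infinity>" \<infinity> g] gi
    by (auto simp: has_real_derivative_iff_has_vector_derivative)
  obtain p where p: "p \<in> K" "\<And>x. x \<in> K \<Longrightarrow> p \<le> x" using compact_attains_inf[OF K(1) False] by auto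
  obtain q where q: "q \<in> K" "\<And>x. x \<in> K \<Longrightarrow> x \<le> q" using compact_attains_sup[OF K(1) False] by auto
  have FTC: "(\<integral>t. g t * indicator {x .. y} t \<partial>lborel) = F y - F x" if "x \<le> y" for x y
    by (rule integral_FTC_Icc_real[OF that]) (use F gi in auto)
  have pq: "p \<le> q" using p q by auto
  have "(\<integral>t. g t * indicator {p .. q} t \<partial>lborel) = integral\<^sup>L lborel g"
  proof (rule Bochner_Integration.integral_cong[OF refl])
    fix x
    have "g x = 0" if "x \<notin> {p..q}" using that p(2)[of x] q(2)[of x] K(3)[of x] by fastforce
    then show "g x * indicator {p..q} x = g x" by (auto split: split_indicator)
  qed
  then have Fpq: "F q = F p" using FTC[OF pq] i by simp
  have l: "F x = F p" if "x \<le> p" for x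
  proof -
    have "(\<integral>t. g t * indicator {x .. p} t \<partial>lborel) = 0"
    proof (rule integral_eq_zero_AE)
      \<comment> \<open>Within \<open>{x..p}\<close> only \<open>t = p\<close> can carry a nonzero
        value of \<open>g\<close>, and a single point is null.\<close>
      show "AE t in lborel. g t * indicator {x..p} t = 0"
        using AE_lborel_singleton[of p]
      proof eventually_elim
        case (elim t)
        have "g t = 0" if "t \<in> {x..p}" using that elim p(2)[of t] K(3)[of t] by fastforce
        then show ?case by (auto split: split_indicator)
      qed
    qed
    then show ?thesis using FTC[OF that] by simp
  qed
  have r: "F x = F q" if "q \<le> x" for x
  proof -
    have "(\<integral>t. g t * indicator {q .. x} t \<partial>lborel) = 0"
    proof (rule integral_eq_zero_AE)
      show "AE t in lborel. g t * indicator {q..x} t = 0"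
        using AE_lborel_singleton[of q]
      proof eventually_elim
        case (elim t)
        have "g t = 0" if "t \<in> {q..x}" using that elim q(2)[of t] K(3)[of t] by fastforce
        then show ?case by (auto split: split_indicator)
      qed
    qed
    then show ?thesis using FTC[OF that] by simp
  qed
  show ?thesis
  proof (rule that)
    have *: "\<And>x. ((\<lambda>x. F x - F p) has_real_derivative g x) (at x)"
      using F by (auto intro!: derivative_eq_intros)
    have sub: "{p..q} \<subseteq> {c<..<d}" using p(1) q(1) K(2) by fastforce
    have z: "F x - F p = 0" if "x \<notin> {p..q}" for x
    proof (cases "x \<le> p")
      case True then show ?thesis using l[OF True] by linarith
    next
      case False then show ?thesis using that r[of x] Fpq by (simp only: atLeastAtMost_iff) linarith
    qed
    show "test1 {c<..<d} (\<lambda>x. F x - F p)"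
      by (rule test1I(1)[OF * g compact_Icc[of p q] sub z])
    show "deriv (\<lambda>x. F x - F p) = g"
      by (rule test1I(2)[OF * g compact_Icc[of p q] sub z])
  qed
qed

text \<open>The integrals of the bumps tend to the length \<open>d - c\<close>, so one of them is
  positive and that bump can be normalised.\<close>

lemma ex_unit_test1:
  assumes cd: "c < d"
  obtains \<rho> where "test1 {c<..<d} \<rho>" "integral\<^sup>L lborel \<rho> = 1"
proof -
  have [measurable]: "bump c d n \<in> borel_measurable borel" for n
    using test1_measurable(1)[OF bump_test1] .
  have "(\<lambda>n. integral\<^sup>L lborel (bump c d n)) \<longlonglongrightarrow> integral\<^sup>L lborel (indicator {c<..<d} :: real \<Rightarrow> real)"
  proof (rule integral_dominated_convergence)
    show "integrable lborel (indicator {c<..<d} :: real \<Rightarrow> real)"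
      using cd by (intro integrable_real_indicator) auto
    show "AE x in lborel. (\<lambda>i. bump c d i x) \<longlonglongrightarrow> indicator {c<..<d} x"
      by (intro AE_I2 bump_tendsto)
    show "AE x in lborel. norm (bump c d i x) \<le> indicator {c<..<d} x" for i
      using bump_bounds bump_eq_0 by (auto split: split_indicator)
  qed auto
  then have "(\<lambda>n. integral\<^sup>L lborel (bump c d n)) \<longlonglongrightarrow> d - c" using cd by simp
  then have "eventually (\<lambda>n. integral\<^sup>L lborel (bump c d n) > 0) sequentially"
    using cd by (auto dest!: order_tendstoD(1)[of _ _ _ 0])
  then obtain n where n: "integral\<^sup>L lborel (bump c d n) > 0"
    by (metis eventually_sequentially order_refl)
  let ?c = "integral\<^sup>L lborel (bump c d n)"
  show ?thesis
  proof (rule that)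
    obtain K where K: "compact K" "K \<subseteq> {c<..<d}" "\<And>x. x \<notin> K \<Longrightarrow> bump c d n x = 0"
      using test1_support[OF bump_test1] by metis
    show "test1 {c<..<d} (\<lambda>x. bump c d n x / ?c)"
    proof (rule test1I(1)[where \<phi>'="\<lambda>x. deriv (bump c d n) x / ?c", OF _ _ K(1,2)])
      show "((\<lambda>x. bump c d n x / ?c) has_real_derivative deriv (bump c d n) x / ?c) (at x)" for x
        by (intro DERIV_cdivide test1_DERIV[OF bump_test1])
      show "continuous_on UNIV (\<lambda>x. deriv (bump c d n) x / ?c)"
        using n by (intro continuous_intros test1_deriv_continuous[OF bump_test1]) auto
    qed (use K in auto)
    show "integral\<^sup>L lborel (\<lambda>x. bump c d n x / ?c) = 1" using n by simp
  qed
qed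

text \<open>The argument of du Bois-Reymond: \<open>U\<close>, the difference of \<open>u\<close>
  and the primitive, annihilates all derivatives of test functions. For any \<open>\<psi>\<close>
  with mean \<open>A\<close>, the function \<open>\<psi> - A \<rho>\<close> is such a derivative,
  hence \<open>U\<close> minus its \<open>\<rho>\<close>-mean annihilates \<open>\<psi>\<close>
  itself.\<close>

lemma is_wderiv_imp_prim:
  assumes ab: "a < b" and u: "L2 {a<..<b} u" and v: "L2 {a<..<b} v"
    and w: "is_wderiv {a<..<b} u v"
  obtains c where "AE x in lon {a<..<b}. u x = c + prim a b v x"
proof -
  let ?I = "{a<..<b}" let ?M = "lon ?I"
  have vi: "integrable ?M v" using v by (intro L2_integrable) auto
  define U where "U x = u x - (0 + prim a b v x)" for x
  have UL: "L2 ?I U" unfolding U_def by (intro L2_diff u L2_prim ab v) simp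
  have Ui: "integrable ?M U" using UL by (intro L2_integrable) auto
  have U0: "integral\<^sup>L ?M (\<lambda>x. U x * deriv \<phi> x) = 0" if phi: "test1 ?I \<phi>" for \<phi>
  proof -
    note L = test1_integrable(4)[OF phi]
    have "integral\<^sup>L ?M (\<lambda>x. U x * deriv \<phi> x) = integral\<^sup>L ?M (\<lambda>x. u x * deriv \<phi> x - (0 + prim a b v x) * deriv \<phi> x)"
      by (simp add: U_def algebra_simps)
    also have "\<dots> = integral\<^sup>L ?M (\<lambda>x. u x * deriv \<phi> x) - integral\<^sup>L ?M (\<lambda>x. (0 + prim a b v x) * deriv \<phi> x)"
      by (intro Bochner_Integration.integral_diff L2_mult_integrable u L L2_prim ab v) auto
    also have "\<dots> = 0"
      using w is_wderiv_prim[OF ab vi, of 0] phi unfolding is_wderiv_def by (simp add: sint_lon)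
    finally show ?thesis .
  qed
  obtain \<rho> where rho: "test1 ?I \<rho>" "integral\<^sup>L lborel \<rho> = 1" using ex_unit_test1[OF ab] by metis
  obtain K1 where K1: "compact K1" "K1 \<subseteq> ?I" "\<And>x. x \<notin> K1 \<Longrightarrow> \<rho> x = 0"
    using test1_support[OF rho(1)] by metis
  define c where "c = integral\<^sup>L ?M (\<lambda>x. U x * \<rho> x)"
  have "AE x in ?M. U x - c = 0"
  proof (rule fundamental_lemma_1)
    interpret finite_measure ?M by (rule finite_measure_lon) auto
    show "integrable ?M (\<lambda>x. U x - c)" using Ui by auto
    fix \<psi> assume psi: "test1 ?I \<psi>"
    obtain K2 where K2: "compact K2" "K2 \<subseteq> ?I" "\<And>x. x \<notin> K2 \<Longrightarrow> \<psi> x = 0"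
      using test1_support[OF psi] by metis
    define A where "A = integral\<^sup>L lborel \<psi>"
    have A': "integral\<^sup>L ?M \<psi> = A" unfolding A_def
      by (rule lborel_integral_support, simp) (meson K2(2,3) subsetD)
    obtain \<phi> where phi: "test1 ?I \<phi>" "deriv \<phi> = (\<lambda>x. \<psi> x - A * \<rho> x)"
    proof (rule test1_antiderivative[of "\<lambda>x. \<psi> x - A * \<rho> x" "K1 \<union> K2" a b])
      show "continuous_on UNIV (\<lambda>x. \<psi> x - A * \<rho> x)"
        by (intro continuous_intros test1_continuous[OF psi] test1_continuous[OF rho(1)])
      show "compact (K1 \<union> K2)" using K1 K2 by auto
      show "K1 \<union> K2 \<subseteq> {a<..<b}" using K1 K2 by auto
      have "integrable lborel \<psi>" "integrable lborel \<rho>"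
        using continuous_support_integrable[OF test1_continuous[OF psi] K2(1,3)]
          continuous_support_integrable[OF test1_continuous[OF rho(1)] K1(1,3)] by auto
      then show "integral\<^sup>L lborel (\<lambda>x. \<psi> x - A * \<rho> x) = 0" using rho(2) by (simp add: A_def)
      show "\<psi> x - A * \<rho> x = 0" if "x \<notin> K1 \<union> K2" for x
        using that K1(3)[of x] K2(3)[of x] by simp
    qed
    note i = L2_mult_integrable[OF _ UL test1_integrable(3)[OF psi]] L2_mult_integrable[OF _ UL test1_integrable(3)[OF rho(1)]]
    have "0 = integral\<^sup>L ?M (\<lambda>x. U x * \<psi> x - A * (U x * \<rho> x))"
      using U0[OF phi(1)] by (simp add: phi(2) algebra_simps)
    also have "\<dots> = integral\<^sup>L ?M (\<lambda>x. U x * \<psi> x) - A * c" using i by (simp add: c_def)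
    finally have e: "integral\<^sup>L ?M (\<lambda>x. U x * \<psi> x) = A * c" by simp
    have "sint ?I (\<lambda>x. (U x - c) * \<psi> x) = integral\<^sup>L ?M (\<lambda>x. U x * \<psi> x - c * \<psi> x)"
      by (simp add: sint_lon algebra_simps)
    also have "\<dots> = 0" using i test1_integrable(1)[OF psi] e A' by simp
    finally show "sint ?I (\<lambda>x. (U x - c) * \<psi> x) = 0" .
  qed
  then have "AE x in ?M. u x = c + prim a b v x" by eventually_elim (simp add: U_def)
  then show ?thesis using that by blast
qed

lemma H1_1_wderiv:
  assumes "H1_1 S u" shows "L2 S u" "L2 S (wderiv S u)" "is_wderiv S u (wderiv S u)"
proof -
  show "L2 S u" using assms by (simp add: H1_1_def)
  have "\<exists>v. L2 S v \<and> is_wderiv S u v" using assms by (simp add: H1_1_def)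
  from someI_ex[OF this] have "L2 S (wderiv S u) \<and> is_wderiv S u (wderiv S u)"
    unfolding wderiv_def .
  then show "L2 S (wderiv S u)" "is_wderiv S u (wderiv S u)" by auto
qed

text \<open>\<open>wderiv\<close> is an arbitrary choice; this lets it be exchanged under integrals
  for an explicitly known weak derivative, also when the function itself is altered on a null
  set.\<close>

lemma is_wderiv_unique:
  assumes v: "L2 {a<..<b} v" "L2 {a<..<b} v'"
    and u[measurable]: "u \<in> borel_measurable (lon {a<..<b})" "u' \<in> borel_measurable (lon {a<..<b})"
    and d: "is_wderiv {a<..<b} u v" "is_wderiv {a<..<b} u' v'"
    and e: "AE x in lon {a<..<b}. u x = u' x"
  shows "AE x in lon {a<..<b}. v x = v' x"
proof -
  let ?M = "lon {a<..<b}"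
  have "AE x in ?M. v x - v' x = 0"
  proof (rule fundamental_lemma_1)
    show "integrable ?M (\<lambda>x. v x - v' x)" using v by (auto intro!: L2_integrable Bochner_Integration.integrable_diff)
    fix \<phi> assume phi: "test1 {a<..<b} \<phi>"
    have [measurable]: "deriv \<phi> \<in> borel_measurable ?M" using test1_integrable(2)[OF phi] by auto
    note i = L2_mult_integrable[OF _ v(1) test1_integrable(3)[OF phi]] L2_mult_integrable[OF _ v(2) test1_integrable(3)[OF phi]]
    have "sint {a<..<b} (\<lambda>x. (v x - v' x) * \<phi> x) = integral\<^sup>L ?M (\<lambda>x. v x * \<phi> x) - integral\<^sup>L ?M (\<lambda>x. v' x * \<phi> x)"
      using i by (simp add: sint_lon left_diff_distrib)
    also have "\<dots> = - integral\<^sup>L ?M (\<lambda>x. u x * deriv \<phi> x) + integral\<^sup>L ?M (\<lambda>x. u' x * deriv \<phi> x)"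
      using d phi unfolding is_wderiv_def by (simp add: sint_lon)
    also have "integral\<^sup>L ?M (\<lambda>x. u x * deriv \<phi> x) = integral\<^sup>L ?M (\<lambda>x. u' x * deriv \<phi> x)"
      by (rule integral_cong_AE) (use e in auto)
    finally show "sint {a<..<b} (\<lambda>x. (v x - v' x) * \<phi> x) = 0" by simp
  qed
  then show ?thesis by eventually_elim simp
qed

lemma H1_1_prim:
  assumes ab: "a < b" and v: "L2 {a<..<b} v"
  shows "H1_1 {a<..<b} (\<lambda>x. c + prim a b v x)"
    "AE x in lon {a<..<b}. wderiv {a<..<b} (\<lambda>x. c + prim a b v x) x = v x"
proof -
  have vi: "integrable (lon {a<..<b}) v" using v by (intro L2_integrable) auto
  show *: "H1_1 {a<..<b} (\<lambda>x. c + prim a b v x)"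
    unfolding H1_1_def using L2_prim[OF ab v] is_wderiv_prim[OF ab vi] v by auto
  show "AE x in lon {a<..<b}. wderiv {a<..<b} (\<lambda>x. c + prim a b v x) x = v x"
    using H1_1_wderiv[OF *] is_wderiv_prim[OF ab vi] v
    by (intro is_wderiv_unique[OF _ _ _ _ _ _ AE_I2[OF refl]]) (auto intro: L2_measurable)
qed

lemma is_wderiv_diff:
  assumes "L2 {a<..<b} u" "L2 {a<..<b} u'" "L2 {a<..<b} v" "L2 {a<..<b} v'"
   "is_wderiv {a<..<b} u v" "is_wderiv {a<..<b} u' v'"
  shows "is_wderiv {a<..<b} (\<lambda>x. u x - u' x) (\<lambda>x. v x - v' x)"
  unfolding is_wderiv_def
proof (intro allI impI)
  fix \<phi> assume phi: "test1 {a<..<b} \<phi>"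
  note L = test1_integrable(3,4)[OF phi]
  show "sint {a<..<b} (\<lambda>x. (u x - u' x) * deriv \<phi> x) = - sint {a<..<b} (\<lambda>x. (v x - v' x) * \<phi> x)"
    using assms(5,6) phi L2_mult_integrable[OF _ assms(1) L(2)] L2_mult_integrable[OF _ assms(2) L(2)]
     L2_mult_integrable[OF _ assms(3) L(1)] L2_mult_integrable[OF _ assms(4) L(1)]
    unfolding is_wderiv_def by (simp add: sint_lon left_diff_distrib)
qed

subsection \<open>Test functions of two variables and Fubini on fibres\<close>

lemma pdx_pdy_has_derivative:
  assumes "(\<Phi> has_derivative (\<lambda>h. p * fst h + q * snd h)) (at z)"
  shows "((\<lambda>t. \<Phi> (t, snd z)) has_real_derivative p) (at (fst z))"
    "((\<lambda>t. \<Phi> (fst z, t)) has_real_derivative q) (at (snd z))"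
    "pdx \<Phi> z = p" "pdy \<Phi> z = q"
proof -
  have "((\<lambda>t. (t, snd z)) has_derivative (\<lambda>h. (h, 0))) (at (fst z))"
    "((\<lambda>t. (fst z, t)) has_derivative (\<lambda>h. (0, h))) (at (snd z))"
    by (auto intro!: derivative_eq_intros)
  from has_derivative_compose[OF this(1), of \<Phi> "\<lambda>h. p * fst h + q * snd h"]
    has_derivative_compose[OF this(2), of \<Phi> "\<lambda>h. p * fst h + q * snd h"] assms
  show *: "((\<lambda>t. \<Phi> (t, snd z)) has_real_derivative p) (at (fst z))"
    "((\<lambda>t. \<Phi> (fst z, t)) has_real_derivative q) (at (snd z))"
    by (auto simp: has_field_derivative_def)
  show "pdx \<Phi> z = p" "pdy \<Phi> z = q"
    unfolding pdx_def pdy_def using * by (auto intro: DERIV_imp_deriv)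
qed

text \<open>Fibred functions have explicit derivatives only on an open set \<open>U\<close> around
  their support. Off \<open>K\<close> they are locally zero, and \<open>U\<close> together with the
  complement of \<open>K\<close> covers the plane, so the partial derivatives glue to continuous
  functions.\<close>

lemma test2I:
  assumes U: "open U" and K: "compact K" "K \<subseteq> S" "K \<subseteq> U" "\<And>z. z \<notin> K \<Longrightarrow> \<Phi> z = 0"
    and d: "\<And>z. z \<in> U \<Longrightarrow> (\<Phi> has_derivative (\<lambda>h. dx z * fst h + dy z * snd h)) (at z)"
    and c: "continuous_on U dx" "continuous_on U dy"
  shows "test2 S \<Phi>" "\<And>z. z \<in> U \<Longrightarrow> pdx \<Phi> z = dx z" "\<And>z. z \<in> U \<Longrightarrow> pdy \<Phi> z = dy z"
proof -
  show px: "\<And>z. z \<in> U \<Longrightarrow> pdx \<Phi> z = dx z" and py: "\<And>z. z \<in> U \<Longrightarrow> pdy \<Phi> z = dy z"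
    using pdx_pdy_has_derivative[OF d] by auto
  have oK: "open (- K)" using compact_imp_closed[OF K(1)] by (simp add: open_Compl)
  have d0: "(\<Phi> has_derivative (\<lambda>h. 0 * fst h + 0 * snd h)) (at z)" if "z \<notin> K" for z
  proof -
    have "((\<lambda>z. 0::real) has_derivative (\<lambda>h. 0 * fst h + 0 * snd h)) (at z)" by simp
    then show ?thesis
      by (rule has_derivative_transform_within_open[OF _ oK]) (use that K in simp_all)
  qed
  have p0: "pdx \<Phi> z = 0" "pdy \<Phi> z = 0" if "z \<notin> K" for z
    using pdx_pdy_has_derivative[OF d0[OF that]] by auto
  have un: "U \<union> (- K) = UNIV" using K by auto
  have "continuous_on (U \<union> (- K)) (pdx \<Phi>)"
    by (rule continuous_on_open_Un[OF U oK continuous_on_eq[OF c(1) px[symmetric]]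
          continuous_on_eq[OF continuous_on_const p0(1)[symmetric]]]) auto
  moreover have "continuous_on (U \<union> (- K)) (pdy \<Phi>)"
    by (rule continuous_on_open_Un[OF U oK continuous_on_eq[OF c(2) py[symmetric]]
          continuous_on_eq[OF continuous_on_const p0(2)[symmetric]]]) auto
  moreover have "\<Phi> differentiable at z" for z
    using d[of z] d0[of z] K(3) unfolding differentiable_def by blast
  ultimately show "test2 S \<Phi>" unfolding test2_def un using K by blast
qed

lemma has_derivative_fst_snd:
  assumes "(f has_real_derivative D) (at (fst z))" and "(g has_real_derivative E) (at (snd z))"
  shows "((\<lambda>z. f (fst z)) has_derivative (\<lambda>h. D * fst h)) (at z)"
    "((\<lambda>z. g (snd z)) has_derivative (\<lambda>h. E * snd h)) (at z)"
  using has_derivative_compose[OF has_derivative_fst[OF has_derivative_ident], of f "(*) D" z]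
   has_derivative_compose[OF has_derivative_snd[OF has_derivative_ident], of g "(*) E" z] assms
  by (auto simp: has_field_derivative_def)

lemma test2_product:
  assumes phi: "test1 A \<phi>" and psi: "test1 B \<psi>" and AB: "A \<times> B \<subseteq> S"
  shows "test2 S (\<lambda>z. \<phi> (fst z) * \<psi> (snd z))"
    "pdx (\<lambda>z. \<phi> (fst z) * \<psi> (snd z)) = (\<lambda>z. deriv \<phi> (fst z) * \<psi> (snd z))"
    "pdy (\<lambda>z. \<phi> (fst z) * \<psi> (snd z)) = (\<lambda>z. \<phi> (fst z) * deriv \<psi> (snd z))"
proof -
  obtain K1 where K1: "compact K1" "K1 \<subseteq> A" "\<And>x. x \<notin> K1 \<Longrightarrow> \<phi> x = 0" using test1_support[OF phi] by metis
  obtain K2 where K2: "compact K2" "K2 \<subseteq> B" "\<And>x. x \<notin> K2 \<Longrightarrow> \<psi> x = 0" using test1_support[OF psi] by metis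
  have K: "compact (K1 \<times> K2)" "K1 \<times> K2 \<subseteq> S" "K1 \<times> K2 \<subseteq> UNIV" using K1 K2 AB by (auto intro: compact_Times)
  have z: "\<phi> (fst z) * \<psi> (snd z) = 0" if "z \<notin> K1 \<times> K2" for z
    using that K1(3) K2(3) by (cases z) auto
  have d: "((\<lambda>z. \<phi> (fst z) * \<psi> (snd z)) has_derivative
     (\<lambda>h. (deriv \<phi> (fst z) * \<psi> (snd z)) * fst h + (\<phi> (fst z) * deriv \<psi> (snd z)) * snd h)) (at z)" for z
    using has_derivative_mult[OF has_derivative_fst_snd[OF test1_DERIV[OF phi] test1_DERIV[OF psi]]]
    by (auto simp: algebra_simps)
  have c: "continuous_on UNIV (\<lambda>z. deriv \<phi> (fst z) * \<psi> (snd z))"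
    "continuous_on UNIV (\<lambda>z. \<phi> (fst z) * deriv \<psi> (snd z))"
    by (intro continuous_intros continuous_on_compose2[OF test1_continuous[OF phi, of UNIV]]
        continuous_on_compose2[OF test1_continuous[OF psi, of UNIV]]
        continuous_on_compose2[OF test1_deriv_continuous[OF phi, of UNIV]]
        continuous_on_compose2[OF test1_deriv_continuous[OF psi, of UNIV]]; simp)+
  note t = test2I[OF open_UNIV K z d c]
  show "test2 S (\<lambda>z. \<phi> (fst z) * \<psi> (snd z))" by (rule t(1))
  show "pdx (\<lambda>z. \<phi> (fst z) * \<psi> (snd z)) = (\<lambda>z. deriv \<phi> (fst z) * \<psi> (snd z))"
    "pdy (\<lambda>z. \<phi> (fst z) * \<psi> (snd z)) = (\<lambda>z. \<phi> (fst z) * deriv \<psi> (snd z))"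
    using t(2,3) by auto
qed

lemma test2_has_derivative:
  assumes "test2 S \<Phi>"
  shows "(\<Phi> has_derivative (\<lambda>h. pdx \<Phi> z * fst h + pdy \<Phi> z * snd h)) (at z)"
proof -
  obtain F where F: "(\<Phi> has_derivative F) (at z)"
    using assms unfolding test2_def differentiable_def by blast
  interpret F: bounded_linear F using F by (rule has_derivative_bounded_linear)
  have "F h = F (1,0) * fst h + F (0,1) * snd h" for h
  proof -
    have "h = fst h *\<^sub>R (1,0) + snd h *\<^sub>R (0,1)" by (cases h) simp
    then have "F h = F (fst h *\<^sub>R (1,0) + snd h *\<^sub>R (0,1))" by (rule arg_cong)
    also have "\<dots> = fst h * F (1,0) + snd h * F (0,1)" by (simp only: F.add F.scaleR real_scaleR_def)
    finally show ?thesis by (simp only: mult.commute)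
  qed
  then have eq: "(\<lambda>h. F (1,0) * fst h + F (0,1) * snd h) = F" by (intro ext) (rule sym)
  have *: "(\<Phi> has_derivative (\<lambda>h. F (1,0) * fst h + F (0,1) * snd h)) (at z)"
    unfolding eq by (rule F)
  then show ?thesis using pdx_pdy_has_derivative(3,4)[OF *] by simp
qed

lemma test2_support:
  assumes "test2 S \<Phi>"
  obtains K where "compact K" "K \<subseteq> S" "\<And>z. z \<notin> K \<Longrightarrow> \<Phi> z = 0"
    "\<And>z. z \<notin> K \<Longrightarrow> pdx \<Phi> z = 0" "\<And>z. z \<notin> K \<Longrightarrow> pdy \<Phi> z = 0"
proof -
  obtain K where K: "compact K" "K \<subseteq> S" "\<And>z. z \<notin> K \<Longrightarrow> \<Phi> z = 0"
    using assms unfolding test2_def by blast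
  have oK: "open (- K)" using compact_imp_closed[OF K(1)] by (simp add: open_Compl)
  have "pdx \<Phi> z = 0 \<and> pdy \<Phi> z = 0" if "z \<notin> K" for z
  proof -
    have "((\<lambda>z. 0::real) has_derivative (\<lambda>h. 0 * fst h + 0 * snd h)) (at z)" by simp
    then have "(\<Phi> has_derivative (\<lambda>h. 0 * fst h + 0 * snd h)) (at z)"
      by (rule has_derivative_transform_within_open[OF _ oK]) (use that K in simp_all)
    from pdx_pdy_has_derivative(3,4)[OF this] show ?thesis by auto
  qed
  with K that show ?thesis by blast
qed

lemma test2_continuous:
  assumes "test2 S \<Phi>"
  shows "continuous_on A \<Phi>" "continuous_on A (pdx \<Phi>)" "continuous_on A (pdy \<Phi>)"
proof -
  show "continuous_on A \<Phi>"
    using has_derivative_continuous[OF test2_has_derivative[OF assms]]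
    by (simp add: continuous_at_imp_continuous_on)
  show "continuous_on A (pdx \<Phi>)" "continuous_on A (pdy \<Phi>)"
    using assms unfolding test2_def by (auto intro: continuous_on_subset)
qed

lemma test2_L2:
  assumes t: "test2 S \<Phi>" and S: "S \<in> sets borel" "bounded S"
  shows "L2 S \<Phi>" "L2 S (pdx \<Phi>)" "L2 S (pdy \<Phi>)"
proof -
  obtain K where K: "compact K" "K \<subseteq> S" "\<And>z. z \<notin> K \<Longrightarrow> \<Phi> z = 0"
    "\<And>z. z \<notin> K \<Longrightarrow> pdx \<Phi> z = 0" "\<And>z. z \<notin> K \<Longrightarrow> pdy \<Phi> z = 0"
    using test2_support[OF t] by metis
  have *: "L2 S g" if c: "continuous_on UNIV g" and 0: "\<And>z. z \<notin> K \<Longrightarrow> g z = 0" for g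
  proof -
    have "bounded (g ` K)"
      using K(1) c by (auto intro!: compact_imp_bounded compact_continuous_image intro: continuous_on_subset)
    then obtain B where B: "\<And>x. x \<in> K \<Longrightarrow> \<bar>g x\<bar> \<le> B" by (auto simp: bounded_iff)
    have "\<bar>g x\<bar> \<le> max 0 B" for x using B[of x] 0[of x] by (cases "x \<in> K") auto
    then show ?thesis using c S
      by (intro L2_bounded[where C="max 0 B"] measurable_restrict_space1) (auto intro: borel_measurable_continuous_onI)
  qed
  show "L2 S \<Phi>" "L2 S (pdx \<Phi>)" "L2 S (pdy \<Phi>)"
    using *[OF test2_continuous(1)[OF t] K(3)] *[OF test2_continuous(2)[OF t] K(4)] *[OF test2_continuous(3)[OF t] K(5)]
    by auto
qed

section \<open>Fubini, fibre integrals and fibre averages on a region between two graphs\<close>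

lemma AE_lborel_fst:
  assumes "AE x in lborel. Q x"
  shows "AE z in (lborel :: (real \<times> real) measure). Q (fst z)"
proof -
  obtain N where N: "{x. \<not> Q x} \<subseteq> N" "N \<in> null_sets lborel"
    using assms by (auto simp: eventually_ae_filter)
  have "N \<times> UNIV \<in> null_sets (lborel \<Otimes>\<^sub>M lborel :: (real \<times> real) measure)"
    using N(2) by (auto simp: null_sets_def lborel.emeasure_pair_measure_Times)
  then have "N \<times> (UNIV::real set) \<in> null_sets lborel" by (simp add: lborel_prod)
  then show ?thesis by (rule AE_I') (use N(1) in auto)
qed

lemma continuous_on_measurable_lon:
  fixes g :: "'a::euclidean_space \<Rightarrow> real"
  assumes "continuous_on S g" shows "g \<in> borel_measurable (lon S)"
proof -
  have "sets (lon S) = sets (restrict_space borel S)" by (rule sets_restrict_space_cong) simp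
  then show ?thesis
    using borel_measurable_continuous_on_restrict[OF assms] by (simp cong: measurable_cong_sets)
qed

lemma integral_lon_cong:
  "S \<in> sets borel \<Longrightarrow> (\<And>x. x \<in> S \<Longrightarrow> f x = g x) \<Longrightarrow> integral\<^sup>L (lon S) f = integral\<^sup>L (lon S) (g :: _ \<Rightarrow> real)"
  by (rule Bochner_Integration.integral_cong) (auto simp: space_restrict_space)

lemma open_between_graphs:
  fixes l m :: "real \<Rightarrow> real"
  assumes "continuous_on {a<..<b} l" "continuous_on {a<..<b} m"
  shows "open {(x,y). a < x \<and> x < b \<and> l x < y \<and> y < m x}"
proof -
  have o: "open ({a<..<b} \<times> (UNIV::real set))" by (auto intro: open_Times)
  have c: "continuous_on ({a<..<b} \<times> (UNIV::real set)) (\<lambda>z. snd z - l (fst z))"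
      "continuous_on ({a<..<b} \<times> (UNIV::real set)) (\<lambda>z. m (fst z) - snd z)"
    by (intro continuous_intros continuous_on_compose2[OF assms(1)] continuous_on_compose2[OF assms(2)]; auto)+
  have "{(x,y). a < x \<and> x < b \<and> l x < y \<and> y < m x} =
    ({a<..<b} \<times> UNIV \<inter> (\<lambda>z. snd z - l (fst z)) -` {0<..}) \<inter> ({a<..<b} \<times> UNIV \<inter> (\<lambda>z. m (fst z) - snd z) -` {0<..})"
    by auto
  also have "open \<dots>" using continuous_open_preimage[OF c(1) o] continuous_open_preimage[OF c(2) o] by auto
  finally show ?thesis .
qed

text \<open>In the application \<open>l = - \<epsilon> k1\<close>, \<open>m = \<epsilon> k2\<close> and \<open>c0 = \<epsilon> min C11 C21\<close>.\<close>

locale thin_domain =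
  fixes a b c0 :: real and l m l' m' :: "real \<Rightarrow> real"
  assumes ab: "a < b" and c0: "0 < c0"
    and l_le: "\<And>x. x \<in> {a..b} \<Longrightarrow> l x \<le> - c0" and m_ge: "\<And>x. x \<in> {a..b} \<Longrightarrow> c0 \<le> m x"
    and l_deriv: "\<And>x. x \<in> {a..b} \<Longrightarrow> (l has_real_derivative l' x) (at x within {a..b})"
    and m_deriv: "\<And>x. x \<in> {a..b} \<Longrightarrow> (m has_real_derivative m' x) (at x within {a..b})"
    and l'_cont: "continuous_on {a..b} l'" and m'_cont: "continuous_on {a..b} m'"
begin

abbreviation I where "I \<equiv> {a<..<b}"
definition R where "R = {(x,y). a < x \<and> x < b \<and> l x < y \<and> y < m x}"
definition D where "D x = m x - l x"
abbreviation fib where "fib x \<equiv> {l x<..<m x}"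
definition fint :: "(real \<times> real \<Rightarrow> real) \<Rightarrow> real \<Rightarrow> real" where
  "fint F x = integral\<^sup>L (lon (fib x)) (\<lambda>y. F (x,y))"

lemma l_cont: "continuous_on {a..b} l" and m_cont: "continuous_on {a..b} m"
  by (rule DERIV_continuous_on, erule l_deriv, rule DERIV_continuous_on, erule m_deriv)

lemma l_DERIV: "x \<in> I \<Longrightarrow> (l has_real_derivative l' x) (at x)"
  and m_DERIV: "x \<in> I \<Longrightarrow> (m has_real_derivative m' x) (at x)"
  using l_deriv[of x] m_deriv[of x] by (simp_all add: at_within_Icc_at)

lemma D_ge: "x \<in> {a..b} \<Longrightarrow> 2 * c0 \<le> D x"
  using l_le[of x] m_ge[of x] by (simp add: D_def)

lemma D_pos: "x \<in> {a..b} \<Longrightarrow> 0 < D x"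
  using D_ge[of x] c0 by simp

lemma D_cont: "continuous_on {a..b} D"
  unfolding D_def by (intro continuous_intros l_cont m_cont)

lemma lm_bounded: obtains B where "\<And>x. x \<in> {a..b} \<Longrightarrow> - B \<le> l x" "\<And>x. x \<in> {a..b} \<Longrightarrow> m x \<le> B" "0 < B"
proof -
  have "bounded (l ` {a..b})" "bounded (m ` {a..b})"
    by (auto intro!: compact_imp_bounded compact_continuous_image l_cont m_cont)
  then obtain B1 B2 where "\<forall>x\<in>{a..b}. \<bar>l x\<bar> \<le> B1" "\<forall>x\<in>{a..b}. \<bar>m x\<bar> \<le> B2"
    by (auto simp: bounded_iff)
  then have B: "\<And>x. x \<in> {a..b} \<Longrightarrow> \<bar>l x\<bar> \<le> B1" "\<And>x. x \<in> {a..b} \<Longrightarrow> \<bar>m x\<bar> \<le> B2" by blast+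
  show ?thesis
  proof (rule that[of "max 1 (max B1 B2)"])
    show "- max 1 (max B1 B2) \<le> l x" if "x \<in> {a..b}" for x using B(1)[OF that] by linarith
    show "m x \<le> max 1 (max B1 B2)" if "x \<in> {a..b}" for x using B(2)[OF that] by linarith
  qed simp
qed

lemma D_bounded: obtains B where "\<And>x. x \<in> {a..b} \<Longrightarrow> D x \<le> B" "0 < B"
proof -
  obtain B where B: "\<And>x. x \<in> {a..b} \<Longrightarrow> - B \<le> l x" "\<And>x. x \<in> {a..b} \<Longrightarrow> m x \<le> B" "0 < B"
    using lm_bounded by metis
  have "D x \<le> 2 * B" if "x \<in> {a..b}" for x
    using B(1,2)[OF that] by (simp add: D_def)
  then show ?thesis using that[of "2 * B"] B(3) by simp
qed

lemma open_R: "open R"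
  unfolding R_def
  by (rule open_between_graphs; rule continuous_on_subset[where s="{a..b}"]) (use l_cont m_cont in auto)

lemma R_borel [simp, measurable]: "R \<in> sets borel" using open_R by simp

lemma bounded_R: "bounded R"
proof -
  obtain B where B: "\<And>x. x \<in> {a..b} \<Longrightarrow> - B \<le> l x" "\<And>x. x \<in> {a..b} \<Longrightarrow> m x \<le> B" "0 < B"
    using lm_bounded by metis
  have "R \<subseteq> cbox (a,-B) (b,B)"
  proof
    fix z assume "z \<in> R"
    then obtain x y where z: "z = (x,y)" "a < x" "x < b" "l x < y" "y < m x" by (auto simp: R_def)
    then show "z \<in> cbox (a,-B) (b,B)" using B(1,2)[of x] by simp
  qed
  then show ?thesis using bounded_subset bounded_cbox by blast
qed

lemma mem_R: "(x,y) \<in> R \<longleftrightarrow> x \<in> I \<and> y \<in> fib x"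
  by (auto simp: R_def)

lemma indicator_R: "indicator R (x,y) = indicator I x * (indicator (fib x) y :: real)"
  by (auto simp: mem_R indicator_def)

lemma R_fst: "z \<in> R \<Longrightarrow> fst z \<in> I" by (auto simp: R_def)

lemma fint_eq: "x \<in> I \<Longrightarrow> fint F x = (\<integral>y. indicator R (x,y) * F (x,y) \<partial>lborel)"
  unfolding fint_def integral_restrict_space[of "fib x" lborel, simplified]
  by (simp add: indicator_R)

lemma fst_measurable_R: "fst \<in> measurable (lon R) (lon I)"
  by (rule measurable_restrict_space2)
    (auto simp: space_restrict_space R_def intro!: measurable_restrict_space1 borel_measurable_continuous_onI continuous_intros)

lemma comp_fst_measurable: "g \<in> borel_measurable (lon I) \<Longrightarrow> (\<lambda>z. g (fst z)) \<in> borel_measurable (lon R)"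
  using measurable_compose[OF fst_measurable_R] .

lemma ext_measurable:
  fixes F :: "real \<times> real \<Rightarrow> real"
  assumes "F \<in> borel_measurable (lon R)"
  shows "(\<lambda>z. indicator R z * F z) \<in> borel_measurable (lborel \<Otimes>\<^sub>M lborel)"
  using assms by (simp add: borel_measurable_restrict_space_iff lborel_prod)

lemma fint_measurable:
  assumes F: "F \<in> borel_measurable (lon R)"
  shows "fint F \<in> borel_measurable (lon I)"
proof -
  have "(\<lambda>x. \<integral>y. indicator R (x,y) * F (x,y) \<partial>lborel) \<in> borel_measurable lborel"
    by (rule lborel.borel_measurable_lebesgue_integral) (use ext_measurable[OF F] in \<open>simp add: split_beta'\<close>)
  then have "(\<lambda>x. \<integral>y. indicator R (x,y) * F (x,y) \<partial>lborel) \<in> borel_measurable (lon I)"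
    by (rule measurable_restrict_space1)
  then show ?thesis
    by (subst measurable_cong[where g="\<lambda>x. \<integral>y. indicator R (x,y) * F (x,y) \<partial>lborel"])
      (auto simp: space_restrict_space fint_eq)
qed

lemma fibre_measurable:
  fixes F :: "real \<times> real \<Rightarrow> real"
  assumes F: "F \<in> borel_measurable (lon R)" and x: "x \<in> I"
  shows "(\<lambda>y. F (x,y)) \<in> borel_measurable (lon (fib x))"
proof -
  have "(\<lambda>y. indicator R (x,y) * F (x,y)) \<in> borel_measurable lborel"
    using measurable_compose[OF measurable_Pair1' ext_measurable[OF F], of x] by simp
  then show ?thesis using x by (simp add: borel_measurable_restrict_space_iff indicator_R)
qed

lemma fibre_integrable_iff:
  fixes F :: "real \<times> real \<Rightarrow> real"
  assumes x: "x \<in> I"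
  shows "integrable lborel (\<lambda>y. indicator R (x,y) * F (x,y)) \<longleftrightarrow> integrable (lon (fib x)) (\<lambda>y. F (x,y))"
  using x by (simp add: integrable_restrict_space indicator_R)

lemma fubini_R:
  assumes F: "integrable (lon R) F"
  shows "AE x in lon I. integrable (lon (fib x)) (\<lambda>y. F (x,y))"
    "integrable (lon I) (fint F)" "integral\<^sup>L (lon R) F = integral\<^sup>L (lon I) (fint F)"
proof -
  have i: "integrable (lborel \<Otimes>\<^sub>M lborel) (\<lambda>z. indicator R z * F z)"
    using F by (simp add: integrable_restrict_space lborel_prod)
  from lborel_pair.AE_integrable_fst'[OF i]
  show "AE x in lon I. integrable (lon (fib x)) (\<lambda>y. F (x,y))"
    by (subst AE_lon) (auto elim!: eventually_mono simp: fibre_integrable_iff)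
  let ?G = "\<lambda>x. \<integral>y. indicator R (x,y) * F (x,y) \<partial>lborel"
  have G: "?G = (\<lambda>x. indicator I x * fint F x)"
    by (auto simp: fint_eq indicator_R split: split_indicator)
  have "integrable lborel ?G" using lborel_pair.integrable_fst'[OF i] by simp
  then show "integrable (lon I) (fint F)"
    unfolding G by (simp add: integrable_restrict_space)
  have "integral\<^sup>L (lon R) F = integral\<^sup>L lborel ?G"
    using lborel_pair.integral_fst'[OF i] by (simp add: integral_restrict_space lborel_prod)
  then show "integral\<^sup>L (lon R) F = integral\<^sup>L (lon I) (fint F)"
    unfolding G by (simp add: integral_restrict_space)
qed

lemma tonelli_R:
  assumes F: "F \<in> borel_measurable (lon R)"
    and f: "AE x in lon I. integrable (lon (fib x)) (\<lambda>y. F (x,y))"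
    and i: "integrable (lon I) (fint (\<lambda>z. \<bar>F z\<bar>))"
  shows "integrable (lon R) F"
proof -
  have "integrable (lborel \<Otimes>\<^sub>M lborel) (\<lambda>z. indicator R z * F z)"
  proof (rule lborel_pair.Fubini_integrable[OF ext_measurable[OF F]])
    have "(\<lambda>x. \<integral>y. norm (indicator R (x,y) * F (x,y)) \<partial>lborel) = (\<lambda>x. indicator I x * fint (\<lambda>z. \<bar>F z\<bar>) x)"
      by (auto simp: fint_eq indicator_R abs_mult split: split_indicator)
    then show "integrable lborel (\<lambda>x. \<integral>y. norm (indicator R (x,y) * F (x,y)) \<partial>lborel)"
      using i by (simp add: integrable_restrict_space)
    have "AE x in lborel. x \<in> I \<longrightarrow> integrable (lon (fib x)) (\<lambda>y. F (x,y))"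
      using f by (subst (asm) AE_lon) auto
    then show "AE x in lborel. integrable lborel (\<lambda>y. indicator R (x,y) * F (x,y))"
    proof eventually_elim
      case (elim x)
      show ?case
      proof (cases "x \<in> I")
        case True then show ?thesis using elim fibre_integrable_iff by blast
      next
        case False then show ?thesis by (simp add: indicator_R)
      qed
    qed
  qed
  then show ?thesis by (simp add: integrable_restrict_space lborel_prod)
qed

lemma finite_fib: "finite_measure (lon (fib x))"
  by (rule finite_measure_lon) auto

lemma fint_const: "x \<in> I \<Longrightarrow> fint (\<lambda>z. g (fst z)) x = g x * D x"
proof -
  assume x: "x \<in> I"
  interpret finite_measure "lon (fib x)" by (rule finite_fib)
  have "measure (lon (fib x)) (fib x) = D x"
    using D_pos[of x] x by (simp add: measure_restrict_space D_def)
  then show ?thesis by (simp add: fint_def space_restrict_space)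
qed

lemma fint_mult_fst: "fint (\<lambda>z. g (fst z) * F z) x = g x * fint F x"
  by (simp add: fint_def)

lemma integrable_fst:
  assumes g: "integrable (lon I) g"
  shows "integrable (lon R) (\<lambda>z. g (fst z))" "integral\<^sup>L (lon R) (\<lambda>z. g (fst z)) = integral\<^sup>L (lon I) (\<lambda>x. D x * g x)"
proof -
  interpret f: finite_measure "lon (fib x)" for x by (rule finite_fib)
  obtain B where B: "\<And>x. x \<in> {a..b} \<Longrightarrow> D x \<le> B" "0 < B" using D_bounded by metis
  have [measurable]: "g \<in> borel_measurable (lon I)" using g by auto
  show *: "integrable (lon R) (\<lambda>z. g (fst z))"
  proof (rule tonelli_R)
    show "(\<lambda>z. g (fst z)) \<in> borel_measurable (lon R)" using g by (intro comp_fst_measurable) auto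
    have m: "fint (\<lambda>z. \<bar>g (fst z)\<bar>) \<in> borel_measurable (lon I)"
      using g by (intro fint_measurable borel_measurable_abs comp_fst_measurable) auto
    show "integrable (lon I) (fint (\<lambda>z. \<bar>g (fst z)\<bar>))"
    proof (rule Bochner_Integration.integrable_bound)
      show "integrable (lon I) (\<lambda>x. B * g x)" using g by simp
      show "AE x in lon I. norm (fint (\<lambda>z. \<bar>g (fst z)\<bar>) x) \<le> norm (B * g x)"
      proof (rule AE_I2)
        fix x assume "x \<in> space (lon I)"
        then have x: "x \<in> I" by (simp add: space_restrict_space)
        have "fint (\<lambda>z. \<bar>g (fst z)\<bar>) x = \<bar>g x\<bar> * D x" using fint_const[OF x, of "\<lambda>t. \<bar>g t\<bar>"] by simp
        moreover have "0 < D x" "D x \<le> B" using B(1)[of x] D_pos[of x] x by auto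
        ultimately show "norm (fint (\<lambda>z. \<bar>g (fst z)\<bar>) x) \<le> norm (B * g x)"
          using B(2) mult_left_mono[of "D x" B "\<bar>g x\<bar>"] by (simp add: abs_mult mult.commute)
      qed
    qed (rule m)
  qed auto
  show "integral\<^sup>L (lon R) (\<lambda>z. g (fst z)) = integral\<^sup>L (lon I) (\<lambda>x. D x * g x)"
    unfolding fubini_R(3)[OF *] by (rule integral_lon_cong) (auto simp: fint_const)
qed

lemma L2_fst:
  assumes g: "L2 I g"
  shows "L2 R (\<lambda>z. g (fst z))" "sint R (\<lambda>z. (g (fst z))^2) = sint I (\<lambda>x. D x * (g x)^2)"
  using integrable_fst[of "\<lambda>x. (g x)^2"] g comp_fst_measurable[of g]
  by (auto simp: L2_iff sint_lon)

lemma AE_fst: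
  assumes "AE x in lon I. Q x" shows "AE z in lon R. Q (fst z)"
proof -
  have "AE x in lborel. x \<in> I \<longrightarrow> Q x" using assms by (subst (asm) AE_lon) auto
  from AE_lborel_fst[OF this] show ?thesis
    by (subst AE_lon) (auto elim!: eventually_mono dest: R_fst)
qed

lemma AE_fibres:
  assumes "AE z in lon R. Q z" shows "AE x in lon I. AE y in lon (fib x). Q (x,y)"
proof -
  have "AE z in lborel \<Otimes>\<^sub>M lborel. z \<in> R \<longrightarrow> Q z" unfolding lborel_prod
    using assms by (subst (asm) AE_lon) auto
  from lborel_pair.AE_pair[OF this] show ?thesis
    by (subst AE_lon) (auto elim!: eventually_mono simp: AE_lon mem_R)
qed

lemma L2_fibre:
  assumes F: "L2 R F"
  shows "AE x in lon I. L2 (fib x) (\<lambda>y. F (x,y))"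
proof -
  have "AE x in lon I. integrable (lon (fib x)) (\<lambda>y. (F (x,y))^2)"
    using fubini_R(1)[of "\<lambda>z. (F z)^2"] F by (simp add: L2_iff)
  then have "AE x in lborel. x \<in> I \<longrightarrow> integrable (lon (fib x)) (\<lambda>y. (F (x,y))^2)"
    by (subst (asm) AE_lon) auto
  then show ?thesis
    by (subst AE_lon) (use F fibre_measurable in \<open>auto elim!: eventually_mono simp: L2_iff\<close>)
qed

text \<open>Cauchy-Schwarz on the fibre against the constant \<open>1\<close>, whose squared norm is
  the fibre length \<open>D x\<close>.\<close>

lemma fint_square_le:
  assumes F: "L2 R F"
  shows "AE x in lon I. (fint F x)^2 \<le> D x * fint (\<lambda>z. (F z)^2) x"
proof -
  have "AE x in lborel. x \<in> I \<longrightarrow> L2 (fib x) (\<lambda>y. F (x,y))"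
    using L2_fibre[OF F] by (subst (asm) AE_lon) auto
  then show ?thesis
  proof (subst AE_lon; simp; eventually_elim)
    case (elim x)
    show ?case
    proof
      assume x: "a < x \<and> x < b"
      then have L: "L2 (fib x) (\<lambda>y. F (x,y))" using elim by auto
      have 1: "L2 (fib x) (\<lambda>y. 1)" by (rule L2_bounded[where C=1]) auto
      have "sint (fib x) (\<lambda>y. 1) = D x" using fint_const[of x "\<lambda>_. 1"] x
        by (simp add: fint_def sint_lon)
      then have n1: "(L2norm (fib x) (\<lambda>y. 1))^2 = D x" unfolding L2norm_square by simp
      have "(\<bar>sint (fib x) (\<lambda>y. 1 * F (x,y))\<bar>)^2 \<le> (L2norm (fib x) (\<lambda>y. 1) * L2norm (fib x) (\<lambda>y. F (x,y)))^2"
        by (rule power_mono[OF L2_Cauchy_Schwarz[OF _ 1 L]]) auto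
      then show "(fint F x)\<^sup>2 \<le> D x * fint (\<lambda>z. (F z)\<^sup>2) x"
        unfolding power_mult_distrib n1 unfolding L2norm_square by (simp add: fint_def sint_lon)
    qed
  qed
qed

lemma L2_fint:
  assumes F: "L2 R F"
  shows "L2 I (fint F)"
proof -
  obtain B where B: "\<And>x. x \<in> {a..b} \<Longrightarrow> D x \<le> B" "0 < B" using D_bounded by metis
  have Fm: "F \<in> borel_measurable (lon R)" and F2: "integrable (lon R) (\<lambda>z. (F z)^2)"
    using F by (auto simp: L2_iff)
  have m[measurable]: "fint F \<in> borel_measurable (lon I)" by (rule fint_measurable[OF Fm])
  have "integrable (lon I) (\<lambda>x. (fint F x)^2)"
  proof (rule Bochner_Integration.integrable_bound)
    show "integrable (lon I) (\<lambda>x. B * fint (\<lambda>z. (F z)^2) x)" using fubini_R(2)[OF F2] by simp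
    show "AE x in lon I. norm ((fint F x)\<^sup>2) \<le> norm (B * fint (\<lambda>z. (F z)\<^sup>2) x)"
      using fint_square_le[OF F] AE_space
    proof eventually_elim
      case (elim x)
      then have "x \<in> I" by (simp add: space_restrict_space)
      then have D: "D x \<le> B" "0 < D x" using B D_pos[of x] by auto
      have "0 \<le> fint (\<lambda>z. (F z)\<^sup>2) x" by (simp add: fint_def)
      then have "D x * fint (\<lambda>z. (F z)\<^sup>2) x \<le> B * fint (\<lambda>z. (F z)\<^sup>2) x" by (intro mult_right_mono D)
      then show ?case using elim(1) by simp
    qed
  qed measurable
  then show ?thesis using m by (simp add: L2_iff)
qed

lemma D_inverse_measurable: "(\<lambda>x. 1 / D x) \<in> borel_measurable (lon I)"
  and D_measurable: "D \<in> borel_measurable (lon I)"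
proof -
  have c: "continuous_on I D" by (rule continuous_on_subset[OF D_cont]) auto
  have "D x \<noteq> 0" if "x \<in> I" for x using D_pos[of x] that by auto
  then have "continuous_on I (\<lambda>x. 1 / D x)" by (intro continuous_on_divide c continuous_on_const) auto
  with c show "(\<lambda>x. 1 / D x) \<in> borel_measurable (lon I)" "D \<in> borel_measurable (lon I)"
    by (auto intro: continuous_on_measurable_lon)
qed

definition favg :: "(real \<times> real \<Rightarrow> real) \<Rightarrow> real \<Rightarrow> real" where
  "favg F x = 1 / D x * fint F x"

lemma L2_favg:
  assumes F: "L2 R F" shows "L2 I (favg F)"
  unfolding favg_def
proof (rule L2_bounded_mult[OF _ L2_fint[OF F] D_inverse_measurable])
  show "\<bar>1 / D x\<bar> \<le> 1 / (2 * c0)" if "x \<in> I" for x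
    using D_ge[of x] D_pos[of x] c0 that by (simp add: frac_le)
qed simp

text \<open>Jensen's inequality on the fibre; integrated over \<open>x\<close>, it makes averaging a
  contraction into \<open>L2\<close> with weight \<open>D\<close>.\<close>

lemma favg_square_le:
  assumes F: "L2 R F"
  shows "AE x in lon I. D x * (favg F x)^2 \<le> fint (\<lambda>z. (F z)^2) x"
  using fint_square_le[OF F] AE_space
proof eventually_elim
  case (elim x)
  then have "x \<in> I" by (simp add: space_restrict_space)
  then have D: "0 < D x" using D_pos[of x] by auto
  have "D x * (favg F x)^2 = (fint F x)^2 / D x"
    using D by (simp add: favg_def field_simps power2_eq_square)
  also have "\<dots> \<le> fint (\<lambda>z. (F z)^2) x" using elim D by (simp add: field_simps)
  finally show ?case .
qed

end

subsection \<open>Weak gradients on the thin domain\<close>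

lemma H1_2_wgrad:
  assumes "H1_2 S u"
  shows "L2 S u" "L2 S (fst (wgrad S u))" "L2 S (snd (wgrad S u))"
    "is_wgrad S u (fst (wgrad S u)) (snd (wgrad S u))"
proof -
  show "L2 S u" using assms by (simp add: H1_2_def)
  have "\<exists>g. L2 S (fst g) \<and> L2 S (snd g) \<and> is_wgrad S u (fst g) (snd g)"
    using assms by (auto simp: H1_2_def)
  from someI_ex[OF this] show "L2 S (fst (wgrad S u))" "L2 S (snd (wgrad S u))"
    "is_wgrad S u (fst (wgrad S u)) (snd (wgrad S u))"
    unfolding wgrad_def by auto
qed

lemma is_wgrad_diff:
  assumes S: "S \<in> sets borel" "bounded S"
    and L: "L2 S u" "L2 S u'" "L2 S gx" "L2 S gx'" "L2 S gy" "L2 S gy'"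
    and g: "is_wgrad S u gx gy" "is_wgrad S u' gx' gy'"
  shows "is_wgrad S (\<lambda>z. u z - u' z) (\<lambda>z. gx z - gx' z) (\<lambda>z. gy z - gy' z)"
  unfolding is_wgrad_def
proof (intro allI impI)
  fix \<Phi> assume t: "test2 S \<Phi>"
  note T = test2_L2[OF t S]
  note i = L2_mult_integrable[OF S(1)]
  show "sint S (\<lambda>z. (u z - u' z) * pdx \<Phi> z) = - sint S (\<lambda>z. (gx z - gx' z) * \<Phi> z) \<and>
    sint S (\<lambda>z. (u z - u' z) * pdy \<Phi> z) = - sint S (\<lambda>z. (gy z - gy' z) * \<Phi> z)"
    using g t i[OF L(1) T(2)] i[OF L(2) T(2)] i[OF L(1) T(3)] i[OF L(2) T(3)] i[OF L(3) T(1)] i[OF L(4) T(1)]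
     i[OF L(5) T(1)] i[OF L(6) T(1)]
    unfolding is_wgrad_def by (simp add: sint_lon[OF S(1)] left_diff_distrib)
qed

context thin_domain begin

text \<open>Frees the weak formulation from the arbitrary choice made by \<open>wgrad\<close>: any
  explicit weak gradient may be inserted instead.\<close>

lemma is_wgrad_unique:
  assumes L: "L2 R gx" "L2 R gx'" "L2 R gy" "L2 R gy'"
    and g: "is_wgrad R u gx gy" "is_wgrad R u gx' gy'"
  shows "AE z in lon R. gx z = gx' z" "AE z in lon R. gy z = gy' z"
proof -
  have *: "AE z in lon R. p z = q z" if pq: "L2 R p" "L2 R q"
    and e: "\<And>\<Phi>. test2 R \<Phi> \<Longrightarrow> sint R (\<lambda>z. p z * \<Phi> z) = sint R (\<lambda>z. q z * \<Phi> z)" for p q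
  proof -
    have "AE z in lon R. p z - q z = 0"
    proof (rule fundamental_lemma_2[OF open_R])
      show "integrable (lon R) (\<lambda>z. p z - q z)"
        using pq by (intro L2_integrable L2_diff bounded_R) auto
      fix c d c' d' \<phi> \<psi>
      assume s: "{c<..<d} \<times> {c'<..<d'} \<subseteq> R" and t: "test1 {c<..<d} \<phi>" "test1 {c'<..<d'} \<psi>"
      note t2 = test2_product(1)[OF t s]
      note T = test2_L2(1)[OF t2 R_borel bounded_R]
      show "sint R (\<lambda>x. (p x - q x) * (\<phi> (fst x) * \<psi> (snd x))) = 0"
        using e[OF t2] L2_mult_integrable[OF R_borel pq(1) T] L2_mult_integrable[OF R_borel pq(2) T]
        by (simp add: sint_lon left_diff_distrib)
    qed
    then show ?thesis by eventually_elim simp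
  qed
  show "AE z in lon R. gx z = gx' z"
    by (rule *[OF L(1,2)]) (use g in \<open>auto simp: is_wgrad_def\<close>)
  show "AE z in lon R. gy z = gy' z"
    by (rule *[OF L(3,4)]) (use g in \<open>auto simp: is_wgrad_def\<close>)
qed

text \<open>A compact support in \<open>R\<close> allows integration over the fixed interval
  \<open>{-M..M}\<close> in place of the moving fibre. Differentiation under the integral sign then
  produces no boundary terms.\<close>

lemma fint_support:
  assumes g: "continuous_on UNIV g" and K: "K \<subseteq> R" "\<And>z. z \<notin> K \<Longrightarrow> g z = 0"
    and M: "\<And>z. z \<in> K \<Longrightarrow> \<bar>snd z\<bar> < M" and x: "x \<in> I"
  shows "fint g x = integral {-M..M} (\<lambda>y. g (x,y))"
proof -
  have c: "continuous_on A (\<lambda>y. g (x,y))" for A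
    by (intro continuous_on_compose2[OF g] continuous_intros) auto
  have z: "g (x,y) = 0" if "(x,y) \<notin> R" for y using that K by blast
  have "fint g x = integral\<^sup>L lborel (\<lambda>y. g (x,y))"
    unfolding fint_def by (rule lborel_integral_support) (use z x in \<open>auto simp: mem_R\<close>)
  also have "\<dots> = sint {-M..M} (\<lambda>y. g (x,y))"
    unfolding set_lebesgue_integral_def
  proof (rule Bochner_Integration.integral_cong[OF refl])
    fix y
    have "g (x,y) = 0" if "y \<notin> {-M..M}" using that M[of "(x,y)"] K(2)[of "(x,y)"] by fastforce
    then show "g (x,y) = indicator {-M..M} y *\<^sub>R g (x,y)" by (auto split: split_indicator)
  qed
  also have "\<dots> = integral {-M..M} (\<lambda>y. g (x,y))"
    using borel_integrable_compact[OF compact_Icc c, of "-M" M]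
    by (intro set_borel_integral_eq_integral(2)) (simp add: set_integrable_def)
  finally show ?thesis .
qed

lemma section_subset_fib: "A \<times> B \<subseteq> R \<Longrightarrow> x \<in> A \<Longrightarrow> B \<subseteq> fib x"
proof
  fix y assume "A \<times> B \<subseteq> R" "x \<in> A" "y \<in> B"
  then have "(x,y) \<in> R" by blast
  then show "y \<in> fib x" by (simp add: mem_R)
qed

text \<open>For a function of \<open>x\<close> alone, testing with \<open>\<Phi>\<close> amounts to
  testing in one variable with the fibre integral \<open>G\<close> of \<open>\<Phi>\<close>. This
  \<open>G\<close> is again a test function, and the fibre integral of \<open>pdy \<Phi>\<close>
  vanishes since \<open>\<Phi>\<close> does at both ends.\<close>

lemma is_wgrad_fst:
  assumes u: "L2 I u" and v: "L2 I v" and w: "is_wderiv I u v"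
  shows "is_wgrad R (\<lambda>z. u (fst z)) (\<lambda>z. v (fst z)) (\<lambda>z. 0)"
  unfolding is_wgrad_def
proof (intro allI impI conjI)
  fix \<Phi> assume t: "test2 R \<Phi>"
  obtain K where K: "compact K" "K \<subseteq> R" "\<And>z. z \<notin> K \<Longrightarrow> \<Phi> z = 0"
    "\<And>z. z \<notin> K \<Longrightarrow> pdx \<Phi> z = 0" "\<And>z. z \<notin> K \<Longrightarrow> pdy \<Phi> z = 0"
    using test2_support[OF t] by metis
  obtain M0 where M0: "\<And>z. z \<in> K \<Longrightarrow> norm z \<le> M0"
    using compact_imp_bounded[OF K(1)] by (auto simp: bounded_iff)
  define M where "M = max 0 M0 + 1"
  have M: "\<bar>snd z\<bar> < M" if "z \<in> K" for z
    using M0[OF that] norm_snd_le[of "snd z" "fst z"] by (simp add: M_def)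
  have Mpos: "0 < M" unfolding M_def by simp
  note cont = test2_continuous[OF t, of UNIV]
  note L = test2_L2[OF t R_borel bounded_R]
  have cc: "continuous_on A (\<lambda>(x,y). pdx \<Phi> (x,y))" "continuous_on B (\<lambda>y. \<Phi> (x,y))" "continuous_on B (\<lambda>y. pdy \<Phi> (x,y))" for A B x
    by (simp_all add: split_beta test2_continuous[OF t])
      (intro continuous_on_compose2[OF cont(1)] continuous_on_compose2[OF cont(3)] continuous_intros; simp)+
  define G where "G x = integral (cbox (-M) M) (\<lambda>y. \<Phi> (x,y))" for x
  define G' where "G' x = integral (cbox (-M) M) (\<lambda>y. pdx \<Phi> (x,y))" for x
  have fG: "fint \<Phi> x = G x" "fint (pdx \<Phi>) x = G' x" if "x \<in> I" for x
    using fint_support[OF cont(1) K(2,3) M that] fint_support[OF cont(2) K(2,4) M that]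
    by (simp_all add: G_def G'_def)
  have fy: "fint (pdy \<Phi>) x = 0" if "x \<in> I" for x
  proof -
    have "((\<lambda>y. pdy \<Phi> (x,y)) has_integral (\<Phi> (x,M) - \<Phi> (x,-M))) {-M..M}"
    proof (rule fundamental_theorem_of_calculus)
      show "((\<lambda>y. \<Phi> (x, y)) has_vector_derivative pdy \<Phi> (x, y)) (at y within {-M..M})" for y
        using pdx_pdy_has_derivative(2)[OF test2_has_derivative[OF t, of "(x,y)"]]
        by (simp add: has_real_derivative_iff_has_vector_derivative has_vector_derivative_at_within)
    qed (use Mpos in simp)
    moreover have "\<Phi> (x,M) = 0" "\<Phi> (x,-M) = 0"
      using M[of "(x,M)"] M[of "(x,-M)"] K(3) Mpos by fastforce+
    ultimately show ?thesis
      using fint_support[OF cont(3) K(2,5) M that] by (simp add: integral_unique)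
  qed
  have dG: "(G has_real_derivative G' x) (at x)" for x
    unfolding G_def G'_def
  proof (rule leibniz_rule_field_derivative[where U=UNIV])
    show "((\<lambda>x. \<Phi> (x, t)) has_real_derivative pdx \<Phi> (x, t)) (at x)" for x t
      using pdx_pdy_has_derivative(1)[OF test2_has_derivative[OF t, of "(x,t)"]] by simp
    show "(\<lambda>y. \<Phi> (x, y)) integrable_on cbox (- M) M" for x
      by (intro integrable_continuous cc)
  qed (use cc in auto)
  have cG: "continuous_on UNIV G'" unfolding G'_def by (rule integral_continuous_on_param[OF cc(1)])
  have sub: "fst ` K \<subseteq> I" using K(2) by (auto simp: R_def)
  have G0: "G x = 0" if "x \<notin> fst ` K" for x
  proof -
    have "\<And>y. \<Phi> (x,y) = 0" using that K(3) by (metis fst_conv image_eqI)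
    then show ?thesis by (simp add: G_def)
  qed
  note tG = test1I[OF dG cG compact_continuous_image[OF continuous_on_fst[OF continuous_on_id] K(1)] sub G0]
  have fub: "sint R (\<lambda>z. g (fst z) * F z) = integral\<^sup>L (lon I) (\<lambda>x. g x * fint F x)" if "L2 I g" "L2 R F" for g F
    unfolding sint_lon[OF R_borel] fubini_R(3)[OF L2_mult_integrable[OF R_borel L2_fst(1)[OF that(1)] that(2)]] fint_mult_fst ..
  have "sint R (\<lambda>z. u (fst z) * pdx \<Phi> z) = integral\<^sup>L (lon I) (\<lambda>x. u x * deriv G x)"
    unfolding fub[OF u L(2)] by (rule integral_lon_cong) (auto simp: fG tG)
  also have "\<dots> = - integral\<^sup>L (lon I) (\<lambda>x. v x * G x)"
    using w tG(1) unfolding is_wderiv_def by (simp add: sint_lon)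
  also have "integral\<^sup>L (lon I) (\<lambda>x. v x * G x) = sint R (\<lambda>z. v (fst z) * \<Phi> z)"
    unfolding fub[OF v L(1)] by (rule integral_lon_cong) (auto simp: fG)
  finally show "sint R (\<lambda>z. u (fst z) * pdx \<Phi> z) = - sint R (\<lambda>z. v (fst z) * \<Phi> z)" .
  have "sint R (\<lambda>z. u (fst z) * pdy \<Phi> z) = integral\<^sup>L (lon I) (\<lambda>x. 0)"
    unfolding fub[OF u L(3)] by (rule integral_lon_cong) (auto simp: fy)
  then show "sint R (\<lambda>z. u (fst z) * pdy \<Phi> z) = - sint R (\<lambda>z. 0 * \<Phi> z)" by simp
qed

text \<open>With \<open>V(x,y) = \<integral> g\<^sub>y(x,t) dt\<close> over \<open>l x < t \<le> y\<close>, the function \<open>z - V\<close> has vanishing weak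
  \<open>y\<close>-derivative, so it depends on \<open>x\<close> only.\<close>

lemma fibre_representation:
  assumes z: "L2 R z" and gy: "L2 R gy" and g: "is_wgrad R z gx gy"
  obtains \<zeta> where "integrable (lon I) \<zeta>" "AE p in lon R. \<bar>z p - \<zeta> (fst p)\<bar> \<le> fint (\<lambda>q. \<bar>gy q\<bar>) (fst p)"
proof -
  define N where "N = fint (\<lambda>q. \<bar>gy q\<bar>)"
  define V where "V p = prim (l (fst p)) (m (fst p)) (\<lambda>t. gy (fst p, t)) (snd p)" for p
  have gym: "gy \<in> borel_measurable (lon R)" using gy by (simp add: L2_iff)
  have gyi: "integrable (lon R) gy" using gy by (intro L2_integrable bounded_R) auto
  have gyabs: "L2 R (\<lambda>q. \<bar>gy q\<bar>)" using gy by (auto simp: L2_iff)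
  have NL: "L2 I N" unfolding N_def by (rule L2_fint[OF gyabs])
  have fi: "AE x in lon I. integrable (lon (fib x)) (\<lambda>t. gy (x,t))" by (rule fubini_R(1)[OF gyi])
  \<comment> \<open>\<open>V\<close> is an integral with moving upper limit, so joint measurability
    in both coordinates is needed; it follows by viewing the integrand as a function of the point
    and of the integration variable.\<close>
  have Vm: "V \<in> borel_measurable (lon R)"
  proof -
    have [measurable]: "(\<lambda>q. indicator R q * gy q) \<in> borel_measurable (borel \<Otimes>\<^sub>M borel)"
      using ext_measurable[OF gym] by (simp cong: measurable_cong_sets)
    have "(\<lambda>p. \<integral>t. indicator {..snd p} t * (indicator R (fst p, t) * gy (fst p,t)) \<partial>lborel) \<in> borel_measurable (borel \<Otimes>\<^sub>M borel)"
    proof (rule lborel.borel_measurable_lebesgue_integral)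
      have 1: "(\<lambda>(p::real\<times>real,t). indicator R (fst p, t) * gy (fst p,t)) \<in> borel_measurable ((borel \<Otimes>\<^sub>M borel) \<Otimes>\<^sub>M lborel)"
        using measurable_compose[of "\<lambda>(p,t). (fst p, t)" "(borel \<Otimes>\<^sub>M borel) \<Otimes>\<^sub>M lborel" "borel \<Otimes>\<^sub>M borel" "\<lambda>q. indicator R q * gy q" borel]
        by (simp add: split_beta')
      have 2: "(\<lambda>(p::real\<times>real,t). indicator {..snd p} t :: real) \<in> borel_measurable ((borel \<Otimes>\<^sub>M borel) \<Otimes>\<^sub>M lborel)"
        by (simp add: indicator_def)
      from borel_measurable_times[OF 2 1]
      show "(\<lambda>(p, t). indicator {..snd p} t * (indicator R (fst p, t) * gy (fst p, t))) \<in> borel_measurable ((borel \<Otimes>\<^sub>M borel) \<Otimes>\<^sub>M lborel)"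
        by (simp add: split_beta')
    qed
    then have "(\<lambda>p. \<integral>t. indicator {..snd p} t * (indicator R (fst p, t) * gy (fst p,t)) \<partial>lborel) \<in> borel_measurable (lon R)"
      by (intro measurable_restrict_space1) (simp add: borel_prod)
    moreover have "V p = (\<integral>t. indicator {..snd p} t * (indicator R (fst p, t) * gy (fst p,t)) \<partial>lborel)" if "p \<in> R" for p
      using R_fst[OF that] unfolding V_def prim_def integral_restrict_space[of "fib (fst p)" lborel, simplified]
      by (intro Bochner_Integration.integral_cong) (auto simp: indicator_R split: split_indicator)
    ultimately show ?thesis
      by (subst measurable_cong[where g="\<lambda>p. \<integral>t. indicator {..snd p} t * (indicator R (fst p, t) * gy (fst p,t)) \<partial>lborel"])
        (auto simp: space_restrict_space)
  qed
  have Vle: "AE p in lon R. \<bar>V p\<bar> \<le> N (fst p)"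
    using AE_fst[OF fi]
  proof eventually_elim
    case (elim p)
    then show ?case using prim_bound[OF elim, of "snd p"] by (simp add: V_def N_def fint_def)
  qed
  have VL: "L2 R V"
  proof -
    have "integrable (lon R) (\<lambda>p. (V p)^2)"
    proof (rule Bochner_Integration.integrable_bound)
      show "integrable (lon R) (\<lambda>p. (N (fst p))^2)" using L2_fst(1)[OF NL] by (simp add: L2_iff)
      show "(\<lambda>p. (V p)\<^sup>2) \<in> borel_measurable (lon R)" using Vm by simp
      show "AE p in lon R. norm ((V p)\<^sup>2) \<le> norm ((N (fst p))\<^sup>2)"
        using Vle by eventually_elim (auto simp: abs_le_square_iff[symmetric])
    qed
    then show ?thesis using Vm by (simp add: L2_iff)
  qed
  define Z where "Z p = z p - V p" for p
  have ZL: "L2 R Z" unfolding Z_def by (intro L2_diff z VL) simp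
  \<comment> \<open>On almost every fibre \<open>V\<close> is a primitive of \<open>gy\<close>,
    which gives the identity fibre by fibre. With a product test function \<open>\<phi> x\<close> is
    a mere factor there, and Fubini reassembles the fibres.\<close>
  have Z0: "sint R (\<lambda>p. Z p * (\<phi> (fst p) * deriv \<psi> (snd p))) = 0"
    if phi: "test1 {\<alpha><..<\<beta>} \<phi>" and psi: "test1 {c<..<d} \<psi>" and s: "{\<alpha><..<\<beta>} \<times> {c<..<d} \<subseteq> R" for \<alpha> \<beta> c d \<phi> \<psi>
  proof -
    note t = test2_product[OF phi psi s]
    note L = test2_L2[OF t(1) R_borel bounded_R, unfolded t(2,3)]
    have "sint R (\<lambda>p. z p * (\<phi> (fst p) * deriv \<psi> (snd p))) = - sint R (\<lambda>p. gy p * (\<phi> (fst p) * \<psi> (snd p)))"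
    proof -
      have "sint R (\<lambda>p. z p * pdy (\<lambda>p. \<phi> (fst p) * \<psi> (snd p)) p) = - sint R (\<lambda>p. gy p * (\<phi> (fst p) * \<psi> (snd p)))"
        using g t(1) unfolding is_wgrad_def by blast
      then show ?thesis unfolding t(3) .
    qed
    moreover have "sint R (\<lambda>p. V p * (\<phi> (fst p) * deriv \<psi> (snd p))) = - sint R (\<lambda>p. gy p * (\<phi> (fst p) * \<psi> (snd p)))"
    proof -
      note i1 = L2_mult_integrable[OF R_borel VL L(3)] and i2 = L2_mult_integrable[OF R_borel gy L(1)]
      have "AE x in lon I. fint (\<lambda>p. V p * (\<phi> (fst p) * deriv \<psi> (snd p))) x = - fint (\<lambda>p. gy p * (\<phi> (fst p) * \<psi> (snd p))) x"
        using fi AE_space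
      proof eventually_elim
        case (elim x)
        then have x: "x \<in> I" by (simp add: space_restrict_space)
        show ?case
        proof (cases "x \<in> {\<alpha><..<\<beta>}")
          case True
          have "{c<..<d} \<subseteq> fib x" by (rule section_subset_fib[OF s True])
          then have ps: "test1 (fib x) \<psi>" using psi test1_mono by blast
          have lm: "l x < m x" using D_pos[of x] x by (simp add: D_def)
          have "sint (fib x) (\<lambda>y. (0 + prim (l x) (m x) (\<lambda>t. gy (x,t)) y) * deriv \<psi> y) = - sint (fib x) (\<lambda>y. gy (x,y) * \<psi> y)"
            using is_wderiv_prim[OF lm elim(1), of 0] ps unfolding is_wderiv_def by blast
          then have e: "integral\<^sup>L (lon (fib x)) (\<lambda>y. V (x,y) * deriv \<psi> y) = - integral\<^sup>L (lon (fib x)) (\<lambda>y. gy (x,y) * \<psi> y)"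
            by (simp add: V_def sint_lon)
          have "fint (\<lambda>p. V p * (\<phi> (fst p) * deriv \<psi> (snd p))) x = \<phi> x * integral\<^sup>L (lon (fib x)) (\<lambda>y. V (x,y) * deriv \<psi> y)"
            unfolding fint_def by (subst integral_mult_right_zero[symmetric]) (simp add: ac_simps)
          also have "\<dots> = - (\<phi> x * integral\<^sup>L (lon (fib x)) (\<lambda>y. gy (x,y) * \<psi> y))" unfolding e by simp
          also have "\<phi> x * integral\<^sup>L (lon (fib x)) (\<lambda>y. gy (x,y) * \<psi> y) = fint (\<lambda>p. gy p * (\<phi> (fst p) * \<psi> (snd p))) x"
            unfolding fint_def by (subst integral_mult_right_zero[symmetric]) (simp add: ac_simps)
          finally show ?thesis .
        next
          case False
          then have "\<phi> x = 0" using test1_support[OF phi] by (metis subsetD)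
          then show ?thesis by (simp add: fint_def)
        qed
      qed
      then have "integral\<^sup>L (lon I) (fint (\<lambda>p. V p * (\<phi> (fst p) * deriv \<psi> (snd p)))) = integral\<^sup>L (lon I) (\<lambda>x. - fint (\<lambda>p. gy p * (\<phi> (fst p) * \<psi> (snd p))) x)"
        using fubini_R(2)[OF i1] fubini_R(2)[OF i2] by (intro integral_cong_AE) auto
      then show ?thesis unfolding sint_lon[OF R_borel] fubini_R(3)[OF i1] fubini_R(3)[OF i2] by simp
    qed
    ultimately show ?thesis
      using L2_mult_integrable[OF R_borel z L(3)] L2_mult_integrable[OF R_borel VL L(3)]
      by (simp add: Z_def sint_lon left_diff_distrib)
  qed
  \<comment> \<open>Every fibre contains the interval from \<open>-c0\<close> to \<open>c0\<close>,
    so a single \<open>\<rho>\<close> serves all \<open>x\<close> at once.\<close>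
  have "- c0 < c0" using c0 by simp
  then obtain \<rho> where rho: "test1 {-c0<..<c0} \<rho>" "integral\<^sup>L lborel \<rho> = 1" using ex_unit_test1 by metis
  obtain Cr where Cr: "\<And>x. \<bar>\<rho> x\<bar> \<le> Cr" using test1_bounded[OF rho(1)] by metis
  have rhoR: "(\<lambda>p. \<rho> (snd p)) \<in> borel_measurable (lon R)"
    using fst_snd_measurable_lon(2)[OF test1_measurable(1)[OF rho(1)]] .
  have ZrL: "L2 R (\<lambda>p. \<rho> (snd p) * Z p)" using L2_bounded_mult[OF R_borel ZL rhoR] Cr by auto
  \<comment> \<open>The \<open>\<rho>\<close>-weighted fibre mean plays the part of the constant of
    integration, now depending on \<open>x\<close>.\<close>
  define \<zeta> where "\<zeta> = fint (\<lambda>p. \<rho> (snd p) * Z p)"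
  have zL: "L2 I \<zeta>" unfolding \<zeta>_def by (rule L2_fint[OF ZrL])
  have zi: "integrable (lon I) \<zeta>" using zL by (intro L2_integrable) auto
  obtain Kr where Kr: "compact Kr" "Kr \<subseteq> {-c0<..<c0}" "\<And>x. x \<notin> Kr \<Longrightarrow> \<rho> x = 0" using test1_support[OF rho(1)] by metis
  have "AE p in lon R. Z p - \<zeta> (fst p) = 0"
  proof (rule fundamental_lemma_2[OF open_R])
    show "integrable (lon R) (\<lambda>p. Z p - \<zeta> (fst p))"
      by (intro L2_integrable L2_diff ZL L2_fst(1)[OF zL] bounded_R) auto
    fix \<alpha> \<beta> c d \<phi> \<psi>
    assume s: "{\<alpha><..<\<beta>} \<times> {c<..<d} \<subseteq> R" and phi: "test1 {\<alpha><..<\<beta>} \<phi>" and psi: "test1 {c<..<d} \<psi>"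
    obtain Kp where Kp: "compact Kp" "Kp \<subseteq> {c<..<d}" "\<And>x. x \<notin> Kp \<Longrightarrow> \<psi> x = 0" using test1_support[OF psi] by metis
    show "sint R (\<lambda>p. (Z p - \<zeta> (fst p)) * (\<phi> (fst p) * \<psi> (snd p))) = 0"
    proof (cases "c < d")
      case False
      then have "\<psi> y = 0" for y using Kp by auto
      then show ?thesis by simp
    next
      case cd: True
      define A where "A = integral\<^sup>L lborel \<psi>"
      \<comment> \<open>The hull of the supports of \<open>\<psi>\<close> and \<open>\<rho>\<close>:
        fibres are intervals containing both, so the enlarged rectangle stays inside
        \<open>R\<close> and \<open>\<Psi>\<close> is admissible in \<open>Z0\<close>.\<close>
      let ?c = "min c (- c0)" and ?d = "max d c0"
      obtain \<Psi> where Psi: "test1 {?c<..<?d} \<Psi>" "deriv \<Psi> = (\<lambda>y. \<psi> y - A * \<rho> y)"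
      proof (rule test1_antiderivative[of "\<lambda>y. \<psi> y - A * \<rho> y" "Kp \<union> Kr" ?c ?d])
        show "continuous_on UNIV (\<lambda>x. \<psi> x - A * \<rho> x)"
          by (intro continuous_intros test1_continuous[OF psi] test1_continuous[OF rho(1)])
        show "compact (Kp \<union> Kr)" using Kp Kr by auto
        show "Kp \<union> Kr \<subseteq> {?c<..<?d}" using Kp(2) Kr(2) by fastforce
        have "integrable lborel \<psi>" "integrable lborel \<rho>"
          using continuous_support_integrable[OF test1_continuous[OF psi] Kp(1,3)]
            continuous_support_integrable[OF test1_continuous[OF rho(1)] Kr(1,3)] by auto
        then show "integral\<^sup>L lborel (\<lambda>x. \<psi> x - A * \<rho> x) = 0" using rho(2) by (simp add: A_def)
        show "\<psi> x - A * \<rho> x = 0" if "x \<notin> Kp \<union> Kr" for x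
          using that Kr(3)[of x] Kp(3)[of x] by simp
      qed
      have sub: "{\<alpha><..<\<beta>} \<times> {?c<..<?d} \<subseteq> R"
      proof clarify
        fix x y assume x: "x \<in> {\<alpha><..<\<beta>}" and y: "y \<in> {?c<..<?d}"
        have cdx: "{c<..<d} \<subseteq> fib x" by (rule section_subset_fib[OF s x])
        obtain t where "c < t" "t < d" using dense[OF cd] by blast
        then have "(x,t) \<in> R" using s x by auto
        then have xI: "x \<in> I" by (simp add: mem_R)
        have "l x \<le> c \<and> d \<le> m x" using cdx cd by (simp add: greaterThanLessThan_subseteq_greaterThanLessThan)
        moreover have "l x \<le> - c0" "c0 \<le> m x" using l_le[of x] m_ge[of x] xI by auto
        ultimately show "(x,y) \<in> R" using y xI by (auto simp: mem_R)
      qed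
      have rs: "{\<alpha><..<\<beta>} \<times> {-c0<..<c0} \<subseteq> R" using sub by fastforce
      note L1 = test2_L2(1)[OF test2_product(1)[OF phi psi s] R_borel bounded_R]
      note L2' = test2_L2(1)[OF test2_product(1)[OF phi rho(1) rs] R_borel bounded_R]
      note i1 = L2_mult_integrable[OF R_borel ZL L1] and i2 = L2_mult_integrable[OF R_borel ZL L2']
        and i3 = L2_mult_integrable[OF R_borel L2_fst(1)[OF zL] L1]
      have "0 = integral\<^sup>L (lon R) (\<lambda>p. Z p * (\<phi> (fst p) * \<psi> (snd p)) - A * (Z p * (\<phi> (fst p) * \<rho> (snd p))))"
        using Z0[OF phi Psi(1) sub] by (simp add: Psi(2) sint_lon algebra_simps)
      then have e1: "integral\<^sup>L (lon R) (\<lambda>p. Z p * (\<phi> (fst p) * \<psi> (snd p))) = A * integral\<^sup>L (lon R) (\<lambda>p. Z p * (\<phi> (fst p) * \<rho> (snd p)))"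
        using i1 i2 by simp
      have e2: "integral\<^sup>L (lon R) (\<lambda>p. Z p * (\<phi> (fst p) * \<rho> (snd p))) = integral\<^sup>L (lon I) (\<lambda>x. \<phi> x * \<zeta> x)"
        unfolding fubini_R(3)[OF i2]
        by (rule integral_lon_cong) (auto simp: \<zeta>_def fint_def integral_mult_right_zero[symmetric] ac_simps simp del: integral_mult_right_zero)
      have "integral\<^sup>L (lon R) (\<lambda>p. \<zeta> (fst p) * (\<phi> (fst p) * \<psi> (snd p))) = integral\<^sup>L (lon I) (\<lambda>x. A * (\<phi> x * \<zeta> x))"
        unfolding fubini_R(3)[OF i3]
      proof (rule integral_lon_cong)
        fix x assume x: "x \<in> I"
        show "fint (\<lambda>p. \<zeta> (fst p) * (\<phi> (fst p) * \<psi> (snd p))) x = A * (\<phi> x * \<zeta> x)"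
        proof (cases "x \<in> {\<alpha><..<\<beta>}")
          case True
          have sub: "{c<..<d} \<subseteq> fib x" by (rule section_subset_fib[OF s True])
          have "integral\<^sup>L (lon (fib x)) \<psi> = A" unfolding A_def
            by (rule lborel_integral_support, simp) (meson Kp(2,3) sub subsetD)
          then show ?thesis by (simp add: fint_def)
        next
          case False
          then have "\<phi> x = 0" using test1_support[OF phi] by (metis subsetD)
          then show ?thesis by (simp add: fint_def)
        qed
      qed simp
      then show ?thesis using e1 e2 i1 i3 by (simp add: sint_lon left_diff_distrib)
    qed
  qed
  with Vle have "AE p in lon R. \<bar>z p - \<zeta> (fst p)\<bar> \<le> N (fst p)"
    by eventually_elim (auto simp: Z_def)
  with zi show ?thesis using that unfolding N_def by blast
qed

text \<open>If \<open>z\<close> stays within \<open>fint \<bar>gy\<bar>\<close> of some function of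
  \<open>x\<close>, so does its fibre average; the triangle inequality gives the factor
  \<open>2\<close>. The bound is pointwise and independent of \<open>y\<close>, so unlike an
  integral Poincare inequality it can be restricted to the thin strip.\<close>

lemma fibre_oscillation:
  assumes z: "L2 R z" and gy: "L2 R gy" and g: "is_wgrad R z gx gy"
  shows "AE p in lon R. \<bar>z p - favg z (fst p)\<bar> \<le> 2 * fint (\<lambda>q. \<bar>gy q\<bar>) (fst p)"
proof -
  define N where "N = fint (\<lambda>q. \<bar>gy q\<bar>)"
  obtain \<zeta> where zi: "integrable (lon I) \<zeta>" and e: "AE p in lon R. \<bar>z p - \<zeta> (fst p)\<bar> \<le> N (fst p)"
    using fibre_representation[OF assms] unfolding N_def by metis
  have zint: "integrable (lon R) z" using z by (intro L2_integrable bounded_R) auto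
  have "AE x in lon I. \<bar>favg z x - \<zeta> x\<bar> \<le> N x"
    using AE_fibres[OF e] fubini_R(1)[OF zint] AE_space
  proof eventually_elim
    case (elim x)
    then have x: "x \<in> I" by (simp add: space_restrict_space)
    interpret finite_measure "lon (fib x)" by (rule finite_fib)
    have D: "0 < D x" using D_pos[of x] x by simp
    have c: "integral\<^sup>L (lon (fib x)) (\<lambda>y. k) = k * D x" for k
      using fint_const[OF x, of "\<lambda>_. k"] unfolding fint_def by simp
    have "integral\<^sup>L (lon (fib x)) (\<lambda>y. z (x,y) - \<zeta> x) = integral\<^sup>L (lon (fib x)) (\<lambda>y. z (x,y)) - integral\<^sup>L (lon (fib x)) (\<lambda>y. \<zeta> x)"
      by (rule Bochner_Integration.integral_diff) (use elim(2) in auto)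
    then have "\<bar>fint z x - \<zeta> x * D x\<bar> = \<bar>integral\<^sup>L (lon (fib x)) (\<lambda>y. z (x,y) - \<zeta> x)\<bar>"
      unfolding c fint_def by simp
    also have "\<dots> \<le> integral\<^sup>L (lon (fib x)) (\<lambda>y. \<bar>z (x,y) - \<zeta> x\<bar>)"
      using integral_norm_bound[of "lon (fib x)" "\<lambda>y. z (x,y) - \<zeta> x"] by simp
    also have "\<dots> \<le> integral\<^sup>L (lon (fib x)) (\<lambda>y. N x)"
      using elim(1,2) by (intro integral_mono_AE) auto
    also have "\<dots> = N x * D x" by (rule c)
    finally have le: "\<bar>fint z x - \<zeta> x * D x\<bar> \<le> N x * D x" .
    have "favg z x - \<zeta> x = (fint z x - \<zeta> x * D x) / D x" using D by (simp add: favg_def field_simps)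
    then have "\<bar>favg z x - \<zeta> x\<bar> = \<bar>fint z x - \<zeta> x * D x\<bar> / D x" using D by simp
    also have "\<dots> \<le> N x" using le D by (simp add: field_simps)
    finally show ?case .
  qed
  from AE_fst[OF this] e show ?thesis unfolding N_def[symmetric]
    by eventually_elim linarith
qed

end

subsection \<open>The weak derivative of the fibre average\<close>

context thin_domain begin

text \<open>\<open>sf\<close> is the fibre coordinate \<open>s\<close> in \<open>y = l x + s D x\<close>, and \<open>Yf\<close> is the derivative of \<open>y\<close> in \<open>x\<close> at fixed \<open>s\<close>.\<close>

definition D' where "D' x = m' x - l' x"
definition sf where "sf z = (snd z - l (fst z)) / D (fst z)"
definition Yf where "Yf z = l' (fst z) + sf z * D' (fst z)"

definition bounded_meas :: "(real \<times> real \<Rightarrow> real) \<Rightarrow> bool" where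
  "bounded_meas g \<longleftrightarrow> g \<in> borel_measurable (lon R) \<and> (\<exists>C. \<forall>z\<in>R. \<bar>g z\<bar> \<le> C)"

lemma bounded_meas_mult: assumes "bounded_meas f" "bounded_meas g" shows "bounded_meas (\<lambda>z. f z * g z)"
proof -
  obtain C E where "\<forall>z\<in>R. \<bar>f z\<bar> \<le> C" "\<forall>z\<in>R. \<bar>g z\<bar> \<le> E" using assms unfolding bounded_meas_def by blast
  then have "\<forall>z\<in>R. \<bar>f z * g z\<bar> \<le> \<bar>C\<bar> * \<bar>E\<bar>"
    unfolding abs_mult by (intro ballI mult_mono) (auto intro: order_trans[OF _ abs_ge_self])
  then show ?thesis using assms unfolding bounded_meas_def by auto
qed

lemma bounded_meas_add: assumes "bounded_meas f" "bounded_meas g" shows "bounded_meas (\<lambda>z. f z + g z)"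
proof -
  obtain C E where "\<forall>z\<in>R. \<bar>f z\<bar> \<le> C" "\<forall>z\<in>R. \<bar>g z\<bar> \<le> E" using assms unfolding bounded_meas_def by blast
  then have "\<forall>z\<in>R. \<bar>f z + g z\<bar> \<le> C + E" by (meson abs_triangle_ineq add_mono order_trans)
  then show ?thesis using assms unfolding bounded_meas_def by auto
qed

lemma bounded_meas_const: "bounded_meas (\<lambda>z. c)" unfolding bounded_meas_def by auto

lemma bounded_meas_diff: "bounded_meas f \<Longrightarrow> bounded_meas g \<Longrightarrow> bounded_meas (\<lambda>z. f z - g z)"
  using bounded_meas_add[of f "\<lambda>z. (-1) * g z"] bounded_meas_mult[of "\<lambda>z. -1" g] bounded_meas_const[of "-1"] by simp

lemma bounded_meas_fst:
  assumes q: "continuous_on {a..b} q" shows "bounded_meas (\<lambda>z. q (fst z))"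
proof -
  have "bounded (q ` {a..b})" by (auto intro!: compact_imp_bounded compact_continuous_image q)
  then obtain C where C: "\<forall>x\<in>{a..b}. \<bar>q x\<bar> \<le> C" by (auto simp: bounded_iff)
  have "\<bar>q (fst z)\<bar> \<le> C" if "z \<in> R" for z using R_fst[OF that] C by simp
  moreover have "q \<in> borel_measurable (lon I)"
    by (intro continuous_on_measurable_lon continuous_on_subset[OF q]) auto
  ultimately show ?thesis unfolding bounded_meas_def using comp_fst_measurable by blast
qed

lemma sf_range: "z \<in> R \<Longrightarrow> 0 < sf z" "z \<in> R \<Longrightarrow> sf z < 1"
  using D_pos[of "fst z"] by (auto simp: sf_def R_def D_def field_simps)

lemma sf_cont: "continuous_on (I \<times> UNIV) sf"
proof -
  have "D (fst z) \<noteq> 0" if "z \<in> I \<times> (UNIV::real set)" for z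
    using D_pos[of "fst z"] that by auto
  then show ?thesis unfolding sf_def
    by (intro continuous_intros continuous_on_compose2[OF l_cont] continuous_on_compose2[OF D_cont]) auto
qed

lemma bounded_meas_sf:
  assumes "continuous_on UNIV \<theta>" shows "bounded_meas (\<lambda>z. \<theta> (sf z))"
proof -
  have "bounded (\<theta> ` {0..1})" by (auto intro!: compact_imp_bounded compact_continuous_image continuous_on_subset[OF assms])
  then obtain C where C: "\<forall>x\<in>{0..1}. \<bar>\<theta> x\<bar> \<le> C" by (auto simp: bounded_iff)
  have "\<bar>\<theta> (sf z)\<bar> \<le> C" if "z \<in> R" for z using sf_range[OF that] C by simp
  moreover have "continuous_on R (\<lambda>z. \<theta> (sf z))"
    by (rule continuous_on_compose2[OF assms continuous_on_subset[OF sf_cont]]) (auto simp: R_def)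
  ultimately show ?thesis unfolding bounded_meas_def using continuous_on_measurable_lon by blast
qed

lemma D'_cont: "continuous_on {a..b} D'"
  unfolding D'_def by (intro continuous_intros l'_cont m'_cont)

lemma invD_cont: "continuous_on {a..b} (\<lambda>x. 1 / D x)"
  by (intro continuous_intros D_cont) (use D_pos in force)

lemma bounded_meas_Yf: "bounded_meas Yf"
  unfolding Yf_def by (intro bounded_meas_add bounded_meas_mult bounded_meas_fst l'_cont D'_cont bounded_meas_sf[of "\<lambda>x. x"] continuous_on_id)

lemma L2_bounded_meas: "L2 R F \<Longrightarrow> bounded_meas g \<Longrightarrow> L2 R (\<lambda>z. g z * F z)"
  unfolding bounded_meas_def by (auto intro: L2_bounded_mult)

lemma integrable_bounded_meas: "L2 R F \<Longrightarrow> bounded_meas g \<Longrightarrow> integrable (lon R) (\<lambda>z. F z * g z)"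
  using L2_integrable[OF R_borel bounded_R L2_bounded_meas[of F g]] by (simp add: mult.commute)

lemma D_DERIV: "x \<in> I \<Longrightarrow> (D has_real_derivative D' x) (at x)"
  unfolding D_def D'_def using l_DERIV m_DERIV by (auto intro!: derivative_eq_intros)

text \<open>Differentiating \<open>y = l x + s * D x\<close> in \<open>x\<close> at fixed
  \<open>y\<close> gives \<open>0 = Yf + D * ds/dx\<close>, whence the coefficient
  \<open>- Yf / D\<close>.\<close>

lemma sf_has_derivative:
  assumes z: "fst z \<in> I"
  shows "(sf has_derivative (\<lambda>h. (- Yf z / D (fst z)) * fst h + (1 / D (fst z)) * snd h)) (at z)"
proof -
  have D0: "D (fst z) \<noteq> 0" using D_pos[of "fst z"] z by auto
  note dl = has_derivative_fst_snd(1)[OF l_DERIV[OF z] DERIV_ident]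
  note dD = has_derivative_fst_snd(1)[OF D_DERIV[OF z] DERIV_ident]
  have ds: "(snd has_derivative snd) (at z)" by (rule has_derivative_snd[OF has_derivative_ident])
  from has_derivative_divide[OF has_derivative_diff[OF ds dl] dD D0]
  have "(sf has_derivative (\<lambda>h. - (snd z - l (fst z)) * (inverse (D (fst z)) * (D' (fst z) * fst h) * inverse (D (fst z))) + (snd h - l' (fst z) * fst h) / D (fst z))) (at z)"
    unfolding sf_def .
  moreover have "(\<lambda>h. - (snd z - l (fst z)) * (inverse (D (fst z)) * (D' (fst z) * fst h) * inverse (D (fst z))) + (snd h - l' (fst z) * fst h) / D (fst z))
    = (\<lambda>h. (- Yf z / D (fst z)) * fst h + (1 / D (fst z)) * snd h)"
    using D0 by (auto simp: Yf_def sf_def field_simps)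
  ultimately show ?thesis by simp
qed

lemma Yf_cont: "continuous_on (I \<times> UNIV) Yf"
  unfolding Yf_def
  by (intro continuous_intros sf_cont continuous_on_compose2[OF l'_cont] continuous_on_compose2[OF D'_cont]) auto

text \<open>Product functions in the straightened coordinates \<open>(x, s)\<close>. Their support
  is the image of \<open>K \<times> T\<close> under
  \<open>(x, s) \<mapsto> (x, l x + s * D x)\<close>, compact in \<open>R\<close>, and they are
  \<open>C\<^sup>1\<close> because \<open>l\<close> and \<open>m\<close> are.\<close>

lemma test2_fibred:
  assumes q: "\<And>x. x \<in> I \<Longrightarrow> (q has_real_derivative q' x) (at x)" and q': "continuous_on {a..b} q'"
    and K: "compact K" "K \<subseteq> I" "\<And>x. x \<notin> K \<Longrightarrow> q x = 0" and th: "test1 {0<..<1} \<theta>"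
  shows "test2 R (\<lambda>z. q (fst z) * \<theta> (sf z))"
    "\<And>z. z \<in> R \<Longrightarrow> pdx (\<lambda>z. q (fst z) * \<theta> (sf z)) z = q' (fst z) * \<theta> (sf z) - q (fst z) * (1 / D (fst z)) * Yf z * deriv \<theta> (sf z)"
    "\<And>z. z \<in> R \<Longrightarrow> pdy (\<lambda>z. q (fst z) * \<theta> (sf z)) z = q (fst z) * (1 / D (fst z)) * deriv \<theta> (sf z)"
proof -
  obtain T where T: "compact T" "T \<subseteq> {0<..<1}" "\<And>x. x \<notin> T \<Longrightarrow> \<theta> x = 0" using test1_support[OF th] by metis
  let ?e = "\<lambda>(x,s). (x, l x + s * D x)"
  let ?K = "?e ` (K \<times> T)"
  have cK: "compact ?K"
  proof (rule compact_continuous_image)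
    have "continuous_on (K \<times> T) (\<lambda>z. (fst z, l (fst z) + snd z * D (fst z)))"
      by (intro continuous_intros continuous_on_compose2[OF l_cont] continuous_on_compose2[OF D_cont]) (use K(2) in auto)
    then show "continuous_on (K \<times> T) ?e" by (simp add: split_beta)
  qed (use K T in \<open>auto intro: compact_Times\<close>)
  have KR: "?K \<subseteq> R"
  proof clarify
    fix x s assume xs: "x \<in> K" "s \<in> T"
    then have x: "x \<in> I" and s: "0 < s" "s < 1" using K(2) T(2) by auto
    have Dp: "0 < D x" using D_pos[of x] x by simp
    have "0 < s * D x" "s * D x < D x" using s Dp by auto
    then show "(x, l x + s * D x) \<in> R" using x by (auto simp: mem_R D_def)
  qed
  have KU: "?K \<subseteq> I \<times> UNIV" using K(2) by auto
  have zero: "q (fst z) * \<theta> (sf z) = 0" if "z \<notin> ?K" for z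
  proof (rule ccontr)
    assume n: "q (fst z) * \<theta> (sf z) \<noteq> 0"
    then have "fst z \<in> K" "sf z \<in> T" using K(3) T(3) by auto
    moreover have "D (fst z) \<noteq> 0" using D_pos[of "fst z"] K(2) \<open>fst z \<in> K\<close> by fastforce
    then have "z = ?e (fst z, sf z)" by (cases z) (simp add: sf_def)
    ultimately have "z \<in> ?K" by blast
    with that show False by simp
  qed
  define dx where "dx z = q' (fst z) * \<theta> (sf z) - q (fst z) * (1 / D (fst z)) * Yf z * deriv \<theta> (sf z)" for z
  define dy where "dy z = q (fst z) * (1 / D (fst z)) * deriv \<theta> (sf z)" for z
  have der: "((\<lambda>z. q (fst z) * \<theta> (sf z)) has_derivative (\<lambda>h. dx z * fst h + dy z * snd h)) (at z)" if "z \<in> I \<times> UNIV" for z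
  proof -
    have z: "fst z \<in> I" using that by auto
    have 1: "((\<lambda>z. q (fst z)) has_derivative (\<lambda>h. q' (fst z) * fst h)) (at z)"
      by (rule has_derivative_fst_snd(1)[OF q[OF z] DERIV_ident])
    have 2: "((\<lambda>z. \<theta> (sf z)) has_derivative (\<lambda>h. deriv \<theta> (sf z) * ((- Yf z / D (fst z)) * fst h + (1 / D (fst z)) * snd h))) (at z)"
      using has_derivative_compose[OF sf_has_derivative[OF z], of \<theta> "(*) (deriv \<theta> (sf z))"] test1_DERIV[OF th, of "sf z"]
      by (simp add: has_field_derivative_def)
    show ?thesis using has_derivative_mult[OF 1 2]
      by (rule has_derivative_eq_rhs) (auto simp: dx_def dy_def algebra_simps)
  qed
  have cq: "continuous_on I q" using q by (meson DERIV_isCont continuous_at_imp_continuous_on)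
  have c1: "continuous_on (I \<times> UNIV) (\<lambda>z. q (fst z))" "continuous_on (I \<times> UNIV) (\<lambda>z. q' (fst z))"
    "continuous_on (I \<times> UNIV) (\<lambda>z. 1 / D (fst z))" "continuous_on (I \<times> UNIV) (\<lambda>z. \<theta> (sf z))"
    "continuous_on (I \<times> UNIV) (\<lambda>z. deriv \<theta> (sf z))"
    by (rule continuous_on_compose2[OF cq] continuous_on_compose2[OF q'] continuous_on_compose2[OF invD_cont]
        continuous_on_compose2[OF test1_continuous[OF th, of UNIV] sf_cont]
        continuous_on_compose2[OF test1_deriv_continuous[OF th, of UNIV] sf_cont]; auto intro: continuous_intros)+
  have c: "continuous_on (I \<times> UNIV) dx" "continuous_on (I \<times> UNIV) dy"
    unfolding dx_def dy_def by (intro continuous_on_diff continuous_on_mult c1 Yf_cont)+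
  have oU: "open (I \<times> (UNIV::real set))" by (auto intro: open_Times)
  show "test2 R (\<lambda>z. q (fst z) * \<theta> (sf z))" by (rule test2I(1)[OF oU cK KR KU zero der c])
  fix z assume "z \<in> R"
  then have RU: "z \<in> I \<times> UNIV" using R_fst[of z] by (cases z) auto
  show "pdx (\<lambda>z. q (fst z) * \<theta> (sf z)) z = q' (fst z) * \<theta> (sf z) - q (fst z) * (1 / D (fst z)) * Yf z * deriv \<theta> (sf z)"
    using test2I(2)[OF oU cK KR KU zero der c RU] unfolding dx_def .
  show "pdy (\<lambda>z. q (fst z) * \<theta> (sf z)) z = q (fst z) * (1 / D (fst z)) * deriv \<theta> (sf z)"
    using test2I(3)[OF oU cK KR KU zero der c RU] unfolding dy_def .
qed

text \<open>Since \<open>l'\<close> and \<open>m'\<close> are merely continuous, the test functions needed in the \<open>y\<close>-direction are not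
  \<open>C\<^sup>1\<close> in \<open>x\<close>; the Weierstrass theorem removes the smoothness requirement on the factor \<open>c\<close>.\<close>

lemma weak_dy_continuous_factor:
  assumes z: "L2 R z" and gy: "L2 R gy" and g: "is_wgrad R z gx gy"
    and q: "\<And>x. x \<in> I \<Longrightarrow> (q has_real_derivative q' x) (at x)" and q': "continuous_on {a..b} q'"
    and qc: "continuous_on {a..b} q"
    and K: "compact K" "K \<subseteq> I" "\<And>x. x \<notin> K \<Longrightarrow> q x = 0" and th: "test1 {0<..<1} \<theta>"
    and c: "continuous_on {a..b} c"
  shows "integral\<^sup>L (lon R) (\<lambda>p. z p * (c (fst p) * (q (fst p) * (1 / D (fst p)) * deriv \<theta> (sf p))) + gy p * (c (fst p) * (q (fst p) * \<theta> (sf p)))) = 0"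
proof -
  define F where "F p = z p * (q (fst p) * (1 / D (fst p)) * deriv \<theta> (sf p)) + gy p * (q (fst p) * \<theta> (sf p))" for p
  have b1: "bounded_meas (\<lambda>p. q (fst p) * (1 / D (fst p)) * deriv \<theta> (sf p))" and b2: "bounded_meas (\<lambda>p. q (fst p) * \<theta> (sf p))"
    by (intro bounded_meas_mult bounded_meas_fst[OF invD_cont] bounded_meas_fst[OF qc] bounded_meas_sf[OF test1_continuous[OF th]]
        bounded_meas_sf[OF test1_deriv_continuous[OF th]])+
  have FL: "L2 R F"
    unfolding F_def using L2_add[OF R_borel L2_bounded_meas[OF z b1] L2_bounded_meas[OF gy b2]] by (simp add: mult.commute)
  have Fi: "integrable (lon R) F" by (rule L2_integrable[OF R_borel bounded_R FL])
  \<comment> \<open>For a polynomial \<open>r\<close> the product \<open>r * q\<close> is again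
    continuously differentiable, so the weak \<open>y\<close>-derivative applies directly to
    \<open>r * q\<close> times \<open>\<theta>\<close> of the fibre coordinate.\<close>
  have poly: "integral\<^sup>L (lon R) (\<lambda>p. r (fst p) * F p) = 0" if r: "real_polynomial_function r" for r
  proof -
    obtain r' where "real_polynomial_function r'" and dr: "\<And>x. (r has_real_derivative r' x) (at x)"
      using has_real_derivative_polynomial_function[OF r] by metis
    have rc: "continuous_on A r" "continuous_on A r'" for A
      using r \<open>real_polynomial_function r'\<close>
      by (simp_all add: real_polynomial_function_eq continuous_on_polymonial_function)
    let ?q = "\<lambda>x. r x * q x"
    have 1: "(?q has_real_derivative (r' x * q x + r x * q' x)) (at x)" if "x \<in> I" for x
      using DERIV_mult[OF dr q[OF that]] by (simp add: algebra_simps)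
    have 2: "continuous_on {a..b} (\<lambda>x. r' x * q x + r x * q' x)"
      by (intro continuous_intros rc qc q')
    have 3: "?q x = 0" if "x \<notin> K" for x using K(3)[OF that] by simp
    note t = test2_fibred[OF 1 2 K(1,2) 3 th]
    have e: "sint R (\<lambda>p. z p * pdy (\<lambda>p. ?q (fst p) * \<theta> (sf p)) p) = - sint R (\<lambda>p. gy p * (?q (fst p) * \<theta> (sf p)))"
      using g t(1) unfolding is_wgrad_def by blast
    have "integral\<^sup>L (lon R) (\<lambda>p. z p * (?q (fst p) * (1 / D (fst p)) * deriv \<theta> (sf p))) = sint R (\<lambda>p. z p * pdy (\<lambda>p. ?q (fst p) * \<theta> (sf p)) p)"
      unfolding sint_lon[OF R_borel]
      by (rule integral_lon_cong[OF R_borel], rule arg_cong[where f="(*) _"], rule test2_fibred(3)[OF 1 2 K(1,2) 3 th, symmetric])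
    then have e2: "integral\<^sup>L (lon R) (\<lambda>p. z p * (?q (fst p) * (1 / D (fst p)) * deriv \<theta> (sf p))) + integral\<^sup>L (lon R) (\<lambda>p. gy p * (?q (fst p) * \<theta> (sf p))) = 0"
      using e by (simp add: sint_lon)
    have qc': "continuous_on {a..b} ?q" by (intro continuous_intros rc qc)
    have i: "integrable (lon R) (\<lambda>p. z p * (?q (fst p) * (1 / D (fst p)) * deriv \<theta> (sf p)))"
      "integrable (lon R) (\<lambda>p. gy p * (?q (fst p) * \<theta> (sf p)))"
      by (intro integrable_bounded_meas z gy bounded_meas_mult bounded_meas_fst[OF invD_cont] bounded_meas_fst[OF qc'] bounded_meas_fst[OF qc] bounded_meas_fst[OF rc(1)]
          bounded_meas_sf[OF test1_continuous[OF th]] bounded_meas_sf[OF test1_deriv_continuous[OF th]])+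
    have "integral\<^sup>L (lon R) (\<lambda>p. r (fst p) * F p) = integral\<^sup>L (lon R) (\<lambda>p. z p * (?q (fst p) * (1 / D (fst p)) * deriv \<theta> (sf p)) + gy p * (?q (fst p) * \<theta> (sf p)))"
      by (rule integral_lon_cong) (auto simp: F_def algebra_simps)
    also have "\<dots> = 0" using e2 i by simp
    finally show ?thesis .
  qed
  define A where "A = integral\<^sup>L (lon R) (\<lambda>p. \<bar>F p\<bar>)"
  have A0: "0 \<le> A" unfolding A_def by simp
  have Fc: "integrable (lon R) (\<lambda>p. c (fst p) * F p)" if "continuous_on {a..b} c" for c
    using integrable_bounded_meas[OF FL bounded_meas_fst[OF that]] by (simp add: mult.commute)
  have "\<bar>integral\<^sup>L (lon R) (\<lambda>p. c (fst p) * F p)\<bar> \<le> 0 + e" if "0 < e" for e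
  proof -
    \<comment> \<open>A uniform error \<open>e'\<close> in the factor costs at most
      \<open>e' * A\<close> in the integral; the added \<open>1\<close> covers
      \<open>A = 0\<close>.\<close>
    define e' where "e' = e / (A + 1)"
    have e': "0 < e'" using that A0 by (simp add: e'_def)
    obtain r where r: "real_polynomial_function r" "\<And>x. x \<in> {a..b} \<Longrightarrow> \<bar>c x - r x\<bar> < e'"
      using Stone_Weierstrass_real_polynomial_function[OF compact_Icc c e'] by metis
    have rc: "continuous_on {a..b} r" using r(1)
      by (simp add: real_polynomial_function_eq continuous_on_polymonial_function)
    have "integral\<^sup>L (lon R) (\<lambda>p. c (fst p) * F p) = integral\<^sup>L (lon R) (\<lambda>p. c (fst p) * F p) - integral\<^sup>L (lon R) (\<lambda>p. r (fst p) * F p)"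
      using poly[OF r(1)] by simp
    also have "\<dots> = integral\<^sup>L (lon R) (\<lambda>p. (c (fst p) - r (fst p)) * F p)"
      using Fc[OF c] Fc[OF rc] by (simp add: left_diff_distrib)
    also have "\<bar>\<dots>\<bar> \<le> integral\<^sup>L (lon R) (\<lambda>p. \<bar>(c (fst p) - r (fst p)) * F p\<bar>)"
      using integral_norm_bound[of "lon R" "\<lambda>p. (c (fst p) - r (fst p)) * F p"] by simp
    also have "\<dots> \<le> integral\<^sup>L (lon R) (\<lambda>p. e' * \<bar>F p\<bar>)"
    proof (rule integral_mono)
      show "integrable (lon R) (\<lambda>p. \<bar>(c (fst p) - r (fst p)) * F p\<bar>)"
        by (rule integrable_abs[OF Fc[OF continuous_on_diff[OF c rc]]])
      show "\<bar>(c (fst p) - r (fst p)) * F p\<bar> \<le> e' * \<bar>F p\<bar>" if "p \<in> space (lon R)" for p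
      proof -
        have "\<bar>c (fst p) - r (fst p)\<bar> \<le> e'"
          using r(2)[of "fst p"] R_fst[of p] that by (simp add: space_restrict_space)
        then show ?thesis unfolding abs_mult by (rule mult_right_mono) simp
      qed
    qed (use Fi in auto)
    also have "\<dots> = e' * A" by (simp add: A_def)
    also have "\<dots> \<le> e" using that A0 by (simp add: e'_def field_simps)
    finally show ?thesis by simp
  qed
  then have "integral\<^sup>L (lon R) (\<lambda>p. c (fst p) * F p) = 0"
    using field_le_epsilon[of "\<bar>integral\<^sup>L (lon R) (\<lambda>p. c (fst p) * F p)\<bar>" 0] by fastforce
  moreover have "integral\<^sup>L (lon R) (\<lambda>p. c (fst p) * F p) = integral\<^sup>L (lon R) (\<lambda>p. z p * (c (fst p) * (q (fst p) * (1 / D (fst p)) * deriv \<theta> (sf p))) + gy p * (c (fst p) * (q (fst p) * \<theta> (sf p))))"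
    by (rule integral_lon_cong) (auto simp: F_def algebra_simps)
  ultimately show ?thesis by simp
qed

text \<open>In the coordinates \<open>(x, s)\<close> the average is an integral over
  \<open>0 < s < 1\<close>, so its derivative is the average of the derivative at fixed
  \<open>s\<close>, namely \<open>gx + Yf * gy\<close>. Since \<open>z\<close> is only weakly
  differentiable, this is verified against test functions \<open>q x * \<eta> s\<close>, and the
  cut-off \<open>\<eta>\<close> is removed at the end.\<close>

lemma is_wderiv_favg:
  assumes z: "L2 R z" and gx: "L2 R gx" and gy: "L2 R gy" and g: "is_wgrad R z gx gy"
  shows "is_wderiv I (favg z) (favg (\<lambda>p. gx p + Yf p * gy p))"
  unfolding is_wderiv_def
proof (intro allI impI)
  fix \<phi> assume phi: "test1 I \<phi>"
  obtain K where K: "compact K" "K \<subseteq> I" "\<And>x. x \<notin> K \<Longrightarrow> \<phi> x = 0" using test1_support[OF phi] by metis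
  \<comment> \<open>Dividing by \<open>D\<close> compensates the Jacobian between \<open>y\<close>
    and \<open>s\<close>.\<close>
  define q where "q x = \<phi> x * (1 / D x)" for x
  define q' where "q' x = deriv \<phi> x * (1 / D x) - q x * (1 / D x) * D' x" for x
  have qd: "(q has_real_derivative q' x) (at x)" if "x \<in> I" for x
  proof -
    have D0: "D x \<noteq> 0" using D_pos[of x] that by auto
    have "((\<lambda>x. \<phi> x / D x) has_real_derivative (deriv \<phi> x * D x - \<phi> x * D' x) / (D x * D x)) (at x)"
      by (rule DERIV_divide[OF test1_DERIV[OF phi] D_DERIV[OF that] D0])
    moreover have "(deriv \<phi> x * D x - \<phi> x * D' x) / (D x * D x) = q' x"
      using D0 by (simp add: q'_def q_def field_simps)
    ultimately show ?thesis by (simp add: q_def[abs_def])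
  qed
  have qc: "continuous_on {a..b} q" unfolding q_def by (intro continuous_on_mult invD_cont test1_continuous[OF phi])
  have q'c: "continuous_on {a..b} q'" unfolding q'_def
    by (intro continuous_on_mult continuous_on_diff invD_cont qc D'_cont test1_deriv_continuous[OF phi])
  have q0: "q x = 0" if "x \<notin> K" for x using K(3)[OF that] by (simp add: q_def)
  define G where "G p = gx p + Yf p * gy p" for p
  have GL: "L2 R G" unfolding G_def by (intro L2_add gx L2_bounded_meas gy bounded_meas_Yf R_borel)
  have \<phi>'c: "continuous_on {a..b} (\<lambda>x. deriv \<phi> x * (1 / D x))"
    by (intro continuous_on_mult invD_cont test1_deriv_continuous[OF phi])
  have cut: "integral\<^sup>L (lon R) (\<lambda>p. (z p * (deriv \<phi> (fst p) * (1 / D (fst p))) + G p * q (fst p)) * \<eta> (sf p)) = 0"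
    if eta: "test1 {0<..<1} \<eta>" for \<eta>
  proof -
    \<comment> \<open>\<open>Yf = l' + s * D'\<close>: the factor \<open>s\<close> is absorbed into
      the cut-off, which leaves the continuous factors \<open>l'\<close> and \<open>D'\<close> of
      \<open>x\<close> alone.\<close>
    define \<theta> where "\<theta> t = t * \<eta> t" for t
    obtain T where T: "compact T" "T \<subseteq> {0<..<1}" "\<And>x. x \<notin> T \<Longrightarrow> \<eta> x = 0" using test1_support[OF eta] by metis
    have d: "(\<theta> has_real_derivative (\<eta> t + t * deriv \<eta> t)) (at t)" for t
      unfolding \<theta>_def using DERIV_mult[OF DERIV_ident test1_DERIV[OF eta]] by (simp add: algebra_simps)
    have cd: "continuous_on UNIV (\<lambda>t. \<eta> t + t * deriv \<eta> t)"
      by (intro continuous_intros test1_continuous[OF eta] test1_deriv_continuous[OF eta])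
    have th0: "\<theta> t = 0" if "t \<notin> T" for t using T(3)[OF that] by (simp add: \<theta>_def)
    note th = test1I[OF d cd T(1,2) th0]
    note t = test2_fibred[OF qd q'c K(1,2) q0 eta]
    have e1: "sint R (\<lambda>p. z p * pdx (\<lambda>p. q (fst p) * \<eta> (sf p)) p) = - sint R (\<lambda>p. gx p * (q (fst p) * \<eta> (sf p)))"
      using g t(1) unfolding is_wgrad_def by blast
    let ?X1 = "\<lambda>p. z p * (q' (fst p) * \<eta> (sf p) - q (fst p) * (1 / D (fst p)) * Yf p * deriv \<eta> (sf p))"
    let ?X2 = "\<lambda>p. gx p * (q (fst p) * \<eta> (sf p))"
    let ?Y1 = "\<lambda>p. z p * (l' (fst p) * (q (fst p) * (1 / D (fst p)) * deriv \<eta> (sf p))) + gy p * (l' (fst p) * (q (fst p) * \<eta> (sf p)))"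
    let ?Y2 = "\<lambda>p. z p * (D' (fst p) * (q (fst p) * (1 / D (fst p)) * deriv \<theta> (sf p))) + gy p * (D' (fst p) * (q (fst p) * \<theta> (sf p)))"
    note meas = bounded_meas_fst[OF invD_cont] bounded_meas_fst[OF qc] bounded_meas_fst[OF q'c] bounded_meas_fst[OF l'_cont] bounded_meas_fst[OF D'_cont] bounded_meas_Yf
        bounded_meas_sf[OF test1_continuous[OF eta]] bounded_meas_sf[OF test1_deriv_continuous[OF eta]]
        bounded_meas_sf[OF test1_continuous[OF th(1)]] bounded_meas_sf[OF test1_deriv_continuous[OF th(1)]]
    have i: "integrable (lon R) ?X1" "integrable (lon R) ?X2" "integrable (lon R) ?Y1" "integrable (lon R) ?Y2"
      by (intro Bochner_Integration.integrable_add integrable_bounded_meas z gx gy bounded_meas_diff bounded_meas_mult meas)+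
    have "integral\<^sup>L (lon R) ?X1 = sint R (\<lambda>p. z p * pdx (\<lambda>p. q (fst p) * \<eta> (sf p)) p)"
      unfolding sint_lon[OF R_borel]
      by (rule integral_lon_cong[OF R_borel], rule arg_cong[where f="(*) _"], rule test2_fibred(2)[OF qd q'c K(1,2) q0 eta, symmetric])
    then have X: "integral\<^sup>L (lon R) ?X1 + integral\<^sup>L (lon R) ?X2 = 0" using e1 by (simp add: sint_lon)
    have Y1: "integral\<^sup>L (lon R) ?Y1 = 0"
      by (rule weak_dy_continuous_factor[OF z gy g qd q'c qc K(1,2) q0 eta l'_cont])
    have Y2: "integral\<^sup>L (lon R) ?Y2 = 0"
      by (rule weak_dy_continuous_factor[OF z gy g qd q'c qc K(1,2) q0 th(1) D'_cont])
    \<comment> \<open>The terms with \<open>deriv \<eta>\<close> cancel because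
      \<open>Yf = l' + s * D'\<close>. The remaining \<open>\<eta>\<close> from the derivative of
      \<open>\<theta>\<close> cancels the \<open>D'\<close> term of \<open>q'\<close>, leaving
      \<open>deriv \<phi> / D\<close>.\<close>
    have "integral\<^sup>L (lon R) (\<lambda>p. (z p * (deriv \<phi> (fst p) * (1 / D (fst p))) + G p * q (fst p)) * \<eta> (sf p))
      = integral\<^sup>L (lon R) (\<lambda>p. ?X1 p + ?X2 p + (?Y1 p + ?Y2 p))"
      by (rule integral_lon_cong)
        (simp_all add: th(2) \<theta>_def G_def Yf_def q'_def algebra_simps)
    also have "\<dots> = (integral\<^sup>L (lon R) ?X1 + integral\<^sup>L (lon R) ?X2) + (integral\<^sup>L (lon R) ?Y1 + integral\<^sup>L (lon R) ?Y2)"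
      by (simp only: Bochner_Integration.integral_add Bochner_Integration.integrable_add i)
    also have "\<dots> = 0" using X Y1 Y2 by simp
    finally show ?thesis .
  qed
  let ?F = "\<lambda>p. z p * (deriv \<phi> (fst p) * (1 / D (fst p))) + G p * q (fst p)"
  have iz: "integrable (lon R) (\<lambda>p. z p * (deriv \<phi> (fst p) * (1 / D (fst p))))"
    using integrable_bounded_meas[OF z bounded_meas_fst[OF \<phi>'c]] by simp
  have iG: "integrable (lon R) (\<lambda>p. G p * q (fst p))" by (rule integrable_bounded_meas[OF GL bounded_meas_fst[OF qc]])
  have Fi: "integrable (lon R) ?F" using iz iG by (rule Bochner_Integration.integrable_add)
  \<comment> \<open>The fibre coordinate lies strictly between \<open>0\<close> and \<open>1\<close>
    on \<open>R\<close>, so the cut-offs tend to \<open>1\<close> everywhere there, dominated by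
    \<open>\<bar>?F\<bar>\<close>.\<close>
  have "(\<lambda>n. integral\<^sup>L (lon R) (\<lambda>p. ?F p * bump 0 1 n (sf p))) \<longlonglongrightarrow> integral\<^sup>L (lon R) ?F"
  proof (rule integral_dominated_convergence)
    show "integrable (lon R) (\<lambda>p. \<bar>?F p\<bar>)" using Fi by (rule integrable_abs)
    show "?F \<in> borel_measurable (lon R)" using Fi by auto
    show "(\<lambda>p. ?F p * bump 0 1 n (sf p)) \<in> borel_measurable (lon R)" for n
      using Fi bounded_meas_sf[OF test1_continuous[OF bump_test1, of UNIV 0 1 n]] unfolding bounded_meas_def
      by (intro borel_measurable_times) auto
    show "AE p in lon R. norm (?F p * bump 0 1 n (sf p)) \<le> \<bar>?F p\<bar>" for n
      using bump_bounds[of 0 1 n] by (intro AE_I2) (simp add: abs_mult mult_left_le)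
    show "AE p in lon R. (\<lambda>n. ?F p * bump 0 1 n (sf p)) \<longlonglongrightarrow> ?F p"
    proof (rule AE_I2)
      fix p assume "p \<in> space (lon R)"
      then have "sf p \<in> {0<..<1}" using sf_range[of p] by (simp add: space_restrict_space)
      then have "(\<lambda>n. bump 0 1 n (sf p)) \<longlonglongrightarrow> 1" using bump_tendsto[of 0 1 "sf p"] by simp
      from tendsto_mult_left[OF this, of "?F p"] show "(\<lambda>n. ?F p * bump 0 1 n (sf p)) \<longlonglongrightarrow> ?F p" by simp
    qed
  qed
  then have F0: "integral\<^sup>L (lon R) ?F = 0" unfolding cut[OF bump_test1] by (simp add: LIMSEQ_const_iff)
  have "integral\<^sup>L (lon R) (\<lambda>p. z p * (deriv \<phi> (fst p) * (1 / D (fst p)))) = sint I (\<lambda>x. favg z x * deriv \<phi> x)"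
    unfolding fubini_R(3)[OF iz] sint_lon[OF Ioo_borel]
    by (rule integral_lon_cong) (auto simp: fint_def favg_def)
  moreover have "integral\<^sup>L (lon R) (\<lambda>p. G p * q (fst p)) = sint I (\<lambda>x. favg G x * \<phi> x)"
    unfolding fubini_R(3)[OF iG] sint_lon[OF Ioo_borel]
    by (rule integral_lon_cong) (auto simp: fint_def favg_def q_def)
  ultimately show "sint I (\<lambda>x. favg z x * deriv \<phi> x) = - sint I (\<lambda>x. favg (\<lambda>p. gx p + Yf p * gy p) x * \<phi> x)"
    using F0 iz iG unfolding G_def[symmetric] by simp
qed

end

subsection \<open>Comparison with the reduced problem\<close>

lemma le_of_square_le_mult:
  assumes "0 \<le> S" "0 \<le> A" "S \<le> A * sqrt S" shows "sqrt S \<le> A"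
proof (cases "S = 0")
  case True then show ?thesis using assms by simp
next
  case False
  then have "0 < sqrt S" using assms by simp
  moreover have "sqrt S * sqrt S \<le> A * sqrt S" using assms by simp
  ultimately show ?thesis by (simp only: mult_le_cancel_right)
qed

lemma sint_Int: "sint (A \<inter> B) F = sint B (\<lambda>z. indicator A z * F z)"
  unfolding set_lebesgue_integral_def
  by (rule Bochner_Integration.integral_cong) (auto split: split_indicator)

context thin_domain begin

text \<open>\<open>Yf\<close> is the convex combination of \<open>l'\<close> and \<open>m'\<close>
  with weights \<open>1 - s\<close> and \<open>s\<close>.\<close>

lemma Yf_bound:
  assumes del: "\<bar>l' (fst p)\<bar> \<le> \<delta>" "\<bar>m' (fst p)\<bar> \<le> \<delta>" and p: "p \<in> R"
  shows "\<bar>Yf p\<bar> \<le> \<delta>"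
proof -
  let ?s = "sf p"
  have s: "0 \<le> ?s" "0 \<le> 1 - ?s" using sf_range[OF p] by auto
  have "Yf p = (1 - ?s) * l' (fst p) + ?s * m' (fst p)" by (simp add: Yf_def D'_def algebra_simps)
  also have "\<bar>\<dots>\<bar> \<le> (1 - ?s) * \<bar>l' (fst p)\<bar> + ?s * \<bar>m' (fst p)\<bar>"
    using abs_triangle_ineq[of "(1 - ?s) * l' (fst p)" "?s * m' (fst p)"] s by (simp add: abs_mult)
  also have "\<dots> \<le> (1 - ?s) * \<delta> + ?s * \<delta>" by (intro add_mono mult_left_mono del s)
  also have "\<dots> = \<delta>" by (simp add: algebra_simps)
  finally show ?thesis .
qed

text \<open>For a function of \<open>x\<close> alone, Fubini leaves only the length of the strip on
  each fibre. This is where the thinness of the strip enters all estimates.\<close>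

lemma sint_strip_fst_le:
  assumes th: "\<theta> \<in> sets borel" and tau: "\<And>x. x \<in> I \<Longrightarrow> fint (indicator \<theta>) x \<le> \<tau>"
    and g: "L2 I g"
  shows "L2 (\<theta> \<inter> R) (\<lambda>p. g (fst p))" "sint (\<theta> \<inter> R) (\<lambda>p. (g (fst p))^2) \<le> \<tau> * sint I (\<lambda>x. (g x)^2)"
proof -
  note gR = L2_fst(1)[OF g]
  show "L2 (\<theta> \<inter> R) (\<lambda>p. g (fst p))" by (rule L2_subset[OF R_borel _ _ gR]) (use th in auto)
  have i: "integrable (lon R) (\<lambda>p. (g (fst p))^2 * indicator \<theta> p)"
  proof (rule Bochner_Integration.integrable_bound)
    show "integrable (lon R) (\<lambda>p. (g (fst p))^2)" using gR by (simp add: L2_iff)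
    then show "(\<lambda>p. (g (fst p))^2 * indicator \<theta> p) \<in> borel_measurable (lon R)"
      using th by (intro borel_measurable_times) (auto intro!: measurable_restrict_space1[of "indicator \<theta>"])
  qed (auto split: split_indicator)
  have gi: "integrable (lon I) (\<lambda>x. (g x)^2)" using g by (simp add: L2_iff)
  have "sint (\<theta> \<inter> R) (\<lambda>p. (g (fst p))^2) = integral\<^sup>L (lon R) (\<lambda>p. (g (fst p))^2 * indicator \<theta> p)"
    unfolding sint_Int sint_lon[OF R_borel] by (simp add: mult.commute)
  also have "\<dots> = integral\<^sup>L (lon I) (\<lambda>x. (g x)^2 * fint (indicator \<theta>) x)"
    unfolding fubini_R(3)[OF i] by (rule integral_lon_cong) (auto simp: fint_def)
  also have "\<dots> \<le> integral\<^sup>L (lon I) (\<lambda>x. (g x)^2 * \<tau>)"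
  proof (rule integral_mono)
    have "integrable (lon I) (fint (\<lambda>p. (g (fst p))^2 * indicator \<theta> p))" by (rule fubini_R(2)[OF i])
    then show "integrable (lon I) (\<lambda>x. (g x)^2 * fint (indicator \<theta>) x)"
      by (rule Bochner_Integration.integrable_cong[THEN iffD1, rotated -1]) (auto simp: fint_def)
    show "(g x)^2 * fint (indicator \<theta>) x \<le> (g x)^2 * \<tau>" if "x \<in> space (lon I)" for x
      using tau[of x] that by (intro mult_left_mono) (auto simp: space_restrict_space)
  qed (use gi in auto)
  also have "\<dots> = \<tau> * sint I (\<lambda>x. (g x)^2)" by (simp add: sint_lon)
  finally show "sint (\<theta> \<inter> R) (\<lambda>p. (g (fst p))^2) \<le> \<tau> * sint I (\<lambda>x. (g x)^2)" .
qed

text \<open>The error \<open>z = w - wh\<close> is orthogonal in \<open>H\<^sup>1(R)\<close> to all functions of \<open>x\<close> alone. Testing with the fibre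
  average of \<open>z\<close> shows that this average is small, and testing with \<open>z\<close> reduces the energy of \<open>z\<close> to the
  average and the oscillation of \<open>z\<close> along the fibres.\<close>

lemma comparison:
  assumes th: "\<theta> \<in> sets borel" and tau: "\<And>x. x \<in> I \<Longrightarrow> fint (indicator \<theta>) x \<le> \<tau>" and tau0: "0 \<le> \<tau>"
    and f: "L2 R f" and del: "\<And>x. x \<in> I \<Longrightarrow> \<bar>l' x\<bar> \<le> \<delta> \<and> \<bar>m' x\<bar> \<le> \<delta>"
    and d: "\<And>x. x \<in> I \<Longrightarrow> d1 \<le> D x \<and> D x \<le> d2" and d1: "0 < d1" and s0: "0 \<le> s"
    and w: "H1_2 R w"
    and weq: "\<And>\<phi>. H1_2 R \<phi> \<Longrightarrow> sint R (\<lambda>z. fst (wgrad R w) z * fst (wgrad R \<phi>) z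
      + snd (wgrad R w) z * snd (wgrad R \<phi>) z + w z * \<phi> z) = s * sint (\<theta> \<inter> R) (\<lambda>z. f z * \<phi> z)"
    and wh: "H1_1 I wh"
    and wheq: "\<And>\<phi>. H1_1 I \<phi> \<Longrightarrow> sint I (\<lambda>x. D x * wderiv I wh x * wderiv I \<phi> x + D x * wh x * \<phi> x)
      = s * sint I (\<lambda>x. fint (\<lambda>z. indicator \<theta> z * f z) x * \<phi> x)"
  shows "L2norm R (\<lambda>z. w z - wh (fst z)) \<le> s * L2norm (\<theta> \<inter> R) f * sqrt \<tau> * (\<delta> / sqrt d1 + 2 * sqrt d2)"
proof -
  obtain wx wy where wg: "wx = fst (wgrad R w)" "wy = snd (wgrad R w)" by blast
  define v where "v = wderiv I wh"
  note W = H1_2_wgrad[OF w, folded wg] and V = H1_1_wderiv[OF wh, folded v_def]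
  define z where "z p = w p - wh (fst p)" for p
  define gx where "gx p = wx p - v (fst p)" for p
  define gy where "gy p = wy p - 0" for p
  have whR: "L2 R (\<lambda>p. wh (fst p))" "L2 R (\<lambda>p. v (fst p))" using L2_fst(1) V by auto
  have L0: "L2 R (\<lambda>p. 0)" by (rule L2_bounded[OF R_borel bounded_R, where C=0]) auto
  have zL: "L2 R z" and gxL: "L2 R gx" and gyL: "L2 R gy"
    unfolding z_def gx_def gy_def by (intro L2_diff W whR R_borel L0)+
  have zg: "is_wgrad R z gx gy" unfolding z_def gx_def gy_def
    by (intro is_wgrad_diff is_wgrad_fst R_borel bounded_R W whR V L0)
  \<comment> \<open>The equation for \<open>w\<close>, freed from the chosen gradient of the test
    function and with the strip written as an indicator.\<close>
  have B1: "integral\<^sup>L (lon R) (\<lambda>p. wx p * px p + wy p * py p + w p * \<phi> p) = s * integral\<^sup>L (lon R) (\<lambda>p. indicator \<theta> p * (f p * \<phi> p))"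
    if L: "L2 R \<phi>" "L2 R px" "L2 R py" and g: "is_wgrad R \<phi> px py" for \<phi> px py
  proof -
    have h: "H1_2 R \<phi>" unfolding H1_2_def using that by blast
    note G = H1_2_wgrad[OF h]
    have m: "\<phi> \<in> borel_measurable (lon R)" "px \<in> borel_measurable (lon R)" "py \<in> borel_measurable (lon R)"
      "fst (wgrad R \<phi>) \<in> borel_measurable (lon R)" "snd (wgrad R \<phi>) \<in> borel_measurable (lon R)"
      "w \<in> borel_measurable (lon R)" "wx \<in> borel_measurable (lon R)" "wy \<in> borel_measurable (lon R)"
      using L G W by (auto simp: L2_iff)
    have "integral\<^sup>L (lon R) (\<lambda>p. wx p * px p + wy p * py p + w p * \<phi> p) =
      integral\<^sup>L (lon R) (\<lambda>p. wx p * fst (wgrad R \<phi>) p + wy p * snd (wgrad R \<phi>) p + w p * \<phi> p)"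
    proof (rule integral_cong_AE)
      show "AE p in lon R. wx p * px p + wy p * py p + w p * \<phi> p = wx p * fst (wgrad R \<phi>) p + wy p * snd (wgrad R \<phi>) p + w p * \<phi> p"
        using is_wgrad_unique[OF L(2) G(2) L(3) G(3) g G(4)] by eventually_elim simp
    qed (use m in \<open>auto intro!: borel_measurable_add borel_measurable_times\<close>)
    also have "\<dots> = s * sint (\<theta> \<inter> R) (\<lambda>z. f z * \<phi> z)" using weq[OF h] by (simp add: wg sint_lon)
    finally show ?thesis unfolding sint_Int by (simp add: sint_lon)
  qed
  have thf: "L2 R (\<lambda>p. indicator \<theta> p * f p)"
    by (rule L2_bounded_mult[OF R_borel f, where C=1]) (use th in \<open>auto split: split_indicator intro!: measurable_restrict_space1\<close>)
  \<comment> \<open>Tested with functions of \<open>x\<close>, the equation for \<open>w\<close>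
    has, by Fubini, the same load as the reduced equation, whose weight \<open>D\<close> is exactly
    the fibre length; subtracting gives orthogonality.\<close>
  have Gal: "integral\<^sup>L (lon R) (\<lambda>p. gx p * \<psi> (fst p) + z p * \<phi> (fst p)) = 0"
    if L: "L2 I \<phi>" "L2 I \<psi>" and g: "is_wderiv I \<phi> \<psi>" for \<phi> \<psi>
  proof -
    note LR = L2_fst(1)[OF L(1)] L2_fst(1)[OF L(2)]
    note i = L2_mult_integrable[OF R_borel W(2) LR(2)] L2_mult_integrable[OF R_borel W(1) LR(1)]
      L2_mult_integrable[OF R_borel whR(2) LR(2)] L2_mult_integrable[OF R_borel whR(1) LR(1)]
    have h: "H1_1 I \<phi>" unfolding H1_1_def using that by blast
    note G = H1_1_wderiv[OF h]
    have 1: "integral\<^sup>L (lon R) (\<lambda>p. wx p * \<psi> (fst p) + w p * \<phi> (fst p)) = s * integral\<^sup>L (lon R) (\<lambda>p. indicator \<theta> p * (f p * \<phi> (fst p)))"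
      using B1[OF LR L0 is_wgrad_fst[OF L g]] by simp
    have i2: "integrable (lon R) (\<lambda>p. (indicator \<theta> p * f p) * \<phi> (fst p))"
      by (rule L2_mult_integrable[OF R_borel thf LR(1)])
    have 2: "integral\<^sup>L (lon R) (\<lambda>p. indicator \<theta> p * (f p * \<phi> (fst p))) = integral\<^sup>L (lon I) (\<lambda>x. fint (\<lambda>z. indicator \<theta> z * f z) x * \<phi> x)"
    proof -
      have "integral\<^sup>L (lon R) (\<lambda>p. indicator \<theta> p * (f p * \<phi> (fst p))) = integral\<^sup>L (lon I) (fint (\<lambda>p. (indicator \<theta> p * f p) * \<phi> (fst p)))"
        using fubini_R(3)[OF i2] by (simp add: mult.assoc)
      also have "\<dots> = integral\<^sup>L (lon I) (\<lambda>x. fint (\<lambda>z. indicator \<theta> z * f z) x * \<phi> x)"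
        by (rule integral_lon_cong) (auto simp: fint_def)
      finally show ?thesis .
    qed
    have iI: "integrable (lon I) (\<lambda>x. v x * \<psi> x + wh x * \<phi> x)"
      by (intro Bochner_Integration.integrable_add L2_mult_integrable V L) auto
    have "integral\<^sup>L (lon R) (\<lambda>p. v (fst p) * \<psi> (fst p) + wh (fst p) * \<phi> (fst p)) = integral\<^sup>L (lon I) (\<lambda>x. D x * (v x * \<psi> x + wh x * \<phi> x))"
      using integrable_fst(2)[OF iI] .
    also have "\<dots> = integral\<^sup>L (lon I) (\<lambda>x. D x * v x * wderiv I \<phi> x + D x * wh x * \<phi> x)"
    proof (rule integral_cong_AE)
      show "AE x in lon I. D x * (v x * \<psi> x + wh x * \<phi> x) = D x * v x * wderiv I \<phi> x + D x * wh x * \<phi> x"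
        using is_wderiv_unique[OF L(2) G(2) _ _ g G(3)] L(1) by (auto simp: L2_iff algebra_simps)
      have "v \<in> borel_measurable (lon I)" "\<psi> \<in> borel_measurable (lon I)" "wh \<in> borel_measurable (lon I)"
        "\<phi> \<in> borel_measurable (lon I)" "wderiv I \<phi> \<in> borel_measurable (lon I)"
        using V L G by (auto simp: L2_iff)
      then show "(\<lambda>x. D x * (v x * \<psi> x + wh x * \<phi> x)) \<in> borel_measurable (lon I)"
        "(\<lambda>x. D x * v x * wderiv I \<phi> x + D x * wh x * \<phi> x) \<in> borel_measurable (lon I)"
        using D_measurable by auto
    qed
    also have "\<dots> = s * integral\<^sup>L (lon I) (\<lambda>x. fint (\<lambda>z. indicator \<theta> z * f z) x * \<phi> x)"
      using wheq[OF h] by (simp add: v_def sint_lon)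
    finally have 3: "integral\<^sup>L (lon R) (\<lambda>p. v (fst p) * \<psi> (fst p) + wh (fst p) * \<phi> (fst p)) = integral\<^sup>L (lon R) (\<lambda>p. wx p * \<psi> (fst p) + w p * \<phi> (fst p))"
      unfolding 1 2 .
    have "integral\<^sup>L (lon R) (\<lambda>p. gx p * \<psi> (fst p) + z p * \<phi> (fst p)) =
       integral\<^sup>L (lon R) (\<lambda>p. (wx p * \<psi> (fst p) + w p * \<phi> (fst p)) - (v (fst p) * \<psi> (fst p) + wh (fst p) * \<phi> (fst p)))"
      by (simp add: gx_def z_def algebra_simps)
    also have "\<dots> = 0"
      using i 3 by (subst Bochner_Integration.integral_diff) (auto intro!: Bochner_Integration.integrable_add)
    finally show ?thesis .
  qed
  define E2 where "E2 = integral\<^sup>L (lon R) (\<lambda>p. (gx p)^2 + (gy p)^2 + (z p)^2)"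
  have sq: "integrable (lon R) (\<lambda>p. (gx p)^2)" "integrable (lon R) (\<lambda>p. (gy p)^2)" "integrable (lon R) (\<lambda>p. (z p)^2)"
    using zL gxL gyL by (auto simp: L2_iff)
  have E2gy: "integral\<^sup>L (lon R) (\<lambda>p. (gy p)^2) \<le> E2" and E2z: "integral\<^sup>L (lon R) (\<lambda>p. (z p)^2) \<le> E2"
    unfolding E2_def using sq by (auto intro!: integral_mono)
  have E20: "0 \<le> E2" unfolding E2_def by (rule integral_nonneg_AE) auto
  \<comment> \<open>Write one factor of each square as \<open>w\<close> minus \<open>wh\<close>; the
    contribution of \<open>wh\<close> vanishes by \<open>Gal\<close>, and that of \<open>w\<close>
    is the load.\<close>
  have energy: "E2 = s * integral\<^sup>L (lon R) (\<lambda>p. indicator \<theta> p * (f p * z p))"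
  proof -
    note i = L2_mult_integrable[OF R_borel]
    have i1: "integrable (lon R) (\<lambda>p. wx p * gx p + wy p * gy p + w p * z p)"
      by (intro Bochner_Integration.integrable_add i W gxL gyL zL)
    have i2: "integrable (lon R) (\<lambda>p. gx p * v (fst p) + z p * wh (fst p))"
      by (intro Bochner_Integration.integrable_add i gxL zL whR)
    have "E2 = integral\<^sup>L (lon R) (\<lambda>p. (wx p * gx p + wy p * gy p + w p * z p) - (gx p * v (fst p) + z p * wh (fst p)))"
      unfolding E2_def by (rule integral_lon_cong) (auto simp: gx_def gy_def z_def algebra_simps power2_eq_square)
    also have "\<dots> = integral\<^sup>L (lon R) (\<lambda>p. wx p * gx p + wy p * gy p + w p * z p) - integral\<^sup>L (lon R) (\<lambda>p. gx p * v (fst p) + z p * wh (fst p))"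
      by (rule Bochner_Integration.integral_diff[OF i1 i2])
    also have "\<dots> = s * integral\<^sup>L (lon R) (\<lambda>p. indicator \<theta> p * (f p * z p))"
      using B1[OF zL gxL gyL zg] Gal[OF V] by simp
    finally show ?thesis .
  qed
  define zb where "zb = favg z"
  define G where "G p = gx p + Yf p * gy p" for p
  define zb' where "zb' = favg G"
  have YL: "L2 R (\<lambda>p. Yf p * gy p)" by (rule L2_bounded_meas[OF gyL bounded_meas_Yf])
  have GL: "L2 R G" unfolding G_def by (intro L2_add gxL YL R_borel)
  have zbL: "L2 I zb" "L2 I zb'" unfolding zb_def zb'_def by (intro L2_favg zL GL)+
  have zbd: "is_wderiv I zb zb'" unfolding zb_def zb'_def G_def by (rule is_wderiv_favg[OF zL gxL gyL zg])
  \<comment> \<open>The defect between the derivative of the average and the average of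
    \<open>gx\<close>; it carries the factor \<open>Yf\<close> and hence
    \<open>\<delta>\<close>.\<close>
  define e where "e = favg (\<lambda>p. Yf p * gy p)"
  have eL: "L2 I e" unfolding e_def by (rule L2_favg[OF YL])
  have iD: "integrable (lon I) (\<lambda>x. D x * (g x)^2)" if "L2 I g" for g
  proof -
    obtain B where B: "\<And>x. x \<in> {a..b} \<Longrightarrow> D x \<le> B" "0 < B" using D_bounded by metis
    have "L2 I (\<lambda>x. D x * g x)"
      by (rule L2_bounded_mult[OF _ that D_measurable, where C=B]) (use B D_pos in \<open>auto simp: abs_of_pos\<close>)
    from L2_mult_integrable[OF _ this that] show ?thesis by (simp add: power2_eq_square mult.assoc)
  qed
  have De: "integral\<^sup>L (lon I) (\<lambda>x. D x * (e x)^2) \<le> \<delta>^2 * E2"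
  proof -
    have YI: "integrable (lon R) (\<lambda>p. (Yf p * gy p)^2)" using YL by (simp add: L2_iff)
    have "integral\<^sup>L (lon I) (\<lambda>x. D x * (e x)^2) \<le> integral\<^sup>L (lon I) (fint (\<lambda>p. (Yf p * gy p)^2))"
      using favg_square_le[OF YL] iD[OF eL] fubini_R(2)[OF YI] unfolding e_def by (intro integral_mono_AE) auto
    also have "\<dots> = integral\<^sup>L (lon R) (\<lambda>p. (Yf p * gy p)^2)" using fubini_R(3)[OF YI] by simp
    also have "\<dots> \<le> integral\<^sup>L (lon R) (\<lambda>p. \<delta>^2 * (gy p)^2)"
    proof (rule integral_mono[OF YI])
      show "integrable (lon R) (\<lambda>p. \<delta>^2 * (gy p)^2)" using sq by simp
      fix p assume "p \<in> space (lon R)"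
      then have p: "p \<in> R" by (simp add: space_restrict_space)
      have "\<bar>Yf p\<bar> \<le> \<delta>" using Yf_bound[OF _ _ p] del[OF R_fst[OF p]] by blast
      then have "(Yf p)^2 \<le> \<delta>^2" by (metis abs_ge_zero power2_abs power_mono)
      then show "(Yf p * gy p)^2 \<le> \<delta>^2 * (gy p)^2" by (simp add: power_mult_distrib mult_right_mono)
    qed
    also have "\<dots> \<le> \<delta>^2 * E2" using E2gy by (simp add: mult_left_mono)
    finally show ?thesis .
  qed
  \<comment> \<open>Since the fibre average of \<open>gx\<close> is \<open>zb' - e\<close>,
    orthogonality to \<open>zb\<close> reads
    \<open>\<integral> D * ((zb' - e) * zb' + zb^2) = 0\<close>, so \<open>e\<close> is the only
    source of \<open>zb\<close>.\<close>
  have Dzb: "integral\<^sup>L (lon I) (\<lambda>x. D x * (zb x)^2) \<le> \<delta>^2 * E2"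
  proof -
    note i = L2_mult_integrable[OF R_borel gxL L2_fst(1)[OF zbL(2)]] L2_mult_integrable[OF R_borel zL L2_fst(1)[OF zbL(1)]]
    have gxI: "integrable (lon R) gx" and YgyI: "integrable (lon R) (\<lambda>p. Yf p * gy p)"
      by (intro L2_integrable[OF R_borel bounded_R] gxL YL)+
    have "integral\<^sup>L (lon I) (fint (\<lambda>p. gx p * zb' (fst p) + z p * zb (fst p))) = 0"
      using Gal[OF zbL zbd] fubini_R(3)[OF Bochner_Integration.integrable_add[OF i]] by simp
    moreover have fe: "AE x in lon I. fint (\<lambda>p. gx p * zb' (fst p) + z p * zb (fst p)) x = D x * ((zb' x - e x) * zb' x + (zb x)^2)"
      using fubini_R(1)[OF gxI] fubini_R(1)[OF YgyI] fubini_R(1)[OF L2_integrable[OF R_borel bounded_R zL]] AE_space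
    proof eventually_elim
      case (elim x)
      then have "x \<in> I" by (simp add: space_restrict_space)
      then have D0: "D x \<noteq> 0" using D_pos[of x] by auto
      have "fint (\<lambda>p. gx p * zb' (fst p) + z p * zb (fst p)) x = fint gx x * zb' x + fint z x * zb x"
        using elim by (simp add: fint_def)
      moreover have "fint z x = D x * zb x" using D0 by (simp add: zb_def favg_def)
      moreover have "fint G x = fint gx x + fint (\<lambda>p. Yf p * gy p) x"
        using elim by (simp add: fint_def G_def)
      then have "fint gx x = D x * (zb' x - e x)" using D0 by (simp add: zb'_def e_def favg_def field_simps)
      ultimately show ?case by (simp add: algebra_simps power2_eq_square)
    qed
    moreover have iF: "integrable (lon I) (fint (\<lambda>p. gx p * zb' (fst p) + z p * zb (fst p)))"
      by (rule fubini_R(2)[OF Bochner_Integration.integrable_add[OF i]])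
    have "integral\<^sup>L (lon I) (\<lambda>x. D x * (zb x)^2 - 1/2 * (D x * (e x)^2)) \<le> integral\<^sup>L (lon I) (fint (\<lambda>p. gx p * zb' (fst p) + z p * zb (fst p)))"
    proof (rule integral_mono_AE[OF _ iF])
      show "integrable (lon I) (\<lambda>x. D x * (zb x)^2 - 1/2 * (D x * (e x)^2))"
        using iD[OF zbL(1)] iD[OF eL] by simp
      show "AE x in lon I. D x * (zb x)^2 - 1/2 * (D x * (e x)^2) \<le> fint (\<lambda>p. gx p * zb' (fst p) + z p * zb (fst p)) x"
        using fe AE_space
      proof eventually_elim
        case (elim x)
        then have "x \<in> I" by (simp add: space_restrict_space)
        then have D0: "0 \<le> D x" using D_pos[of x] by auto
        \<comment> \<open>The right-hand side equals \<open>(zb' - e) * zb' + e^2 / 2\<close>: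
          completing squares discards \<open>zb'\<close> at the price of half of
          \<open>e^2\<close>.\<close>
        have "0 \<le> 1/2 * (zb' x - e x)^2 + 1/2 * (zb' x)^2" by simp
        then have "(zb x)^2 - 1/2 * (e x)^2 \<le> (zb' x - e x) * zb' x + (zb x)^2"
          by (simp add: power2_eq_square algebra_simps)
        from mult_left_mono[OF this D0] show ?case unfolding elim(1) by (simp add: algebra_simps)
      qed
    qed
    ultimately have "integral\<^sup>L (lon I) (\<lambda>x. D x * (zb x)^2) \<le> 1/2 * integral\<^sup>L (lon I) (\<lambda>x. D x * (e x)^2)"
      using iD[OF zbL(1)] iD[OF eL] by simp
    moreover have "0 \<le> \<delta>^2 * E2" using E20 by simp
    ultimately show ?thesis using De by linarith
  qed
  define N where "N = fint (\<lambda>q. \<bar>gy q\<bar>)"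
  have gyabs: "L2 R (\<lambda>q. \<bar>gy q\<bar>)" using gyL by (auto simp: L2_iff)
  have NL: "L2 I N" unfolding N_def by (rule L2_fint[OF gyabs])
  define T where "T = \<theta> \<inter> R"
  have T: "T \<in> sets borel" "T \<subseteq> R" unfolding T_def using th by auto
  have d12: "d1 \<le> d2"
  proof -
    obtain x where "x \<in> I" using ab dense by auto
    then show ?thesis using d[of x] by linarith
  qed
  \<comment> \<open>Removing the weight \<open>D\<close> costs \<open>1 / sqrt d1\<close>. In the
    application \<open>d1\<close> is of order \<open>\<epsilon>\<close>, and the rescaled norm
    compensates this loss.\<close>
  have zbT: "L2norm T (\<lambda>p. zb (fst p)) \<le> sqrt \<tau> * (\<bar>\<delta>\<bar> / sqrt d1) * sqrt E2"
  proof -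
    have zi: "integrable (lon I) (\<lambda>x. (zb x)^2)" using zbL by (simp add: L2_iff)
    have "d1 * integral\<^sup>L (lon I) (\<lambda>x. (zb x)^2) = integral\<^sup>L (lon I) (\<lambda>x. d1 * (zb x)^2)" by simp
    also have "\<dots> \<le> integral\<^sup>L (lon I) (\<lambda>x. D x * (zb x)^2)"
      using zi iD[OF zbL(1)] d by (intro integral_mono) (auto simp: space_restrict_space intro!: mult_right_mono)
    also have "\<dots> \<le> \<delta>^2 * E2" by (rule Dzb)
    finally have "integral\<^sup>L (lon I) (\<lambda>x. (zb x)^2) \<le> \<delta>^2 * E2 / d1" using d1 by (simp add: field_simps)
    then have "\<tau> * sint I (\<lambda>x. (zb x)^2) \<le> \<tau> * (\<delta>^2 * E2 / d1)"
      unfolding sint_lon[OF Ioo_borel] using tau0 by (rule mult_left_mono)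
    with sint_strip_fst_le(2)[OF th tau zbL(1)] have "sint T (\<lambda>p. (zb (fst p))^2) \<le> \<tau> * (\<delta>^2 * E2 / d1)"
      unfolding T_def by linarith
    then have "L2norm T (\<lambda>p. zb (fst p)) \<le> sqrt (\<tau> * (\<delta>^2 * E2 / d1))" unfolding L2norm_def by (rule real_sqrt_le_mono)
    then show ?thesis by (simp add: real_sqrt_mult real_sqrt_divide)
  qed
  \<comment> \<open>Cauchy-Schwarz on fibres of length at most \<open>d2\<close> gains
    \<open>sqrt d2\<close>, the second small quantity besides \<open>\<delta>\<close>.\<close>
  have NT: "L2norm T (\<lambda>p. 2 * N (fst p)) \<le> sqrt \<tau> * (2 * sqrt d2) * sqrt E2"
  proof -
    have g2: "integrable (lon R) (\<lambda>q. (\<bar>gy q\<bar>)^2)" using sq by simp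
    have "sint I (\<lambda>x. (N x)^2) \<le> integral\<^sup>L (lon I) (\<lambda>x. d2 * fint (\<lambda>q. (\<bar>gy q\<bar>)^2) x)"
      unfolding sint_lon[OF Ioo_borel]
    proof (rule integral_mono_AE)
      show "integrable (lon I) (\<lambda>x. (N x)^2)" using NL by (simp add: L2_iff)
      show "integrable (lon I) (\<lambda>x. d2 * fint (\<lambda>q. (\<bar>gy q\<bar>)^2) x)" using fubini_R(2)[OF g2] by simp
      show "AE x in lon I. (N x)^2 \<le> d2 * fint (\<lambda>q. (\<bar>gy q\<bar>)^2) x"
        using fint_square_le[OF gyabs] AE_space
      proof eventually_elim
        case (elim x)
        have "D x * fint (\<lambda>q. (\<bar>gy q\<bar>)^2) x \<le> d2 * fint (\<lambda>q. (\<bar>gy q\<bar>)^2) x"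
          using d[of x] elim(2) by (intro mult_right_mono) (auto simp: space_restrict_space fint_def)
        then show ?case using elim(1) unfolding N_def by linarith
      qed
    qed
    also have "\<dots> = d2 * integral\<^sup>L (lon R) (\<lambda>q. (gy q)^2)" using fubini_R(3)[OF g2] by simp
    also have "\<dots> \<le> d2 * E2" using E2gy d12 d1 by (intro mult_left_mono) auto
    finally have "\<tau> * sint I (\<lambda>x. (N x)^2) \<le> \<tau> * (d2 * E2)" using tau0 by (rule mult_left_mono)
    with sint_strip_fst_le(2)[OF th tau NL] have "sint T (\<lambda>p. (N (fst p))^2) \<le> \<tau> * (d2 * E2)"
      unfolding T_def by linarith
    then have "sint T (\<lambda>p. (2 * N (fst p))^2) \<le> 4 * (\<tau> * (d2 * E2))" by (simp add: power_mult_distrib)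
    then have "L2norm T (\<lambda>p. 2 * N (fst p)) \<le> sqrt (4 * (\<tau> * (d2 * E2)))" unfolding L2norm_def by (rule real_sqrt_le_mono)
    then show ?thesis by (simp add: real_sqrt_mult)
  qed
  have fT: "L2 T f" and zT: "L2 T z" by (rule L2_subset[OF R_borel T], fact f, rule L2_subset[OF R_borel T zL])
  have zbTL: "L2 T (\<lambda>p. zb (fst p))" and NTL: "L2 T (\<lambda>p. N (fst p))"
    unfolding T_def using sint_strip_fst_le(1)[OF th tau] zbL NL by auto
  have oscT: "AE p in lon T. \<bar>z p - zb (fst p)\<bar> \<le> 2 * N (fst p)"
  proof -
    have "AE p in lborel. p \<in> R \<longrightarrow> \<bar>z p - zb (fst p)\<bar> \<le> 2 * N (fst p)"
      using fibre_oscillation[OF zL gyL zg] unfolding zb_def N_def by (subst (asm) AE_lon) auto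
    then show ?thesis by (subst AE_lon[OF T(1)]) (use T(2) in \<open>auto elim!: eventually_mono\<close>)
  qed
  have diffL: "L2 T (\<lambda>p. z p - zb (fst p))" by (rule L2_diff[OF T(1) zT zbTL])
  have oscN: "L2norm T (\<lambda>p. z p - zb (fst p)) \<le> L2norm T (\<lambda>p. 2 * N (fst p))"
    unfolding L2norm_def sint_lon[OF T(1)]
  proof (rule real_sqrt_le_mono, rule integral_mono_AE)
    show "integrable (lon T) (\<lambda>p. (z p - zb (fst p))^2)" using diffL T(1) by (simp add: L2_iff)
    show "integrable (lon T) (\<lambda>p. (2 * N (fst p))^2)" using L2_cmult[OF T(1) NTL, of 2] T(1) by (simp add: L2_iff)
    show "AE p in lon T. (z p - zb (fst p))^2 \<le> (2 * N (fst p))^2"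
      using oscT by eventually_elim (metis abs_ge_zero power2_abs power_mono)
  qed
  have "E2 = s * sint T (\<lambda>p. f p * z p)" unfolding energy T_def sint_Int sint_lon[OF R_borel] ..
  \<comment> \<open>Average and oscillation are estimated separately on the strip. Both bounds are
    linear in \<open>sqrt E2\<close>, so one power of it can be divided out below.\<close>
  also have "sint T (\<lambda>p. f p * z p) = sint T (\<lambda>p. f p * zb (fst p)) + sint T (\<lambda>p. f p * (z p - zb (fst p)))"
  proof -
    have "sint T (\<lambda>p. f p * z p) = integral\<^sup>L (lon T) (\<lambda>p. f p * zb (fst p) + f p * (z p - zb (fst p)))"
      unfolding sint_lon[OF T(1)] by (simp add: algebra_simps)
    also have "\<dots> = sint T (\<lambda>p. f p * zb (fst p)) + sint T (\<lambda>p. f p * (z p - zb (fst p)))"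
      unfolding sint_lon[OF T(1)]
      by (rule Bochner_Integration.integral_add) (intro L2_mult_integrable T fT zbTL diffL)+
    finally show ?thesis .
  qed
  also have "s * \<dots> \<le> s * (L2norm T f * (sqrt \<tau> * (\<bar>\<delta>\<bar> / sqrt d1) * sqrt E2) + L2norm T f * (sqrt \<tau> * (2 * sqrt d2) * sqrt E2))"
  proof (intro mult_left_mono add_mono s0)
    have "sint T (\<lambda>p. f p * zb (fst p)) \<le> L2norm T f * L2norm T (\<lambda>p. zb (fst p))"
      using L2_Cauchy_Schwarz[OF T(1) fT zbTL] by linarith
    also have "\<dots> \<le> L2norm T f * (sqrt \<tau> * (\<bar>\<delta>\<bar> / sqrt d1) * sqrt E2)" by (rule mult_left_mono[OF zbT L2norm_nonneg])
    finally show "sint T (\<lambda>p. f p * zb (fst p)) \<le> L2norm T f * (sqrt \<tau> * (\<bar>\<delta>\<bar> / sqrt d1) * sqrt E2)" .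
    have "sint T (\<lambda>p. f p * (z p - zb (fst p))) \<le> L2norm T f * L2norm T (\<lambda>p. z p - zb (fst p))"
      using L2_Cauchy_Schwarz[OF T(1) fT diffL] by linarith
    also have "\<dots> \<le> L2norm T f * (sqrt \<tau> * (2 * sqrt d2) * sqrt E2)" using oscN NT by (intro mult_left_mono L2norm_nonneg) linarith
    finally show "sint T (\<lambda>p. f p * (z p - zb (fst p))) \<le> L2norm T f * (sqrt \<tau> * (2 * sqrt d2) * sqrt E2)" .
  qed
  also have "\<dots> = (s * L2norm T f * sqrt \<tau> * (\<bar>\<delta>\<bar> / sqrt d1 + 2 * sqrt d2)) * sqrt E2" (is "_ = ?C * _")
    by (simp add: algebra_simps)
  finally have le: "E2 \<le> ?C * sqrt E2" .
  have delta0: "\<bar>\<delta>\<bar> = \<delta>"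
  proof -
    obtain x where "x \<in> I" using ab dense by auto
    then show ?thesis using del[of x] by linarith
  qed
  have C0: "0 \<le> ?C" using s0 tau0 d1 d12 by (intro mult_nonneg_nonneg add_nonneg_nonneg L2norm_nonneg) auto
  have "sqrt E2 \<le> ?C" by (rule le_of_square_le_mult[OF E20 C0 le])
  moreover have "L2norm R z \<le> sqrt E2" unfolding L2norm_def sint_lon[OF R_borel] by (rule real_sqrt_le_mono[OF E2z])
  ultimately show ?thesis unfolding z_def[abs_def] delta0 T_def by linarith
qed

end

subsection \<open>Weak limits and the limit problem\<close>

lemma L2_zero_AE:
  assumes S: "S \<in> sets borel" and u: "L2 S u" and 0: "sint S (\<lambda>x. (u x)^2) = 0"
  shows "AE x in lon S. u x = 0"
proof -
  have "integrable (lon S) (\<lambda>x. (u x)^2)" using u S by (simp add: L2_iff)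
  then have "AE x in lon S. (u x)^2 = 0"
    using 0 integral_nonneg_eq_0_iff_AE[of "lon S" "\<lambda>x. (u x)^2"] by (simp add: sint_lon[OF S])
  then show ?thesis by eventually_elim simp
qed

text \<open>Test with the indicator of the set where \<open>U < c\<close>: in the limit the integral
  of \<open>c - U\<close> over this set is at most \<open>0\<close>, although the integrand is
  positive there.\<close>

lemma weak_limit_lower_bound:
  fixes a b :: real
  assumes U: "L2 {a<..<b} U" and u: "\<And>n. L2 {a<..<b} (u n)"
    and conv: "\<And>g. L2 {a<..<b} g \<Longrightarrow> (\<lambda>n. sint {a<..<b} (\<lambda>x. u n x * g x)) \<longlonglongrightarrow> sint {a<..<b} (\<lambda>x. U x * g x)"
    and lo: "\<And>n x. x \<in> {a<..<b} \<Longrightarrow> c \<le> u n x"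
  shows "AE x in lon {a<..<b}. c \<le> U x"
proof -
  let ?I = "{a<..<b}" let ?M = "lon ?I"
  have Um[measurable]: "U \<in> borel_measurable ?M" using U by (simp add: L2_iff)
  define g :: "real \<Rightarrow> real" where "g x = (if U x < c then 1 else 0)" for x
  have gm[measurable]: "g \<in> borel_measurable ?M" unfolding g_def by measurable
  have gL: "L2 ?I g" by (rule L2_bounded[where C=1, OF _ _ gm]) (auto simp: g_def)
  have gi: "integrable ?M g" using gL by (intro L2_integrable) auto
  have "integral\<^sup>L ?M (\<lambda>x. c * g x) \<le> sint ?I (\<lambda>x. U x * g x)"
  proof (rule LIMSEQ_le_const[OF conv[OF gL]], intro exI allI impI)
    fix n
    show "integral\<^sup>L ?M (\<lambda>x. c * g x) \<le> sint ?I (\<lambda>x. u n x * g x)"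
      unfolding sint_lon[OF Ioo_borel]
    proof (rule integral_mono)
      show "integrable ?M (\<lambda>x. c * g x)" using gi by simp
      show "integrable ?M (\<lambda>x. u n x * g x)" by (rule L2_mult_integrable[OF _ u gL]) simp
      show "c * g x \<le> u n x * g x" if "x \<in> space ?M" for x
        using lo[of x n] that by (simp add: g_def space_restrict_space)
    qed
  qed
  moreover have i: "integrable ?M (\<lambda>x. (c - U x) * g x)"
    using gi L2_mult_integrable[OF _ U gL] by (simp add: left_diff_distrib)
  ultimately have "integral\<^sup>L ?M (\<lambda>x. (c - U x) * g x) \<le> 0"
    using gi L2_mult_integrable[OF _ U gL] by (simp add: left_diff_distrib sint_lon)
  moreover have nn: "AE x in ?M. 0 \<le> (c - U x) * g x" by (auto simp: g_def)
  ultimately have "integral\<^sup>L ?M (\<lambda>x. (c - U x) * g x) = 0" using integral_nonneg_AE[OF nn] by linarith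
  then have "AE x in ?M. (c - U x) * g x = 0" using integral_nonneg_eq_0_iff_AE[OF i nn] by simp
  then show ?thesis by eventually_elim (auto simp: g_def split: if_splits)
qed

lemma weak_limit_upper_bound:
  fixes a b :: real
  assumes U: "L2 {a<..<b} U" and u: "\<And>n. L2 {a<..<b} (u n)"
    and conv: "\<And>g. L2 {a<..<b} g \<Longrightarrow> (\<lambda>n. sint {a<..<b} (\<lambda>x. u n x * g x)) \<longlonglongrightarrow> sint {a<..<b} (\<lambda>x. U x * g x)"
    and hi: "\<And>n x. x \<in> {a<..<b} \<Longrightarrow> u n x \<le> c"
  shows "AE x in lon {a<..<b}. U x \<le> c"
proof -
  have "AE x in lon {a<..<b}. - c \<le> (-1) * U x"
  proof (rule weak_limit_lower_bound[where u="\<lambda>n x. (-1) * u n x"])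
    show "(\<lambda>n. sint {a<..<b} (\<lambda>x. (-1) * u n x * g x)) \<longlonglongrightarrow> sint {a<..<b} (\<lambda>x. (-1) * U x * g x)" if "L2 {a<..<b} g" for g
      using tendsto_mult_left[OF conv[OF that], of "-1"] unfolding mult.assoc set_integral_mult_right .
    show "L2 {a<..<b} (\<lambda>x. (-1) * U x)" "L2 {a<..<b} (\<lambda>x. (-1) * u n x)" for n
      by (rule L2_cmult[OF Ioo_borel], fact)+
  qed (use hi in auto)
  then show ?thesis by eventually_elim simp
qed

text \<open>Split \<open>\<phi> n\<close> into \<open>p\<close> and the remainder. The first part is
  weak convergence against \<open>p * g\<close>; the second is at most \<open>Q\<close> times the
  uniform error times the \<open>L\<^sup>1\<close> norm of \<open>g\<close>.\<close>

lemma weak_times_uniform: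
  fixes q :: "nat \<Rightarrow> real \<Rightarrow> real"
  assumes ab: "a < b" and qm: "\<And>n. q n \<in> borel_measurable (lon {a<..<b})"
    and Q: "\<And>n x. x \<in> {a<..<b} \<Longrightarrow> \<bar>q n x\<bar> \<le> Q"
    and conv: "\<And>g. L2 {a<..<b} g \<Longrightarrow> (\<lambda>n. sint {a<..<b} (\<lambda>x. q n x * g x)) \<longlonglongrightarrow> sint {a<..<b} (\<lambda>x. U x * g x)"
    and \<phi>c: "\<And>n. continuous_on {a..b} (\<phi> n)" and pc: "continuous_on {a..b} p"
    and unif: "\<And>e. 0 < e \<Longrightarrow> \<exists>N. \<forall>n\<ge>N. \<forall>x\<in>{a..b}. \<bar>\<phi> n x - p x\<bar> < e"
    and g: "L2 {a<..<b} g"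
  shows "(\<lambda>n. sint {a<..<b} (\<lambda>x. q n x * (\<phi> n x * g x))) \<longlonglongrightarrow> sint {a<..<b} (\<lambda>x. U x * (p x * g x))"
proof -
  let ?I = "{a<..<b}" let ?M = "lon ?I"
  have Q0: "0 \<le> Q"
  proof -
    obtain x where "x \<in> ?I" using ab dense by auto
    then show ?thesis using Q[of x 0] by linarith
  qed
  have bc: "L2 ?I (\<lambda>x. c x * g x)" if c: "continuous_on {a..b} c" for c
  proof -
    have "bounded (c ` {a..b})" by (auto intro!: compact_imp_bounded compact_continuous_image c)
    then obtain C where C: "\<forall>x\<in>{a..b}. \<bar>c x\<bar> \<le> C" by (auto simp: bounded_iff)
    have "c \<in> borel_measurable ?M" by (intro continuous_on_measurable_lon continuous_on_subset[OF c]) auto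
    then show ?thesis by (rule L2_bounded_mult[OF Ioo_borel g, where C=C]) (use C in auto)
  qed
  have gi: "integrable ?M (\<lambda>x. \<bar>g x\<bar>)" using L2_integrable[OF _ _ g] by auto
  have "(\<lambda>n. sint ?I (\<lambda>x. q n x * ((\<phi> n x - p x) * g x))) \<longlonglongrightarrow> 0"
  proof (rule LIMSEQ_I)
    fix r :: real assume r: "0 < r"
    define A where "A = Q * integral\<^sup>L ?M (\<lambda>x. \<bar>g x\<bar>)"
    have A0: "0 \<le> A" unfolding A_def using Q0 by (intro mult_nonneg_nonneg integral_nonneg_AE) auto
    define e where "e = r / (A + 1)"
    have e: "0 < e" using r A0 by (simp add: e_def)
    obtain N where N: "\<forall>n\<ge>N. \<forall>x\<in>{a..b}. \<bar>\<phi> n x - p x\<bar> < e" using unif[OF e] by blast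
    show "\<exists>N. \<forall>n\<ge>N. norm (sint ?I (\<lambda>x. q n x * ((\<phi> n x - p x) * g x)) - 0) < r"
    proof (intro exI allI impI)
      fix n assume n: "N \<le> n"
      have L: "L2 ?I (\<lambda>x. (\<phi> n x - p x) * g x)" by (intro bc continuous_intros \<phi>c pc)
      have i: "integrable ?M (\<lambda>x. q n x * ((\<phi> n x - p x) * g x))"
        by (rule L2_integrable[OF _ _ L2_bounded_mult[OF _ L qm Q]]) auto
      have "\<bar>integral\<^sup>L ?M (\<lambda>x. q n x * ((\<phi> n x - p x) * g x))\<bar> \<le> integral\<^sup>L ?M (\<lambda>x. \<bar>q n x * ((\<phi> n x - p x) * g x)\<bar>)"
        using integral_norm_bound[of ?M "\<lambda>x. q n x * ((\<phi> n x - p x) * g x)"] by simp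
      also have "\<dots> \<le> integral\<^sup>L ?M (\<lambda>x. Q * e * \<bar>g x\<bar>)"
      proof (rule integral_mono)
        show "integrable ?M (\<lambda>x. \<bar>q n x * ((\<phi> n x - p x) * g x)\<bar>)" using i by (rule integrable_abs)
        show "integrable ?M (\<lambda>x. Q * e * \<bar>g x\<bar>)" using gi by simp
        fix x assume "x \<in> space ?M"
        then have x: "x \<in> ?I" by (simp add: space_restrict_space)
        have "\<bar>\<phi> n x - p x\<bar> \<le> e" using N n x by (simp add: less_imp_le)
        then have "\<bar>q n x\<bar> * (\<bar>\<phi> n x - p x\<bar> * \<bar>g x\<bar>) \<le> Q * (e * \<bar>g x\<bar>)"
          using Q[OF x, of n] Q0 by (intro mult_mono) auto
        then show "\<bar>q n x * ((\<phi> n x - p x) * g x)\<bar> \<le> Q * e * \<bar>g x\<bar>" by (simp add: abs_mult mult.assoc)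
      qed
      also have "\<dots> = e * A" by (simp add: A_def)
      also have "\<dots> < r" using r A0 by (simp add: e_def field_simps)
      finally show "norm (sint ?I (\<lambda>x. q n x * ((\<phi> n x - p x) * g x)) - 0) < r" by (simp add: sint_lon)
    qed
  qed
  from tendsto_add[OF this conv[OF bc[OF pc]]]
  have "(\<lambda>n. sint ?I (\<lambda>x. q n x * ((\<phi> n x - p x) * g x)) + sint ?I (\<lambda>x. q n x * (p x * g x))) \<longlonglongrightarrow> sint ?I (\<lambda>x. U x * (p x * g x))"
    by simp
  moreover have "sint ?I (\<lambda>x. q n x * ((\<phi> n x - p x) * g x)) + sint ?I (\<lambda>x. q n x * (p x * g x)) = sint ?I (\<lambda>x. q n x * (\<phi> n x * g x))" for n
  proof -
    have i: "integrable ?M (\<lambda>x. q n x * ((\<phi> n x - p x) * g x))" "integrable ?M (\<lambda>x. q n x * (p x * g x))"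
      by (rule L2_integrable[OF _ _ L2_bounded_mult[OF _ _ qm Q]]; (intro bc continuous_intros \<phi>c pc)?; auto)+
    then show ?thesis unfolding sint_lon[OF Ioo_borel]
      by (subst Bochner_Integration.integral_add[symmetric]) (auto simp: algebra_simps)
  qed
  ultimately show ?thesis by simp
qed

section \<open>The limit problem and its uniqueness\<close>

definition solves_limit :: "real \<Rightarrow> real \<Rightarrow> (real \<Rightarrow> real) \<Rightarrow> (real \<Rightarrow> real) \<Rightarrow> (real \<Rightarrow> real) \<Rightarrow> (real \<Rightarrow> real) \<Rightarrow> bool" where
  "solves_limit a b P K f0 u \<longleftrightarrow> H1_1 {a<..<b} u \<and> (\<forall>\<phi>. H1_1 {a<..<b} \<phi> \<longrightarrow>
     sint {a<..<b} (\<lambda>x. 1 / P x * wderiv {a<..<b} u x * wderiv {a<..<b} \<phi> x + K x * u x * \<phi> x)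
       = sint {a<..<b} (\<lambda>x. f0 x * \<phi> x))"

text \<open>Testing the difference of the two equations with the difference of the solutions gives a
  sum of two nonnegative terms. The lower bound on \<open>P\<close> is what makes
  \<open>1 / P\<close> bounded and the integrals finite.\<close>

lemma solves_limit_unique:
  assumes P: "P \<in> borel_measurable (lon {a<..<b})" and Pb: "AE x in lon {a<..<b}. p1 \<le> P x" and p1: "0 < p1"
    and K: "K \<in> borel_measurable (lon {a<..<b})" and Kb: "AE x in lon {a<..<b}. k1 \<le> K x" "AE x in lon {a<..<b}. K x \<le> k2" and k1: "0 < k1"
    and s: "solves_limit a b P K f0 u" "solves_limit a b P K f0 u'"
  shows "AE x in lon {a<..<b}. u x = u' x" "AE x in lon {a<..<b}. wderiv {a<..<b} u x = wderiv {a<..<b} u' x"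
proof -
  let ?I = "{a<..<b}" let ?M = "lon ?I"
  let ?v = "wderiv ?I u" and ?v' = "wderiv ?I u'"
  have h: "H1_1 ?I u" "H1_1 ?I u'" using s by (auto simp: solves_limit_def)
  note U = H1_1_wderiv[OF h(1)] and U' = H1_1_wderiv[OF h(2)]
  define \<phi> where "\<phi> x = u x - u' x" for x
  define \<psi> where "\<psi> x = ?v x - ?v' x" for x
  have L: "L2 ?I \<phi>" "L2 ?I \<psi>" unfolding \<phi>_def \<psi>_def by (intro L2_diff U U'; simp)+
  have d: "is_wderiv ?I \<phi> \<psi>" unfolding \<phi>_def \<psi>_def by (intro is_wderiv_diff U U')
  have hphi: "H1_1 ?I \<phi>" unfolding H1_1_def using L d by blast
  note G = H1_1_wderiv[OF hphi]
  have ae: "AE x in ?M. wderiv ?I \<phi> x = \<psi> x"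
    by (rule is_wderiv_unique[OF G(2) L(2) _ _ G(3) d]) (use L in \<open>auto simp: L2_iff\<close>)
  have Pm: "(\<lambda>x. 1 / P x) \<in> borel_measurable ?M" using P by simp
  have Pi: "AE x in ?M. \<bar>1 / P x\<bar> \<le> 1 / p1" using Pb by eventually_elim (use p1 in \<open>simp add: frac_le\<close>)
  have Kab: "AE x in ?M. \<bar>K x\<bar> \<le> k2" using Kb by eventually_elim (use k1 in simp)
  have LP: "L2 ?I (\<lambda>x. 1 / P x * g x)" if "L2 ?I g" for g by (rule L2_AE_bounded_mult[OF _ that Pm Pi]) simp
  have LK: "L2 ?I (\<lambda>x. K x * g x)" if "L2 ?I g" for g by (rule L2_AE_bounded_mult[OF _ that K Kab]) simp
  have i: "integrable ?M (\<lambda>x. 1 / P x * g x * g' x + K x * f x * f' x)" if "L2 ?I g" "L2 ?I g'" "L2 ?I f" "L2 ?I f'" for g g' f f'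
    by (intro Bochner_Integration.integrable_add L2_mult_integrable LP LK that) auto
  have m: "P \<in> borel_measurable ?M" "K \<in> borel_measurable ?M" "\<psi> \<in> borel_measurable ?M" "\<phi> \<in> borel_measurable ?M" "wderiv ?I \<phi> \<in> borel_measurable ?M"
    using P K L G by (auto simp: L2_iff)
  have "integral\<^sup>L ?M (\<lambda>x. 1 / P x * (\<psi> x)^2 + K x * (\<phi> x)^2) = integral\<^sup>L ?M (\<lambda>x. (1 / P x * ?v x * wderiv ?I \<phi> x + K x * u x * \<phi> x) - (1 / P x * ?v' x * wderiv ?I \<phi> x + K x * u' x * \<phi> x))"
  proof (rule integral_cong_AE)
    show "AE x in ?M. 1 / P x * (\<psi> x)^2 + K x * (\<phi> x)^2 = (1 / P x * ?v x * wderiv ?I \<phi> x + K x * u x * \<phi> x) - (1 / P x * ?v' x * wderiv ?I \<phi> x + K x * u' x * \<phi> x)"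
      using ae
    proof eventually_elim
      case (elim x)
      have "c * (r - t)^2 + k * (y - y')^2 = (c * r * (r - t) + k * y * (y - y')) - (c * t * (r - t) + k * y' * (y - y'))"
        for c r t k y y' :: real by algebra
      then show ?case unfolding elim unfolding \<phi>_def \<psi>_def .
    qed
    show "(\<lambda>x. (1 / P x * ?v x * wderiv ?I \<phi> x + K x * u x * \<phi> x) - (1 / P x * ?v' x * wderiv ?I \<phi> x + K x * u' x * \<phi> x)) \<in> borel_measurable ?M"
      using i[OF U(2) G(2) U(1) L(1)] i[OF U'(2) G(2) U'(1) L(1)] by auto
  qed (use m in auto)
  also have "\<dots> = 0"
    using s hphi unfolding solves_limit_def sint_lon[OF Ioo_borel]
    by (subst Bochner_Integration.integral_diff[OF i[OF U(2) G(2) U(1) L(1)] i[OF U'(2) G(2) U'(1) L(1)]]) auto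
  finally have z: "integral\<^sup>L ?M (\<lambda>x. 1 / P x * (\<psi> x)^2 + K x * (\<phi> x)^2) = 0" .
  have ii: "integrable ?M (\<lambda>x. 1 / P x * (\<psi> x)^2 + K x * (\<phi> x)^2)"
    using i[OF L(2) L(2) L(1) L(1)] by (simp add: power2_eq_square mult.assoc)
  have nn: "AE x in ?M. 0 \<le> 1 / P x * (\<psi> x)^2 + K x * (\<phi> x)^2"
    using Pb Kb(1) by eventually_elim (use p1 k1 in auto)
  have "AE x in ?M. 1 / P x * (\<psi> x)^2 + K x * (\<phi> x)^2 = 0"
    using z integral_nonneg_eq_0_iff_AE[OF ii nn] by simp
  then have "AE x in ?M. \<psi> x = 0 \<and> \<phi> x = 0"
    using Pb Kb(1)
  proof eventually_elim
    case (elim x)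
    have p: "0 < 1 / P x" "0 < K x" using elim p1 k1 by auto
    have "0 \<le> 1 / P x * (\<psi> x)^2" "0 \<le> K x * (\<phi> x)^2" using p by (auto simp del: divide_divide_eq_right)
    then have "1 / P x * (\<psi> x)^2 = 0" "K x * (\<phi> x)^2 = 0" using elim(1) by linarith+
    then show ?case using p by auto
  qed
  then show "AE x in ?M. u x = u' x" "AE x in ?M. ?v x = ?v' x"
    by (eventually_elim; simp add: \<phi>_def \<psi>_def)+
qed

subsection \<open>Compactness of the reduced problems\<close>

lemma prim_left: "x \<le> a \<Longrightarrow> prim a b v x = 0"
proof -
  assume x: "x \<le> a"
  have "prim a b v x = integral\<^sup>L (lon {a<..<b}) (\<lambda>t. 0)" unfolding prim_def
    by (rule Bochner_Integration.integral_cong) (use x in \<open>auto simp: space_restrict_space split: split_indicator\<close>)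
  then show ?thesis by simp
qed

lemma L2_indicator_atMost: "L2 {a<..<b::real} (indicator {..x})"
proof (rule L2_bounded[where C=1])
  show "indicator {..x} \<in> borel_measurable (lon {a<..<b})" by (rule measurable_restrict_space1) simp
qed (auto split: split_indicator)

text \<open>\<open>k\<close> stands for \<open>k1 + k2\<close> and \<open>h\<close> for the rescaled
  load, taken along an arbitrary sequence of parameters. The bounds are uniform in \<open>n\<close>,
  and the three weak convergences are required along this sequence only.\<close>

locale reduced_problems =
  fixes a b \<kappa>1 \<kappa>2 C :: real and k h wh :: "nat \<Rightarrow> real \<Rightarrow> real" and K P f0 :: "real \<Rightarrow> real"
  assumes ab: "a < b" and \<kappa>1: "0 < \<kappa>1"
    and km: "\<And>n. k n \<in> borel_measurable (lon {a<..<b})"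
    and kb: "\<And>n x. x \<in> {a<..<b} \<Longrightarrow> \<kappa>1 \<le> k n x \<and> k n x \<le> \<kappa>2"
    and hL: "\<And>n. L2 {a<..<b} (h n)" and hb: "\<And>n. L2norm {a<..<b} (h n) \<le> C"
    and KL: "L2 {a<..<b} K" and PL: "L2 {a<..<b} P" and f0L: "L2 {a<..<b} f0"
    and kconv: "\<And>g. L2 {a<..<b} g \<Longrightarrow> (\<lambda>n. sint {a<..<b} (\<lambda>x. k n x * g x)) \<longlonglongrightarrow> sint {a<..<b} (\<lambda>x. K x * g x)"
    and Pconv: "\<And>g. L2 {a<..<b} g \<Longrightarrow> (\<lambda>n. sint {a<..<b} (\<lambda>x. 1 / k n x * g x)) \<longlonglongrightarrow> sint {a<..<b} (\<lambda>x. P x * g x)"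
    and hconv: "\<And>g. L2 {a<..<b} g \<Longrightarrow> (\<lambda>n. sint {a<..<b} (\<lambda>x. h n x * g x)) \<longlonglongrightarrow> sint {a<..<b} (\<lambda>x. f0 x * g x)"
    and whH: "\<And>n. H1_1 {a<..<b} (wh n)"
    and eq: "\<And>n \<phi>. H1_1 {a<..<b} \<phi> \<Longrightarrow> sint {a<..<b} (\<lambda>x. k n x * wderiv {a<..<b} (wh n) x * wderiv {a<..<b} \<phi> x + k n x * wh n x * \<phi> x)
       = sint {a<..<b} (\<lambda>x. h n x * \<phi> x)"
begin

abbreviation I where "I \<equiv> {a<..<b}"
abbreviation M where "M \<equiv> lon I"
definition v where "v n = wderiv I (wh n)"
text \<open>\<open>g\<close> is what the equation prescribes as derivative of the flux
  \<open>k * v\<close>. \<open>A\<close> will bound the solutions and their derivatives in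
  \<open>L2\<close>, and \<open>B\<close> will bound \<open>g\<close>.\<close>

definition g where "g n x = k n x * wh n x - h n x" for n x
definition A where "A = C / \<kappa>1"
definition B where "B = \<kappa>2 * A + C"

lemma mid: obtains x where "x \<in> I" using ab dense by auto

lemma \<kappa>2: "\<kappa>1 \<le> \<kappa>2" using mid kb by (metis order_trans)

lemma C0: "0 \<le> C" using hb[of 0] L2norm_nonneg[of I "h 0"] by linarith

lemma A0: "0 \<le> A" and B0: "0 \<le> B" using C0 \<kappa>1 \<kappa>2 by (auto simp: A_def B_def)

lemma whL: "L2 I (wh n)" and vL: "L2 I (v n)" and vd: "is_wderiv I (wh n) (v n)"
  using H1_1_wderiv[OF whH] by (auto simp: v_def)

lemma k_abs: "x \<in> I \<Longrightarrow> \<bar>k n x\<bar> \<le> \<kappa>2"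
  using kb[of x n] \<kappa>1 by simp

lemma kL: "L2 I u \<Longrightarrow> L2 I (\<lambda>x. k n x * u x)"
  by (rule L2_bounded_mult[OF Ioo_borel _ km k_abs])

lemma eq':
  assumes "L2 I \<phi>" "L2 I \<psi>" "is_wderiv I \<phi> \<psi>"
  shows "integral\<^sup>L M (\<lambda>x. k n x * v n x * \<psi> x) + integral\<^sup>L M (\<lambda>x. g n x * \<phi> x) = 0"
proof -
  have H: "H1_1 I \<phi>" unfolding H1_1_def using assms by blast
  note W = H1_1_wderiv[OF H]
  have ae: "AE x in M. wderiv I \<phi> x = \<psi> x"
    by (rule is_wderiv_unique[OF W(2) assms(2) _ _ W(3) assms(3)]) (use assms(1) in \<open>auto simp: L2_iff\<close>)
  note i1 = L2_mult_integrable[OF Ioo_borel kL[OF vL[of n], of n] assms(2)]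
    and i2 = L2_mult_integrable[OF Ioo_borel kL[OF whL[of n], of n] assms(1)]
    and i3 = L2_mult_integrable[OF Ioo_borel hL[of n] assms(1)]
    and i4 = L2_mult_integrable[OF Ioo_borel kL[OF vL[of n], of n] W(2)]
  have "integral\<^sup>L M (\<lambda>x. k n x * v n x * wderiv I \<phi> x) = integral\<^sup>L M (\<lambda>x. k n x * v n x * \<psi> x)"
    by (rule integral_cong_AE) (use ae i1 i4 in auto)
  moreover have "integral\<^sup>L M (\<lambda>x. k n x * v n x * wderiv I \<phi> x) + integral\<^sup>L M (\<lambda>x. k n x * wh n x * \<phi> x) = integral\<^sup>L M (\<lambda>x. h n x * \<phi> x)"
    using eq[OF H, of n] i2 i4 unfolding v_def[symmetric] by (simp add: sint_lon)
  moreover have "integral\<^sup>L M (\<lambda>x. g n x * \<phi> x) = integral\<^sup>L M (\<lambda>x. k n x * wh n x * \<phi> x) - integral\<^sup>L M (\<lambda>x. h n x * \<phi> x)"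
    using i2 i3 by (simp add: g_def left_diff_distrib)
  ultimately show ?thesis by simp
qed

text \<open>Test with the solution itself: coercivity gives
  \<open>\<kappa>1 * S \<le> C * sqrt S\<close> for the squared \<open>H\<^sup>1\<close> norm
  \<open>S\<close>, hence \<open>sqrt S \<le> C / \<kappa>1\<close>.\<close>

lemma energy: "L2norm I (v n) \<le> A" "L2norm I (wh n) \<le> A"
proof -
  define S where "S = (L2norm I (v n))^2 + (L2norm I (wh n))^2"
  have S0: "0 \<le> S" unfolding S_def by simp
  have sq: "integrable M (\<lambda>x. (v n x)^2)" "integrable M (\<lambda>x. (wh n x)^2)" using vL whL by (auto simp: L2_iff)
  have i: "integrable M (\<lambda>x. k n x * v n x * v n x)" "integrable M (\<lambda>x. k n x * wh n x * wh n x)"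
    "integrable M (\<lambda>x. h n x * wh n x)"
    by (intro L2_mult_integrable kL vL whL hL; simp)+
  have "\<kappa>1 * S = integral\<^sup>L M (\<lambda>x. \<kappa>1 * (v n x)^2 + \<kappa>1 * (wh n x)^2)"
    unfolding S_def L2norm_square using sq by (simp add: sint_lon distrib_left)
  also have "\<dots> \<le> integral\<^sup>L M (\<lambda>x. k n x * v n x * v n x + k n x * wh n x * wh n x)"
  proof (rule integral_mono)
    show "\<kappa>1 * (v n x)^2 + \<kappa>1 * (wh n x)^2 \<le> k n x * v n x * v n x + k n x * wh n x * wh n x" if "x \<in> space M" for x
    proof -
      have "\<kappa>1 \<le> k n x" using kb[of x n] that by (simp add: space_restrict_space)
      then have "\<kappa>1 * (v n x)^2 \<le> k n x * (v n x)^2" "\<kappa>1 * (wh n x)^2 \<le> k n x * (wh n x)^2"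
        by (auto intro: mult_right_mono)
      then show ?thesis by (simp add: power2_eq_square mult.assoc)
    qed
  qed (use sq i in auto)
  also have "\<dots> = sint I (\<lambda>x. h n x * wh n x)"
    using eq'[OF whL vL vd, of n n] i by (simp add: g_def left_diff_distrib sint_lon)
  also have "\<dots> \<le> L2norm I (h n) * L2norm I (wh n)"
    using L2_Cauchy_Schwarz[OF Ioo_borel hL[of n] whL[of n]] by linarith
  also have "\<dots> \<le> C * sqrt S"
    using hb[of n] C0 L2norm_nonneg[of I "wh n"]
    by (intro mult_mono) (auto simp: S_def intro!: real_le_rsqrt)
  finally have "S \<le> A * sqrt S" using \<kappa>1 by (simp add: A_def field_simps)
  then have S: "sqrt S \<le> A" by (rule le_of_square_le_mult[OF S0 A0])
  moreover have "L2norm I (v n) \<le> sqrt S" "L2norm I (wh n) \<le> sqrt S"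
    by (auto simp: S_def intro!: real_le_rsqrt)
  ultimately show "L2norm I (v n) \<le> A" "L2norm I (wh n) \<le> A" by linarith+
qed

lemma gL: "L2 I (g n)"
  unfolding g_def by (intro L2_diff kL whL hL) simp

lemma g_bound: "L2norm I (g n) \<le> B"
proof -
  have "L2norm I (\<lambda>x. k n x * wh n x + (-1) * h n x) \<le> L2norm I (\<lambda>x. k n x * wh n x) + L2norm I (\<lambda>x. (-1) * h n x)"
    by (intro L2norm_triangle kL whL L2_cmult hL) simp_all
  moreover have "L2norm I (\<lambda>x. (-1) * h n x) = L2norm I (h n)" by (subst L2norm_cmult) simp
  moreover have "L2norm I (\<lambda>x. k n x * wh n x) \<le> L2norm I (\<lambda>x. \<kappa>2 * wh n x)"
  proof (rule L2norm_mono)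
    show "AE x in M. \<bar>k n x * wh n x\<bar> \<le> \<bar>\<kappa>2 * wh n x\<bar>"
    proof (rule AE_I2)
      fix x assume "x \<in> space M"
      then have "\<bar>k n x\<bar> \<le> \<bar>\<kappa>2\<bar>" using kb[of x n] \<kappa>1 by (simp add: space_restrict_space)
      then show "\<bar>k n x * wh n x\<bar> \<le> \<bar>\<kappa>2 * wh n x\<bar>" unfolding abs_mult by (rule mult_right_mono) simp
    qed
  qed (intro kL whL L2_cmult Ioo_borel)+
  moreover have "L2norm I (\<lambda>x. \<kappa>2 * wh n x) \<le> \<kappa>2 * A"
    unfolding L2norm_cmult using energy(2)[of n] \<kappa>1 \<kappa>2 by (simp add: mult_left_mono)
  ultimately show ?thesis using hb[of n] unfolding B_def g_def by simp
qed

lemma gi: "integrable M (g n)" and vi: "integrable M (v n)"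
  using gL vL by (auto intro: L2_integrable)

text \<open>Constants are admissible test functions. This is the Neumann condition at
  \<open>b\<close> in integrated form, since it says that the primitive \<open>G n\<close> vanishes
  there.\<close>

lemma g_mean: "integral\<^sup>L M (g n) = 0"
proof -
  have "is_wderiv I (\<lambda>x. 1 + prim a b (\<lambda>x. 0) x) (\<lambda>x. 0)" by (rule is_wderiv_prim[OF ab]) simp
  moreover have "(\<lambda>x. 1 + prim a b (\<lambda>x. 0) x) = (\<lambda>x. 1)" by (simp add: prim_def)
  ultimately have "is_wderiv I (\<lambda>x. 1) (\<lambda>x. 0)" by simp
  from eq'[OF L2_const L2_const this] show ?thesis by simp
qed

definition G where "G n = prim a b (g n)"

lemma GL: "L2 I (G n)"
  using L2_prim[OF ab gL, of 0] by (simp add: G_def)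

text \<open>Test with the primitive of \<open>\<psi> = k * v - G\<close>. Integration by parts, with
  \<open>g\<close> of mean zero, moves the primitive onto \<open>g\<close>, and the equation becomes
  \<open>\<integral> \<psi>^2 = 0\<close>.\<close>

lemma flux: "AE x in M. k n x * v n x = G n x"
proof -
  define \<psi> where "\<psi> x = k n x * v n x - G n x" for x
  have \<psi>L: "L2 I \<psi>" unfolding \<psi>_def by (intro L2_diff kL vL GL) simp
  have \<psi>i: "integrable M \<psi>" using \<psi>L by (auto intro: L2_integrable)
  have d: "is_wderiv I (\<lambda>x. 0 + prim a b \<psi> x) \<psi>" by (rule is_wderiv_prim[OF ab \<psi>i])
  have "integral\<^sup>L M (\<lambda>x. k n x * v n x * \<psi> x) + integral\<^sup>L M (\<lambda>x. g n x * prim a b \<psi> x) = 0"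
    using eq'[OF L2_prim[OF ab \<psi>L, of 0] \<psi>L d, of n] by simp
  moreover have "integral\<^sup>L M (\<lambda>x. g n x * prim a b \<psi> x) + integral\<^sup>L M (\<lambda>x. \<psi> x * G n x) = 0"
    using prim_parts[OF \<psi>i gi[of n]] g_mean[of n] by (simp add: G_def)
  moreover have "sint I (\<lambda>x. (\<psi> x)^2) = integral\<^sup>L M (\<lambda>x. k n x * v n x * \<psi> x - \<psi> x * G n x)"
    unfolding sint_lon[OF Ioo_borel]
    by (rule integral_lon_cong) (auto simp: \<psi>_def power2_eq_square algebra_simps)
  moreover have "integral\<^sup>L M (\<lambda>x. k n x * v n x * \<psi> x - \<psi> x * G n x) = integral\<^sup>L M (\<lambda>x. k n x * v n x * \<psi> x) - integral\<^sup>L M (\<lambda>x. \<psi> x * G n x)"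
    by (rule Bochner_Integration.integral_diff; intro L2_mult_integrable kL vL \<psi>L GL; simp)
  ultimately have "sint I (\<lambda>x. (\<psi> x)^2) = 0" by simp
  from L2_zero_AE[OF _ \<psi>L this] have "AE x in M. \<psi> x = 0" by simp
  then show ?thesis by eventually_elim (simp add: \<psi>_def)
qed

lemma ex_c: "\<exists>c. AE x in M. wh n x = c + prim a b (v n) x"
  using is_wderiv_imp_prim[OF ab whL vL vd] by metis

text \<open>The constant of integration; with it \<open>W n\<close> is the continuous representative
  of \<open>wh n\<close>, meaningful at every point, as uniform convergence requires.\<close>

definition c where "c n = (SOME c. AE x in M. wh n x = c + prim a b (v n) x)"
definition W where "W n x = c n + prim a b (v n) x" for n x

lemma wh_W: "AE x in M. wh n x = W n x"
  unfolding W_def c_def by (rule someI_ex[OF ex_c])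

lemma WL: "L2 I (W n)" unfolding W_def by (rule L2_prim[OF ab vL])

lemma W_cont: "continuous_on S (W n)" and G_cont: "continuous_on S (G n)"
  unfolding W_def G_def by (intro continuous_intros prim_continuous[OF ab vL] prim_continuous[OF ab gL])+

lemma W_Hoelder: "\<bar>W n y - W n x\<bar> \<le> sqrt \<bar>y - x\<bar> * A"
  using prim_Hoelder[OF ab vL, of n y x] mult_left_mono[OF energy(1)[of n], of "sqrt \<bar>y - x\<bar>"] by (simp add: W_def)

lemma G_Hoelder: "\<bar>G n y - G n x\<bar> \<le> sqrt \<bar>y - x\<bar> * B"
  using prim_Hoelder[OF ab gL, of n y x] mult_left_mono[OF g_bound[of n], of "sqrt \<bar>y - x\<bar>"] by (simp add: G_def)

lemma prim_v_bound: "x \<in> {a..b} \<Longrightarrow> \<bar>prim a b (v n) x\<bar> \<le> sqrt (b - a) * A"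
proof -
  assume x: "x \<in> {a..b}"
  have "\<bar>prim a b (v n) x\<bar> \<le> sqrt \<bar>x - a\<bar> * A"
    using W_Hoelder[of n x a] by (simp add: W_def prim_left)
  also have "\<dots> \<le> sqrt (b - a) * A" using x A0 by (intro mult_right_mono) auto
  finally show ?thesis .
qed

lemma G_bound: "x \<in> {a..b} \<Longrightarrow> \<bar>G n x\<bar> \<le> sqrt (b - a) * B"
proof -
  assume x: "x \<in> {a..b}"
  have "\<bar>G n x\<bar> \<le> sqrt \<bar>x - a\<bar> * B"
    using G_Hoelder[of n x a] by (simp add: G_def prim_left)
  also have "\<dots> \<le> sqrt (b - a) * B" using x B0 by (intro mult_right_mono) auto
  finally show ?thesis .
qed

text \<open>Almost everywhere \<open>c n\<close> is the difference of \<open>wh n\<close> and a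
  bounded primitive, and the \<open>L2\<close> norm of a constant is its modulus times
  \<open>sqrt (b - a)\<close>. An \<open>L2\<close> bound thus yields a pointwise one.\<close>

lemma c_bound: "\<bar>c n\<bar> * sqrt (b - a) \<le> A + (sqrt (b - a) * A) * sqrt (b - a)"
proof -
  define p where "p x = (-1) * prim a b (v n) x" for x
  have pL: "L2 I p" unfolding p_def using L2_cmult[OF _ L2_prim[OF ab vL[of n], of 0], of "-1"] by simp
  have "\<bar>c n\<bar> * sqrt (b - a) = L2norm I (\<lambda>x. c n)" using L2norm_const[OF ab] by simp
  also have "\<dots> \<le> L2norm I (\<lambda>x. wh n x + p x)"
  proof (rule L2norm_mono)
    show "AE x in M. \<bar>c n\<bar> \<le> \<bar>wh n x + p x\<bar>" using wh_W[of n] by eventually_elim (simp add: W_def p_def)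
  qed (intro L2_const L2_add whL pL Ioo_borel)+
  also have "\<dots> \<le> L2norm I (wh n) + L2norm I p" by (intro L2norm_triangle whL pL) simp
  also have "L2norm I p \<le> L2norm I (\<lambda>x. sqrt (b - a) * A)"
  proof (rule L2norm_mono)
    show "AE x in M. \<bar>p x\<bar> \<le> \<bar>sqrt (b - a) * A\<bar>"
    proof (rule AE_I2)
      fix x assume "x \<in> space M"
      then show "\<bar>p x\<bar> \<le> \<bar>sqrt (b - a) * A\<bar>" using prim_v_bound[of x n] by (simp add: p_def space_restrict_space)
    qed
  qed (intro pL L2_const Ioo_borel)+
  also have "L2norm I (\<lambda>x. sqrt (b - a) * A) = (sqrt (b - a) * A) * sqrt (b - a)"
    using L2norm_const[OF ab] A0 ab by (simp add: abs_mult)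
  finally show ?thesis using energy(2)[of n] by linarith
qed

text \<open>Arzela-Ascoli is applied to the pairs \<open>(W n, G n)\<close> as functions into the
  plane, so that one subsequence serves both components.\<close>

lemma compactness:
  obtains r W0 G0 where "strict_mono (r :: nat \<Rightarrow> nat)" "continuous_on {a..b} W0" "continuous_on {a..b} G0"
    "\<And>e. 0 < e \<Longrightarrow> \<exists>N. \<forall>n\<ge>N. \<forall>x\<in>{a..b}. \<bar>W (r n) x - W0 x\<bar> < e"
    "\<And>e. 0 < e \<Longrightarrow> \<exists>N. \<forall>n\<ge>N. \<forall>x\<in>{a..b}. \<bar>G (r n) x - G0 x\<bar> < e"
proof -
  define F where "F n x = (W n x, G n x)" for n x
  define Q where "Q = (A + (sqrt (b - a) * A) * sqrt (b - a)) / sqrt (b - a)"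
  have sab: "0 < sqrt (b - a)" using ab by simp
  have cb: "\<bar>c n\<bar> \<le> Q" for n using c_bound[of n] sab by (simp add: Q_def field_simps)
  have bound: "norm (F n x) \<le> (Q + sqrt (b - a) * A) + sqrt (b - a) * B" if "x \<in> {a..b}" for n x
  proof -
    have "norm (F n x) \<le> norm (W n x) + norm (G n x)" unfolding F_def by (rule norm_Pair_le)
    moreover have "\<bar>W n x\<bar> \<le> Q + sqrt (b - a) * A" using cb[of n] prim_v_bound[OF that, of n] unfolding W_def by linarith
    ultimately show ?thesis using G_bound[OF that, of n] by simp
  qed
  have equi: "\<exists>d. 0 < d \<and> (\<forall>n y. y \<in> {a..b} \<and> norm (x - y) < d \<longrightarrow> norm (F n x - F n y) < e)" if "0 < e" for x e
  proof -
    \<comment> \<open>Inverts the Hoelder modulus \<open>sqrt d * (A + B)\<close>; the added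
      \<open>1\<close> keeps the quotient defined when both constants vanish.\<close>
    define d where "d = (e / (A + B + 1))^2"
    have q: "0 < e / (A + B + 1)" using that A0 B0 by simp
    have d: "0 < d" unfolding d_def by (rule zero_less_power[OF q])
    moreover have "norm (F n x - F n y) < e" if "norm (x - y) < d" for n y
    proof -
      have "sqrt \<bar>x - y\<bar> < sqrt d" using that by simp
      also have "sqrt d = e / (A + B + 1)" unfolding d_def using real_sqrt_abs[of "e / (A + B + 1)"] abs_of_pos[OF q] by simp
      finally have s: "sqrt \<bar>x - y\<bar> < e / (A + B + 1)" .
      have "norm (F n x - F n y) \<le> norm (W n x - W n y) + norm (G n x - G n y)"
        unfolding F_def using norm_Pair_le[of "W n x - W n y" "G n x - G n y"] by simp
      also have "\<dots> \<le> sqrt \<bar>x - y\<bar> * A + sqrt \<bar>x - y\<bar> * B" using W_Hoelder[of n x y] G_Hoelder[of n x y] by simp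
      also have "\<dots> \<le> sqrt \<bar>x - y\<bar> * (A + B + 1)" by (simp add: algebra_simps)
      also have "\<dots> < e / (A + B + 1) * (A + B + 1)" using A0 B0 by (intro mult_strict_right_mono s) simp
      also have "\<dots> = e" using A0 B0 by simp
      finally show ?thesis .
    qed
    ultimately show ?thesis by blast
  qed
  obtain p r where p: "continuous_on {a..b} p" "strict_mono (r :: nat \<Rightarrow> nat)"
    "\<And>e. 0 < e \<Longrightarrow> \<exists>N. \<forall>n x. n \<ge> N \<and> x \<in> {a..b} \<longrightarrow> norm (F (r n) x - p x) < e"
    using Arzela_Ascoli[OF compact_Icc bound equi] by metis
  show ?thesis
  proof (rule that[OF p(2), of "\<lambda>x. fst (p x)" "\<lambda>x. snd (p x)"])
    show "continuous_on {a..b} (\<lambda>x. fst (p x))" "continuous_on {a..b} (\<lambda>x. snd (p x))"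
      by (intro continuous_intros p)+
    fix e :: real assume "0 < e"
    then obtain N where N: "\<And>n x. n \<ge> N \<Longrightarrow> x \<in> {a..b} \<Longrightarrow> norm (F (r n) x - p x) < e" using p(3) by blast
    have "\<bar>W (r n) x - fst (p x)\<bar> \<le> norm (F (r n) x - p x) \<and> \<bar>G (r n) x - snd (p x)\<bar> \<le> norm (F (r n) x - p x)" for n x
      using norm_fst_le[of "W (r n) x - fst (p x)" "G (r n) x - snd (p x)"]
        norm_snd_le[of "G (r n) x - snd (p x)" "W (r n) x - fst (p x)"]
      by (simp add: F_def minus_prod_def)
    then show "\<exists>N. \<forall>n\<ge>N. \<forall>x\<in>{a..b}. \<bar>W (r n) x - fst (p x)\<bar> < e" "\<exists>N. \<forall>n\<ge>N. \<forall>x\<in>{a..b}. \<bar>G (r n) x - snd (p x)\<bar> < e"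
      using N by (meson le_less_trans)+
  qed
qed

lemma kinv_bound: "x \<in> I \<Longrightarrow> 1 / \<kappa>2 \<le> 1 / k n x" "x \<in> I \<Longrightarrow> \<bar>1 / k n x\<bar> \<le> 1 / \<kappa>1"
  using kb[of x n] \<kappa>1 by (auto simp: frac_le)

lemma kinv_m: "(\<lambda>x. 1 / k n x) \<in> borel_measurable M" using km by simp

text \<open>Pointwise bounds survive weak limits. This makes the coefficient \<open>1 / P\<close>
  bounded, and division by \<open>P\<close> legitimate almost everywhere.\<close>

lemma P_lower_bound: "AE x in M. 1 / \<kappa>2 \<le> P x"
proof -
  have L: "L2 I (\<lambda>x. 1 / k n x)" for n
    by (rule L2_bounded[OF _ _ kinv_m kinv_bound(2)]) auto
  show "AE x in M. 1 / \<kappa>2 \<le> P x" by (rule weak_limit_lower_bound[OF PL L Pconv kinv_bound(1)])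
qed

lemma K_bounds: "AE x in M. \<kappa>1 \<le> K x" "AE x in M. K x \<le> \<kappa>2"
proof -
  have L: "L2 I (k n)" for n
    by (rule L2_bounded[OF _ _ km k_abs]) auto
  show "AE x in M. \<kappa>1 \<le> K x" by (rule weak_limit_lower_bound[OF KL L kconv]) (use kb in auto)
  show "AE x in M. K x \<le> \<kappa>2" by (rule weak_limit_upper_bound[OF KL L kconv]) (use kb in auto)
qed

lemma limit_unique:
  assumes "solves_limit a b P K f0 u" "solves_limit a b P K f0 u'"
  shows "AE x in M. u x = u' x" "AE x in M. wderiv I u x = wderiv I u' x"
proof -
  have m: "P \<in> borel_measurable M" "K \<in> borel_measurable M" using PL KL by (auto simp: L2_iff)
  have "0 < 1 / \<kappa>2" using \<kappa>1 \<kappa>2 by simp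
  note u = solves_limit_unique[OF m(1) P_lower_bound this m(2) K_bounds \<kappa>1 assms]
  show "AE x in M. u x = u' x" "AE x in M. wderiv I u x = wderiv I u' x" by (rule u)+
qed

text \<open>The indicators of \<open>{..x}\<close> are admissible weak test functions and turn weak
  limits into identities between primitives: \<open>W0\<close> becomes a primitive of
  \<open>P * G0\<close>, and \<open>G0\<close> one of \<open>K * W0 - f0\<close>. Dividing by
  \<open>P\<close> and integrating by parts recovers the weak form of the limit problem.\<close>

lemma subsequence_converges:
  obtains r u where "strict_mono (r :: nat \<Rightarrow> nat)" "solves_limit a b P K f0 u"
    "\<And>\<phi>. L2 I \<phi> \<Longrightarrow> (\<lambda>n. sint I (\<lambda>x. wh (r n) x * \<phi> x)) \<longlonglongrightarrow> sint I (\<lambda>x. u x * \<phi> x)"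
    "\<And>\<phi>. L2 I \<phi> \<Longrightarrow> (\<lambda>n. sint I (\<lambda>x. wderiv I (wh (r n)) x * \<phi> x)) \<longlonglongrightarrow> sint I (\<lambda>x. wderiv I u x * \<phi> x)"
    "(\<lambda>n. L2norm I (\<lambda>x. wh (r n) x - u x)) \<longlonglongrightarrow> 0"
proof -
  obtain r W0 G0 where r: "strict_mono (r :: nat \<Rightarrow> nat)" and c0: "continuous_on {a..b} W0" "continuous_on {a..b} G0"
    and uW: "\<And>e. 0 < e \<Longrightarrow> \<exists>N. \<forall>n\<ge>N. \<forall>x\<in>{a..b}. \<bar>W (r n) x - W0 x\<bar> < e"
    and uG: "\<And>e. 0 < e \<Longrightarrow> \<exists>N. \<forall>n\<ge>N. \<forall>x\<in>{a..b}. \<bar>G (r n) x - G0 x\<bar> < e"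
    using compactness by metis
  have pW: "(\<lambda>n. W (r n) x) \<longlonglongrightarrow> W0 x" and pG: "(\<lambda>n. G (r n) x) \<longlonglongrightarrow> G0 x" if "x \<in> {a..b}" for x
  proof -
    show "(\<lambda>n. W (r n) x) \<longlonglongrightarrow> W0 x"
    proof (rule LIMSEQ_I)
      fix e :: real assume "0 < e"
      from uW[OF this] show "\<exists>N. \<forall>n\<ge>N. norm (W (r n) x - W0 x) < e" using that by (auto simp del: atLeastAtMost_iff)
    qed
    show "(\<lambda>n. G (r n) x) \<longlonglongrightarrow> G0 x"
    proof (rule LIMSEQ_I)
      fix e :: real assume "0 < e"
      from uG[OF this] show "\<exists>N. \<forall>n\<ge>N. norm (G (r n) x - G0 x) < e" using that by (auto simp del: atLeastAtMost_iff)
    qed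
  qed
  have mult: "L2 I (\<lambda>x. q x * \<phi> x)" if "continuous_on {a..b} q" "L2 I \<phi>" for q \<phi>
  proof -
    have "bounded (q ` {a..b})" by (auto intro!: compact_imp_bounded compact_continuous_image that)
    then obtain C where C: "\<forall>x\<in>{a..b}. \<bar>q x\<bar> \<le> C" by (auto simp: bounded_iff)
    have "q \<in> borel_measurable M" by (intro continuous_on_measurable_lon continuous_on_subset[OF that(1)]) auto
    then show ?thesis by (rule L2_bounded_mult[OF Ioo_borel that(2), where C=C]) (use C in auto)
  qed
  have m: "wh n \<in> borel_measurable M" "v n \<in> borel_measurable M" "G n \<in> borel_measurable M" "W n \<in> borel_measurable M" for n
    using whL vL GL WL by (auto simp: L2_iff)
  have vG: "AE x in M. v n x = 1 / k n x * G n x" for n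
    using flux[of n] AE_space
  proof eventually_elim
    case (elim x)
    then have "k n x \<noteq> 0" using kb[of x n] \<kappa>1 by (auto simp: space_restrict_space)
    then show ?case using elim(1)[symmetric] by simp
  qed
  have cG: "(\<lambda>n. sint I (\<lambda>x. 1 / k (r n) x * (G (r n) x * \<phi> x))) \<longlonglongrightarrow> sint I (\<lambda>x. P x * (G0 x * \<phi> x))" if "L2 I \<phi>" for \<phi>
    by (rule weak_times_uniform[OF ab kinv_m kinv_bound(2) _ G_cont c0(2) uG that])
      (use LIMSEQ_subseq_LIMSEQ[OF Pconv r] in \<open>auto simp: o_def\<close>)
  have cW: "(\<lambda>n. sint I (\<lambda>x. k (r n) x * (W (r n) x * \<phi> x))) \<longlonglongrightarrow> sint I (\<lambda>x. K x * (W0 x * \<phi> x))" if "L2 I \<phi>" for \<phi>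
    by (rule weak_times_uniform[OF ab km k_abs _ W_cont c0(1) uW that])
      (use LIMSEQ_subseq_LIMSEQ[OF kconv r] in \<open>auto simp: o_def\<close>)
  have cW1: "(\<lambda>n. sint I (\<lambda>x. 1 * (W (r n) x * \<phi> x))) \<longlonglongrightarrow> sint I (\<lambda>x. 1 * (W0 x * \<phi> x))" if "L2 I \<phi>" for \<phi>
    by (rule weak_times_uniform[OF ab _ _ _ W_cont c0(1) uW that, where Q=1]) auto
  have v_eq: "sint I (\<lambda>x. v n x * \<phi> x) = sint I (\<lambda>x. 1 / k n x * (G n x * \<phi> x))" if "L2 I \<phi>" for n \<phi>
    unfolding sint_lon[OF Ioo_borel]
  proof (rule integral_cong_AE)
    show "AE x in M. v n x * \<phi> x = 1 / k n x * (G n x * \<phi> x)" using vG[of n] by eventually_elim simp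
    have "\<phi> \<in> borel_measurable M" using that by (simp add: L2_iff)
    then show "(\<lambda>x. v n x * \<phi> x) \<in> borel_measurable M" "(\<lambda>x. 1 / k n x * (G n x * \<phi> x)) \<in> borel_measurable M"
      using m km by auto
  qed
  define PG where "PG x = P x * G0 x" for x
  have PGL: "L2 I PG" unfolding PG_def using mult[OF c0(2) PL] by (simp add: mult.commute)
  \<comment> \<open>Defined as a primitive, \<open>u\<close> has the known weak derivative
    \<open>P * G0\<close>; that it coincides with the uniform limit \<open>W0\<close> is shown
    next.\<close>
  define u where "u x = W0 a + prim a b PG x" for x
  have ind: "L2 I (indicator {..x})" for x :: real by (rule L2_indicator_atMost)
  \<comment> \<open>The increment of \<open>W n\<close> from \<open>a\<close> to \<open>x\<close> is
    the integral of \<open>v n\<close> against \<open>indicator {..x}\<close>, and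
    \<open>v n = G n / k n\<close> has a weak limit because \<open>G n\<close> converges
    uniformly.\<close>
  have uW0: "u x = W0 x" if x: "x \<in> {a..b}" for x
  proof -
    have "(\<lambda>n. W (r n) x - W (r n) a) \<longlonglongrightarrow> W0 x - W0 a" using ab x by (intro tendsto_diff pW) auto
    moreover have "W n x - W n a = sint I (\<lambda>t. v n t * indicator {..x} t)" for n
      by (simp add: W_def prim_left) (simp add: prim_def sint_lon mult.commute)
    moreover have "(\<lambda>n. sint I (\<lambda>t. v (r n) t * indicator {..x} t)) \<longlonglongrightarrow> sint I (\<lambda>t. P t * (G0 t * indicator {..x} t))"
      unfolding v_eq[OF ind] by (rule cG[OF ind])
    ultimately have "W0 x - W0 a = sint I (\<lambda>t. P t * (G0 t * indicator {..x} t))" using LIMSEQ_unique by auto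
    also have "\<dots> = prim a b PG x" by (simp add: prim_def sint_lon PG_def ac_simps)
    finally show ?thesis by (simp add: u_def)
  qed
  define g0 where "g0 x = K x * u x - f0 x" for x
  have u_cont: "continuous_on S u" for S unfolding u_def by (intro continuous_intros prim_continuous[OF ab PGL])
  have KuL: "L2 I (\<lambda>x. K x * u x)" using mult[OF u_cont KL] by (simp add: mult.commute)
  have g0L: "L2 I g0" unfolding g0_def by (intro L2_diff KuL f0L) simp
  have g0i: "integrable M g0" using g0L by (auto intro: L2_integrable)
  \<comment> \<open>\<open>G n x\<close> is likewise the integral of \<open>k n * wh n - h n\<close>
    against the indicator; replacing \<open>wh n\<close> by \<open>W n\<close> makes the product of
    a weakly and a uniformly convergent factor.\<close>
  have G0p: "G0 x = prim a b g0 x" if x: "x \<in> {a..b}" for x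
  proof -
    have "(\<lambda>n. sint I (\<lambda>t. k (r n) t * (W (r n) t * indicator {..x} t)) - sint I (\<lambda>t. h (r n) t * indicator {..x} t))
      \<longlonglongrightarrow> sint I (\<lambda>t. K t * (W0 t * indicator {..x} t)) - sint I (\<lambda>t. f0 t * indicator {..x} t)"
      using LIMSEQ_subseq_LIMSEQ[OF hconv[OF ind] r] by (intro tendsto_diff cW[OF ind]) (simp add: o_def)
    moreover have "sint I (\<lambda>t. k n t * (W n t * indicator {..x} t)) - sint I (\<lambda>t. h n t * indicator {..x} t) = G n x" for n
    proof -
      have "sint I (\<lambda>t. k n t * (W n t * indicator {..x} t)) = sint I (\<lambda>t. (k n t * wh n t) * indicator {..x} t)"
        unfolding sint_lon[OF Ioo_borel]
      proof (rule integral_cong_AE)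
        show "AE t in M. k n t * (W n t * indicator {..x} t) = (k n t * wh n t) * indicator {..x} t"
          using wh_W[of n] by eventually_elim simp
        have "indicator {..x} \<in> borel_measurable M" using ind[of x] by (simp add: L2_iff)
        then show "(\<lambda>t. k n t * (W n t * indicator {..x} t)) \<in> borel_measurable M"
          "(\<lambda>t. (k n t * wh n t) * indicator {..x} t) \<in> borel_measurable M" using m km by auto
      qed
      then show ?thesis
        using L2_mult_integrable[OF _ kL[OF whL[of n], of n] ind[of x]] L2_mult_integrable[OF _ hL[of n] ind[of x]]
        by (simp add: G_def prim_def g_def sint_lon right_diff_distrib mult.commute)
    qed
    ultimately have "(\<lambda>n. G (r n) x) \<longlonglongrightarrow> sint I (\<lambda>t. K t * (W0 t * indicator {..x} t)) - sint I (\<lambda>t. f0 t * indicator {..x} t)" by simp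
    then have "G0 x = sint I (\<lambda>t. K t * (W0 t * indicator {..x} t)) - sint I (\<lambda>t. f0 t * indicator {..x} t)"
      using LIMSEQ_unique pG[OF x] by blast
    also have "sint I (\<lambda>t. K t * (W0 t * indicator {..x} t)) = sint I (\<lambda>t. (K t * u t) * indicator {..x} t)"
      unfolding sint_lon[OF Ioo_borel] by (rule integral_lon_cong) (auto simp: uW0)
    also have "\<dots> - sint I (\<lambda>t. f0 t * indicator {..x} t) = prim a b g0 x"
      using L2_mult_integrable[OF _ KuL ind[of x]] L2_mult_integrable[OF _ f0L ind[of x]]
      by (simp add: prim_def g0_def sint_lon right_diff_distrib mult.commute)
    finally show ?thesis .
  qed
  \<comment> \<open>The Neumann condition at \<open>b\<close>, that is \<open>G n b = 0\<close> for
    all \<open>n\<close>, passes to the limit pointwise.\<close>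
  have g0m: "integral\<^sup>L M g0 = 0"
  proof -
    have "G n b = 0" for n using g_mean[of n] by (simp add: G_def prim_top)
    moreover have "(\<lambda>n. G (r n) b) \<longlonglongrightarrow> G0 b" by (rule pG) (use ab in auto)
    ultimately have "G0 b = 0" by (simp add: LIMSEQ_const_iff)
    then show ?thesis using G0p[of b] ab by (simp add: prim_top)
  qed
  have uH: "H1_1 I u" "AE x in M. wderiv I u x = PG x"
    unfolding u_def using H1_1_prim[OF ab PGL, of "W0 a"] by auto
  note uW' = H1_1_wderiv[OF uH(1)]
  have sol: "solves_limit a b P K f0 u" unfolding solves_limit_def
  proof (intro conjI allI impI uH(1))
    fix \<phi> assume H: "H1_1 I \<phi>"
    define \<psi> where "\<psi> = wderiv I \<phi>"
    note F = H1_1_wderiv[OF H, folded \<psi>_def]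
    obtain d where d: "AE x in M. \<phi> x = d + prim a b \<psi> x" using is_wderiv_imp_prim[OF ab F] by metis
    have \<psi>i: "integrable M \<psi>" using F(2) by (auto intro: L2_integrable)
    have G0L: "L2 I G0" using mult[OF c0(2) L2_const[of _ _ 1]] by simp
    have mm: "P \<in> borel_measurable M" "\<psi> \<in> borel_measurable M" "\<phi> \<in> borel_measurable M" "K \<in> borel_measurable M"
      "u \<in> borel_measurable M" "wderiv I u \<in> borel_measurable M" "G0 \<in> borel_measurable M" "f0 \<in> borel_measurable M" "g0 \<in> borel_measurable M"
      "prim a b \<psi> \<in> borel_measurable M"
      using PL F KL uW' G0L f0L g0L L2_prim[OF ab F(2), of 0] by (auto simp: L2_iff)
    have pos: "0 < 1 / \<kappa>2" using \<kappa>1 \<kappa>2 by simp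
    \<comment> \<open>The coefficient cancels: \<open>1 / P\<close> times the weak derivative of
      \<open>u\<close> is \<open>G0\<close>, the primitive of \<open>g0\<close>.\<close>
    have "sint I (\<lambda>x. 1 / P x * wderiv I u x * \<psi> x + K x * u x * \<phi> x) = integral\<^sup>L M (\<lambda>x. (\<psi> x * prim a b g0 x + g0 x * \<phi> x) + f0 x * \<phi> x)"
      unfolding sint_lon[OF Ioo_borel]
    proof (rule integral_cong_AE)
      show "AE x in M. 1 / P x * wderiv I u x * \<psi> x + K x * u x * \<phi> x = (\<psi> x * prim a b g0 x + g0 x * \<phi> x) + f0 x * \<phi> x"
        using uH(2) P_lower_bound AE_space
      proof eventually_elim
        case (elim x)
        then have "P x \<noteq> 0" and x: "x \<in> I" using pos by (auto simp: space_restrict_space)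
        then have "1 / P x * wderiv I u x = prim a b g0 x" using elim(1) G0p[of x] by (simp add: PG_def)
        then show ?case by (simp add: g0_def algebra_simps)
      qed
      have "prim a b g0 \<in> borel_measurable M" using L2_prim[OF ab g0L, of 0] by (simp add: L2_iff)
      then show "(\<lambda>x. (\<psi> x * prim a b g0 x + g0 x * \<phi> x) + f0 x * \<phi> x) \<in> borel_measurable M" using mm by auto
    qed (use mm in auto)
    also have "\<dots> = (integral\<^sup>L M (\<lambda>x. \<psi> x * prim a b g0 x) + integral\<^sup>L M (\<lambda>x. g0 x * \<phi> x)) + integral\<^sup>L M (\<lambda>x. f0 x * \<phi> x)"
      using L2_mult_integrable[OF _ F(2) L2_prim[OF ab g0L, of 0]] L2_mult_integrable[OF _ g0L F(1)] L2_mult_integrable[OF _ f0L F(1)]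
      by simp
    \<comment> \<open>Only the primitive part of \<open>\<phi>\<close> counts: its constant
      \<open>d\<close> meets the mean of \<open>g0\<close>, which is zero.\<close>
    also have "integral\<^sup>L M (\<lambda>x. g0 x * \<phi> x) = integral\<^sup>L M (\<lambda>x. d * g0 x + g0 x * prim a b \<psi> x)"
      by (rule integral_cong_AE) (use d mm in \<open>auto simp: algebra_simps\<close>)
    also have "\<dots> = integral\<^sup>L M (\<lambda>x. g0 x * prim a b \<psi> x)"
      using L2_mult_integrable[OF _ g0L L2_prim[OF ab F(2), of 0]] g0i g0m by simp
    also have "integral\<^sup>L M (\<lambda>x. \<psi> x * prim a b g0 x) + integral\<^sup>L M (\<lambda>x. g0 x * prim a b \<psi> x) = 0"
      using prim_parts[OF g0i \<psi>i] g0m by simp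
    finally show "sint I (\<lambda>x. 1 / P x * wderiv I u x * wderiv I \<phi> x + K x * u x * \<phi> x) = sint I (\<lambda>x. f0 x * \<phi> x)"
      unfolding \<psi>_def by (simp add: sint_lon)
  qed
  show ?thesis
  proof (rule that[OF r sol])
    fix \<phi> assume L: "L2 I \<phi>"
    have pm: "\<phi> \<in> borel_measurable M" using L by (simp add: L2_iff)
    have "sint I (\<lambda>x. wh n x * \<phi> x) = sint I (\<lambda>x. 1 * (W n x * \<phi> x))" for n
      unfolding sint_lon[OF Ioo_borel]
      by (rule integral_cong_AE) (use wh_W[of n] m pm in auto)
    moreover have "sint I (\<lambda>x. u x * \<phi> x) = sint I (\<lambda>x. 1 * (W0 x * \<phi> x))"
      unfolding sint_lon[OF Ioo_borel]
      by (rule integral_lon_cong) (auto simp: uW0)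
    ultimately show "(\<lambda>n. sint I (\<lambda>x. wh (r n) x * \<phi> x)) \<longlonglongrightarrow> sint I (\<lambda>x. u x * \<phi> x)" using cW1[OF L] by simp
    have "sint I (\<lambda>x. wderiv I u x * \<phi> x) = sint I (\<lambda>x. P x * (G0 x * \<phi> x))"
      unfolding sint_lon[OF Ioo_borel]
    proof (rule integral_cong_AE)
      show "AE x in M. wderiv I u x * \<phi> x = P x * (G0 x * \<phi> x)" using uH(2) by eventually_elim (simp add: PG_def)
      have "G0 \<in> borel_measurable M" by (intro continuous_on_measurable_lon continuous_on_subset[OF c0(2)]) auto
      then show "(\<lambda>x. P x * (G0 x * \<phi> x)) \<in> borel_measurable M" using PL pm by (auto simp: L2_iff)
      show "(\<lambda>x. wderiv I u x * \<phi> x) \<in> borel_measurable M" using uW'(2) pm by (auto simp: L2_iff)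
    qed
    then show "(\<lambda>n. sint I (\<lambda>x. wderiv I (wh (r n)) x * \<phi> x)) \<longlonglongrightarrow> sint I (\<lambda>x. wderiv I u x * \<phi> x)"
      using cG[OF L] v_eq[OF L] unfolding v_def by simp
  next
    show "(\<lambda>n. L2norm I (\<lambda>x. wh (r n) x - u x)) \<longlonglongrightarrow> 0"
    proof (rule LIMSEQ_I)
      fix e :: real assume e: "0 < e"
      have sab: "0 < sqrt (b - a)" using ab by simp
      \<comment> \<open>A uniform error \<open>e'\<close> on an interval of length
        \<open>b - a\<close> has \<open>L2\<close> norm \<open>e' * sqrt (b - a) = e / 2\<close>,
        strictly below \<open>e\<close>.\<close>
      define e' where "e' = e / (2 * sqrt (b - a))"
      have e': "0 < e'" using e sab by (simp add: e'_def)
      obtain N where N: "\<forall>n\<ge>N. \<forall>x\<in>{a..b}. \<bar>W (r n) x - W0 x\<bar> < e'" using uW[OF e'] by blast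
      have "norm (L2norm I (\<lambda>x. wh (r n) x - u x) - 0) < e" if "N \<le> n" for n
      proof -
        have "L2norm I (\<lambda>x. wh (r n) x - u x) \<le> L2norm I (\<lambda>x. e')"
        proof (rule L2norm_mono)
          show "L2 I (\<lambda>x. wh (r n) x - u x)" by (intro L2_diff whL uW') simp
          show "AE x in M. \<bar>wh (r n) x - u x\<bar> \<le> \<bar>e'\<bar>" using wh_W[of "r n"] AE_space
          proof eventually_elim
            case (elim x)
            then have x: "x \<in> {a..b}" by (simp add: space_restrict_space)
            then have "\<bar>W (r n) x - W0 x\<bar> < e'" using N that by blast
            then show ?case using elim(1) uW0[OF x] by simp
          qed
        qed (auto intro: L2_const)
        also have "\<dots> = e / 2" using L2norm_const[OF ab, of e'] e e' sab by (simp add: e'_def)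
        finally show ?thesis using e L2norm_nonneg[of I "\<lambda>x. wh (r n) x - u x"] by simp
      qed
      then show "\<exists>N. \<forall>n\<ge>N. norm (L2norm I (\<lambda>x. wh (r n) x - u x) - 0) < e" by blast
    qed
  qed
qed

end

subsection \<open>Uniform estimates\<close>

text \<open>Duality: pairing the fibre integral \<open>q\<close> with itself is pairing
  \<open>f\<close> with \<open>q\<close> on the strip. There \<open>q\<close>, a function of
  \<open>x\<close>, has norm at most \<open>sqrt \<tau>\<close> times its norm on \<open>I\<close>,
  and one factor \<open>L2norm I q\<close> cancels.\<close>

lemma (in thin_domain) L2norm_fint_strip:
  assumes th: "\<theta> \<in> sets borel" and tau: "\<And>x. x \<in> I \<Longrightarrow> fint (indicator \<theta>) x \<le> \<tau>" and tau0: "0 \<le> \<tau>"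
    and f: "L2 R f"
  shows "L2 I (fint (\<lambda>z. indicator \<theta> z * f z))"
    "L2norm I (fint (\<lambda>z. indicator \<theta> z * f z)) \<le> sqrt \<tau> * L2norm (\<theta> \<inter> R) f"
proof -
  define q where "q = fint (\<lambda>z. indicator \<theta> z * f z)"
  have thf: "L2 R (\<lambda>p. indicator \<theta> p * f p)"
    by (rule L2_bounded_mult[OF R_borel f, where C=1]) (use th in \<open>auto split: split_indicator intro!: measurable_restrict_space1\<close>)
  show qL: "L2 I (fint (\<lambda>z. indicator \<theta> z * f z))" by (rule L2_fint[OF thf])
  have T: "\<theta> \<inter> R \<in> sets borel" "\<theta> \<inter> R \<subseteq> R" using th by auto
  have qT: "L2 (\<theta> \<inter> R) (\<lambda>p. q (fst p))" and qle: "sint (\<theta> \<inter> R) (\<lambda>p. (q (fst p))^2) \<le> \<tau> * sint I (\<lambda>x. (q x)^2)"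
    unfolding q_def using sint_strip_fst_le[OF th tau qL] by auto
  have i: "integrable (lon R) (\<lambda>p. (indicator \<theta> p * f p) * q (fst p))"
    unfolding q_def by (rule L2_mult_integrable[OF R_borel thf L2_fst(1)[OF qL]])
  have "(L2norm I q)^2 = integral\<^sup>L (lon I) (fint (\<lambda>p. (indicator \<theta> p * f p) * q (fst p)))"
    unfolding L2norm_square sint_lon[OF Ioo_borel]
    by (rule integral_lon_cong) (auto simp: fint_def q_def power2_eq_square)
  also have "\<dots> = sint (\<theta> \<inter> R) (\<lambda>p. f p * q (fst p))"
    unfolding fubini_R(3)[OF i, symmetric] sint_Int sint_lon[OF R_borel] by (simp add: mult.assoc)
  also have "\<dots> \<le> L2norm (\<theta> \<inter> R) f * L2norm (\<theta> \<inter> R) (\<lambda>p. q (fst p))"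
    using L2_Cauchy_Schwarz[OF T(1) L2_subset[OF R_borel T f] qT] by linarith
  also have "\<dots> \<le> L2norm (\<theta> \<inter> R) f * (sqrt \<tau> * L2norm I q)"
  proof (rule mult_left_mono[OF _ L2norm_nonneg])
    show "L2norm (\<theta> \<inter> R) (\<lambda>p. q (fst p)) \<le> sqrt \<tau> * L2norm I q"
      using real_sqrt_le_mono[OF qle] by (simp add: L2norm_def real_sqrt_mult)
  qed
  finally have le: "L2norm I q * L2norm I q \<le> (sqrt \<tau> * L2norm (\<theta> \<inter> R) f) * L2norm I q"
    by (simp add: power2_eq_square ac_simps)
  show "L2norm I (fint (\<lambda>z. indicator \<theta> z * f z)) \<le> sqrt \<tau> * L2norm (\<theta> \<inter> R) f"
  proof (cases "L2norm I q = 0")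
    case True
    then show ?thesis using tau0 L2norm_nonneg[of "\<theta> \<inter> R" f] by (simp add: q_def)
  next
    case False
    then have "0 < L2norm I q" using L2norm_nonneg[of I q] by linarith
    then show ?thesis using le unfolding q_def[symmetric] by (simp only: mult_le_cancel_right)
  qed
qed

text \<open>The subsequence principle: if convergence failed, some sequence would stay a fixed
  distance away from \<open>L\<close>, and so would all its subsequences. Parameters may be confined
  to values below \<open>1\<close>, where the hypotheses hold.\<close>

lemma tendsto_at_right_subsequence:
  fixes X :: "real \<Rightarrow> real"
  assumes "\<And>S. (\<And>n. 0 < S n \<and> S n < 1) \<Longrightarrow> S \<longlonglongrightarrow> 0 \<Longrightarrow> \<exists>r. strict_mono (r :: nat \<Rightarrow> nat) \<and> (\<lambda>n. X (S (r n))) \<longlonglongrightarrow> L"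
  shows "(X \<longlongrightarrow> L) (at_right 0)"
proof (rule tendsto_at_right_sequentially[of 0 1])
  fix S :: "nat \<Rightarrow> real" assume S: "\<And>n. 0 < S n" "\<And>n. S n < 1" "S \<longlonglongrightarrow> 0"
  show "(\<lambda>n. X (S n)) \<longlonglongrightarrow> L"
  proof (rule ccontr)
    assume "\<not> (\<lambda>n. X (S n)) \<longlonglongrightarrow> L"
    then obtain e where e: "0 < e" "\<not> eventually (\<lambda>n. dist (X (S n)) L < e) sequentially"
      unfolding tendsto_iff by blast
    from not_eventually_sequentiallyD[OF e(2)] obtain s :: "nat \<Rightarrow> nat"
      where s: "strict_mono s" "\<And>n. \<not> dist (X (S (s n))) L < e" by blast
    have "(\<lambda>n. S (s n)) \<longlonglongrightarrow> 0" using LIMSEQ_subseq_LIMSEQ[OF S(3) s(1)] by (simp add: o_def)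
    then obtain r :: "nat \<Rightarrow> nat" where "(\<lambda>n. X (S (s (r n)))) \<longlonglongrightarrow> L"
      using assms[of "\<lambda>n. S (s n)"] S(1,2) by blast
    then have "eventually (\<lambda>n. dist (X (S (s (r n)))) L < e) sequentially" using e(1) unfolding tendsto_iff by blast
    then show False using s(2) by simp
  qed
qed simp

lemma C1_on_continuous: "C1_on T q \<Longrightarrow> continuous_on T q"
  unfolding C1_on_def by (blast intro: DERIV_continuous_on)

text \<open>A supremum of reals is informative only for sets bounded above; boundedness comes from
  the continuous extension of the derivative to the closed interval.\<close>

lemma abs_deriv_le_SUP:
  assumes k: "continuous_on {a..b} k'" "\<And>x. x \<in> {a..b} \<Longrightarrow> (k has_real_derivative k' x) (at x within {a..b})"
    and x: "x \<in> {a<..<b}"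
  shows "\<bar>k' x\<bar> \<le> (SUP x\<in>{a<..<b}. \<bar>deriv k x\<bar>)"
proof -
  have d: "deriv k t = k' t" if "t \<in> {a<..<b}" for t
    using k(2)[of t] that by (intro DERIV_imp_deriv) (simp add: at_within_Icc_at)
  have "bounded (k' ` {a..b})" by (auto intro!: compact_imp_bounded compact_continuous_image k)
  then obtain C where C: "\<forall>x\<in>{a..b}. \<bar>k' x\<bar> \<le> C" by (auto simp: bounded_iff)
  have "bdd_above ((\<lambda>x. \<bar>deriv k x\<bar>) ` {a<..<b})" by (rule bdd_aboveI2[of _ _ C]) (use C d in auto)
  from cSUP_upper[OF x this] show ?thesis using d[OF x] by simp
qed

text \<open>The data at one fixed \<open>\<epsilon>\<close>, so that the resulting estimates show
  their dependence on \<open>\<epsilon>\<close> explicitly and no limit is involved.\<close>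

locale thin_problem =
  fixes a b \<gamma> \<epsilon> :: real and k1 k2 H :: "real \<Rightarrow> real" and f w :: "real \<times> real \<Rightarrow> real" and wh :: "real \<Rightarrow> real"
    and C11 C12 C21 C22 H0 H1 c :: real
  assumes ab: "a < b" and eps: "0 < \<epsilon>"
    and C1: "C1_on {a..b} k1" "C1_on {a..b} k2"
    and C: "0 < C11" "0 < C21"
    and kb: "\<And>x. x \<in> {a..b} \<Longrightarrow> C11 \<le> k1 x \<and> k1 x \<le> C12 \<and> C21 \<le> k2 x \<and> k2 x \<le> C22"
    and HC: "C1_on {a..b} H" and HH: "0 \<le> H0" and Hb: "\<And>x. x \<in> {a..b} \<Longrightarrow> H0 \<le> H x \<and> H x \<le> H1"
    and fL: "L2 (Rdom a b \<epsilon> k1 k2) f"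
    and F: "\<epsilon> powr (-\<gamma>) * (rnorm_L2 \<epsilon> (theta a b \<gamma> \<epsilon> k2 H \<inter> Rdom a b \<epsilon> k1 k2) f)^2 \<le> c"
    and wsol: "H1_2 (Rdom a b \<epsilon> k1 k2) w \<and>
       (\<forall>\<phi>. H1_2 (Rdom a b \<epsilon> k1 k2) \<phi> \<longrightarrow>
          sint (Rdom a b \<epsilon> k1 k2)
            (\<lambda>z. fst (wgrad (Rdom a b \<epsilon> k1 k2) w) z * fst (wgrad (Rdom a b \<epsilon> k1 k2) \<phi>) z
                 + snd (wgrad (Rdom a b \<epsilon> k1 k2) w) z * snd (wgrad (Rdom a b \<epsilon> k1 k2) \<phi>) z
                 + w z * \<phi> z)
          = \<epsilon> powr (-\<gamma>) * sint (theta a b \<gamma> \<epsilon> k2 H \<inter> Rdom a b \<epsilon> k1 k2) (\<lambda>z. f z * \<phi> z))"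
    and whsol: "H1_1 {a<..<b} wh \<and>
       (\<forall>\<phi>. H1_1 {a<..<b} \<phi> \<longrightarrow>
          sint {a<..<b} (\<lambda>x. (k1 x + k2 x) * wderiv {a<..<b} wh x * wderiv {a<..<b} \<phi> x
                            + (k1 x + k2 x) * wh x * \<phi> x)
          = \<epsilon> powr (-\<gamma>) * sint {a<..<b} (\<lambda>x. (k1 x + k2 x)
               * (1 / (\<epsilon> * (k1 x + k2 x)) * sint {-\<epsilon> * k1 x<..<\<epsilon> * k2 x}
                    (\<lambda>y. indicator (theta a b \<gamma> \<epsilon> k2 H) (x,y) * f (x,y)))
               * \<phi> x))"
begin

text \<open>In the reduced equation the weight \<open>k1 + k2\<close> cancels against the one in the
  mean, and \<open>\<epsilon> powr (-\<gamma>)\<close> merges with the remaining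
  \<open>1 / \<epsilon>\<close>; hence the exponent. This is also the function whose weak limit is
  \<open>f0\<close>.\<close>

definition h where "h x = \<epsilon> powr (-(\<gamma>+1)) * sint {-\<epsilon> * k1 x<..<\<epsilon> * k2 x}
          (\<lambda>y. indicator (theta a b \<gamma> \<epsilon> k2 H) (x,y) * f (x,y))"

text \<open>The sum dominates the slopes of both boundary curves, and tends to zero directly by the
  two limits in (H.1).\<close>

definition \<delta> where "\<delta> = \<epsilon> * (SUP x\<in>{a<..<b}. \<bar>deriv k1 x\<bar>) + \<epsilon> * (SUP x\<in>{a<..<b}. \<bar>deriv k2 x\<bar>)"

abbreviation "bound \<equiv> sqrt (c * H1) * (\<delta> / sqrt (C11 + C21) + 2 * \<epsilon> * sqrt (C12 + C22))"

lemma k_measurable: "(\<lambda>x. k1 x + k2 x) \<in> borel_measurable (lon {a<..<b})"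
  by (intro continuous_on_measurable_lon continuous_on_add continuous_on_subset[OF C1_on_continuous[OF C1(1)]]
      continuous_on_subset[OF C1_on_continuous[OF C1(2)]]) auto

lemma k_pos: "x \<in> {a..b} \<Longrightarrow> 0 < k1 x + k2 x"
  using kb[of x] C by linarith

text \<open>Everything that is used for a single \<open>\<epsilon>\<close>, proved together because
  all parts share one interpretation of \<open>thin_domain\<close> and the same constants.\<close>

lemma estimates:
  shows h_L2: "L2 {a<..<b} h" and h_bound: "L2norm {a<..<b} h \<le> sqrt (c * H1)"
    and h_equation: "H1_1 {a<..<b} \<phi> \<Longrightarrow> sint {a<..<b} (\<lambda>x. (k1 x + k2 x) * wderiv {a<..<b} wh x * wderiv {a<..<b} \<phi> x
                            + (k1 x + k2 x) * wh x * \<phi> x) = sint {a<..<b} (\<lambda>x. h x * \<phi> x)"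
    and distance: "L2 {a<..<b} u \<Longrightarrow> rnorm_L2 \<epsilon> (Rdom a b \<epsilon> k1 k2) (\<lambda>z. w z - u (fst z))
       \<le> bound + sqrt (C12 + C22) * L2norm {a<..<b} (\<lambda>x. wh x - u x)"
proof -
  obtain k1' where k1': "continuous_on {a..b} k1'" "\<And>x. x \<in> {a..b} \<Longrightarrow> (k1 has_real_derivative k1' x) (at x within {a..b})"
    using C1(1) unfolding C1_on_def by blast
  obtain k2' where k2': "continuous_on {a..b} k2'" "\<And>x. x \<in> {a..b} \<Longrightarrow> (k2 has_real_derivative k2' x) (at x within {a..b})"
    using C1(2) unfolding C1_on_def by blast
  define l where "l x = - \<epsilon> * k1 x" for x
  define m where "m x = \<epsilon> * k2 x" for x
  \<comment> \<open>The factor \<open>\<epsilon>\<close> is harmless: \<open>c0\<close> only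
    guarantees a common interval in all fibres and enters no estimate below.\<close>
  define c0 where "c0 = \<epsilon> * min C11 C21"
  interpret T: thin_domain a b c0 l m "\<lambda>x. - \<epsilon> * k1' x" "\<lambda>x. \<epsilon> * k2' x"
  proof
    show "a < b" "0 < c0" using ab C eps by (auto simp: c0_def)
    fix x assume x: "x \<in> {a..b}"
    have "\<epsilon> * min C11 C21 \<le> \<epsilon> * k1 x" "\<epsilon> * min C11 C21 \<le> \<epsilon> * k2 x" using kb[OF x] eps by (auto intro!: mult_left_mono)
    then show "l x \<le> - c0" "c0 \<le> m x" by (auto simp: l_def m_def c0_def)
    show "(l has_real_derivative - \<epsilon> * k1' x) (at x within {a..b})" unfolding l_def
      by (rule DERIV_cmult[OF k1'(2)[OF x]])
    show "(m has_real_derivative \<epsilon> * k2' x) (at x within {a..b})" unfolding m_def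
      by (rule DERIV_cmult[OF k2'(2)[OF x]])
  next
    show "continuous_on {a..b} (\<lambda>x. - \<epsilon> * k1' x)" "continuous_on {a..b} (\<lambda>x. \<epsilon> * k2' x)"
      by (intro continuous_intros k1' k2')+
  qed
  let ?I = "{a<..<b}"
  have R: "Rdom a b \<epsilon> k1 k2 = T.R" by (simp add: Rdom_def T.R_def l_def m_def)
  have D: "T.D x = \<epsilon> * (k1 x + k2 x)" for x by (simp add: T.D_def l_def m_def algebra_simps)
  define \<theta> where "\<theta> = theta a b \<gamma> \<epsilon> k2 H"
  \<comment> \<open>The common scale of the problem: the strip has thickness \<open>p * H x\<close>,
    and (F) says that the squared norm of \<open>f\<close> on it is at most
    \<open>c * p\<close>.\<close>
  define p where "p = \<epsilon> powr (\<gamma> + 1)"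
  have p: "0 < p" using eps by (simp add: p_def)
  have pe: "\<epsilon> powr \<gamma> * \<epsilon> = p" using eps by (simp add: p_def powr_add)
  have pm: "\<epsilon> powr (-(\<gamma>+1)) = 1 / p" unfolding p_def by (rule powr_minus_divide)
  have pg: "\<epsilon> powr (-\<gamma>) = \<epsilon> / p" using pe p eps by (simp add: powr_minus_divide field_simps)
  have ph: "(\<epsilon> powr (-1/2)) = 1 / sqrt \<epsilon>" using eps by (simp add: powr_minus_divide powr_half_sqrt)
  have th: "\<theta> \<in> sets borel"
  proof -
    have "continuous_on ?I k2" "continuous_on ?I H"
      by (rule continuous_on_subset[OF C1_on_continuous[OF C1(2)]], force, rule continuous_on_subset[OF C1_on_continuous[OF HC]], force)
    then have "open \<theta>" unfolding \<theta>_def theta_def by (intro open_between_graphs continuous_intros)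
    then show ?thesis by simp
  qed
  \<comment> \<open>The fibre length of \<open>theta\<close> is
    \<open>\<epsilon> * \<epsilon> powr \<gamma> * H x\<close>. As the strip may protrude below the
    domain, this is only an upper bound for the length inside it.\<close>
  define \<tau> where "\<tau> = p * H1"
  have H10: "0 \<le> H1" using Hb[of a] HH ab by auto
  have tau0: "0 \<le> \<tau>" using p H10 by (simp add: \<tau>_def)
  have tau: "T.fint (indicator \<theta>) x \<le> \<tau>" if x: "x \<in> ?I" for x
  proof -
    let ?lo = "\<epsilon> * (k2 x - \<epsilon> powr \<gamma> * H x)" and ?hi = "\<epsilon> * k2 x"
    have Hx: "0 \<le> H x" "H x \<le> H1" using Hb[of x] HH x by auto
    have d: "?hi - ?lo = p * H x" unfolding pe[symmetric] by (simp add: algebra_simps)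
    have le: "?lo \<le> ?hi" using d p Hx(1) by (smt (verit) mult_nonneg_nonneg)
    have "T.fint (indicator \<theta>) x = (\<integral>y. indicator T.R (x,y) * indicator \<theta> (x,y) \<partial>lborel)" by (rule T.fint_eq[OF x])
    also have "\<dots> \<le> (\<integral>y. indicator {?lo<..<?hi} y \<partial>lborel)"
    proof (rule integral_mono')
      show "integrable lborel (indicator {?lo<..<?hi} :: real \<Rightarrow> real)" using le by (intro integrable_real_indicator) auto
      show "indicator T.R (x,y) * indicator \<theta> (x,y) \<le> (indicator {?lo<..<?hi} y :: real)" for y
        by (auto simp: \<theta>_def theta_def split: split_indicator)
    qed auto
    also have "\<dots> = p * H x" using le d by simp
    also have "\<dots> \<le> \<tau>" using Hx p by (simp add: \<tau>_def mult_left_mono)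
    finally show ?thesis .
  qed
  have fR: "L2 T.R f" using fL by (simp add: R)
  define q where "q = T.fint (\<lambda>z. indicator \<theta> z * f z)"
  have fq: "sint {-\<epsilon> * k1 x<..<\<epsilon> * k2 x} (\<lambda>y. indicator (theta a b \<gamma> \<epsilon> k2 H) (x,y) * f (x,y)) = q x" for x
    by (simp add: q_def T.fint_def l_def m_def \<theta>_def sint_lon)
  have hq: "h = (\<lambda>x. 1 / p * q x)" unfolding h_def fq pm ..
  have q: "L2 ?I q" "L2norm ?I q \<le> sqrt \<tau> * L2norm (\<theta> \<inter> T.R) f"
    unfolding q_def
    by (rule T.L2norm_fint_strip(1)[OF th tau tau0 fR], assumption, rule T.L2norm_fint_strip(2)[OF th tau tau0 fR])
  show hL: "L2 ?I h" unfolding hq by (rule L2_cmult[OF Ioo_borel q(1)])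
  define nf where "nf = L2norm (\<theta> \<inter> T.R) f"
  have nf0: "0 \<le> nf" unfolding nf_def by (rule L2norm_nonneg)
  have rn: "rnorm_L2 \<epsilon> S u = 1 / sqrt \<epsilon> * L2norm S u" for S u
    unfolding rnorm_L2_def L2norm_def ph ..
  \<comment> \<open>(F) in unscaled norms: the two factors \<open>1 / sqrt \<epsilon>\<close> cancel
    the \<open>\<epsilon>\<close> in
    \<open>\<epsilon> powr (-\<gamma>) = \<epsilon> / p\<close>.\<close>
  have nfc: "nf^2 \<le> c * p"
  proof -
    have "\<epsilon> / p * (1 / sqrt \<epsilon> * nf)^2 \<le> c" using F unfolding pg rn R \<theta>_def[symmetric] nf_def .
    moreover have "\<epsilon> / p * (1 / sqrt \<epsilon> * nf)^2 = nf^2 / p" using eps by (simp add: power_mult_distrib power_divide)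
    ultimately have "nf^2 / p \<le> c" by metis
    then show ?thesis using p by (simp add: pos_divide_le_eq)
  qed
  have c0: "0 \<le> c" using nfc p by (smt (verit) zero_le_power2 mult_neg_pos)
  have nfs: "nf \<le> sqrt c * sqrt p" using nfc by (simp add: real_le_rsqrt real_sqrt_mult[symmetric])
  \<comment> \<open>The thinness of the strip and the size of \<open>f\<close> each contribute
    \<open>sqrt p\<close>; the resulting \<open>p\<close> cancels the weight \<open>1 / p\<close> in
    both uses below.\<close>
  have st: "sqrt \<tau> * nf \<le> p * sqrt (c * H1)"
  proof -
    have "sqrt \<tau> * nf \<le> sqrt \<tau> * (sqrt c * sqrt p)" using nfs tau0 by (intro mult_left_mono) auto
    also have "\<dots> = (sqrt p * sqrt p) * sqrt (c * H1)" by (simp add: \<tau>_def real_sqrt_mult)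
    finally show ?thesis using p by simp
  qed
  show "L2norm ?I h \<le> sqrt (c * H1)"
  proof -
    have "L2norm ?I h = 1 / p * L2norm ?I q" unfolding hq L2norm_cmult using p by simp
    also have "\<dots> \<le> 1 / p * (p * sqrt (c * H1))" using q(2) st p unfolding nf_def by (intro mult_left_mono) auto
    finally show ?thesis using p by simp
  qed
  have red: "sint ?I (\<lambda>x. (k1 x + k2 x) * wderiv ?I wh x * wderiv ?I \<phi> x + (k1 x + k2 x) * wh x * \<phi> x) = 1 / p * sint ?I (\<lambda>x. q x * \<phi> x)"
    if "H1_1 ?I \<phi>" for \<phi>
  proof -
    have "sint ?I (\<lambda>x. (k1 x + k2 x) * wderiv ?I wh x * wderiv ?I \<phi> x + (k1 x + k2 x) * wh x * \<phi> x)
      = \<epsilon> / p * sint ?I (\<lambda>x. (k1 x + k2 x) * (1 / (\<epsilon> * (k1 x + k2 x)) * q x) * \<phi> x)"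
      using whsol that unfolding fq pg by blast
    also have "sint ?I (\<lambda>x. (k1 x + k2 x) * (1 / (\<epsilon> * (k1 x + k2 x)) * q x) * \<phi> x) = sint ?I (\<lambda>x. 1 / \<epsilon> * (q x * \<phi> x))"
      unfolding sint_lon[OF Ioo_borel]
    proof (rule integral_lon_cong)
      fix x assume "x \<in> ?I"
      then have "k1 x + k2 x \<noteq> 0" using k_pos[of x] by auto
      moreover have "s * (1 / (\<epsilon> * s) * y) * t = 1 / \<epsilon> * (y * t)" if "s \<noteq> 0" for s y t
        using eps that by simp
      ultimately show "(k1 x + k2 x) * (1 / (\<epsilon> * (k1 x + k2 x)) * q x) * \<phi> x = 1 / \<epsilon> * (q x * \<phi> x)"
        by blast
    qed simp
    also have "\<epsilon> / p * \<dots> = 1 / p * sint ?I (\<lambda>x. q x * \<phi> x)" using eps by simp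
    finally show ?thesis .
  qed
  show "sint ?I (\<lambda>x. (k1 x + k2 x) * wderiv ?I wh x * wderiv ?I \<phi> x + (k1 x + k2 x) * wh x * \<phi> x) = sint ?I (\<lambda>x. h x * \<phi> x)"
    if "H1_1 ?I \<phi>" for \<phi>
  proof -
    have "sint ?I (\<lambda>x. 1 / p * q x * \<phi> x) = 1 / p * sint ?I (\<lambda>x. q x * \<phi> x)"
      unfolding mult.assoc set_integral_mult_right ..
    then show ?thesis unfolding red[OF that] hq by simp
  qed
  have S0: "0 \<le> (SUP x\<in>?I. \<bar>deriv k1 x\<bar>)" "0 \<le> (SUP x\<in>?I. \<bar>deriv k2 x\<bar>)"
  proof -
    obtain x where x: "x \<in> ?I" using ab dense by auto
    show "0 \<le> (SUP x\<in>?I. \<bar>deriv k1 x\<bar>)" "0 \<le> (SUP x\<in>?I. \<bar>deriv k2 x\<bar>)"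
      using abs_deriv_le_SUP[OF k1' x] abs_deriv_le_SUP[OF k2' x] by linarith+
  qed
  have del: "\<bar>- \<epsilon> * k1' x\<bar> \<le> \<delta> \<and> \<bar>\<epsilon> * k2' x\<bar> \<le> \<delta>" if "x \<in> ?I" for x
  proof -
    have "\<epsilon> * \<bar>k1' x\<bar> \<le> \<epsilon> * (SUP x\<in>?I. \<bar>deriv k1 x\<bar>)" "\<epsilon> * \<bar>k2' x\<bar> \<le> \<epsilon> * (SUP x\<in>?I. \<bar>deriv k2 x\<bar>)"
      using abs_deriv_le_SUP[OF k1' that] abs_deriv_le_SUP[OF k2' that] eps by (auto intro!: mult_left_mono)
    moreover have "0 \<le> \<epsilon> * (SUP x\<in>?I. \<bar>deriv k1 x\<bar>)" "0 \<le> \<epsilon> * (SUP x\<in>?I. \<bar>deriv k2 x\<bar>)" using S0 eps by auto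
    moreover have "\<bar>- \<epsilon> * k1' x\<bar> = \<epsilon> * \<bar>k1' x\<bar>" "\<bar>\<epsilon> * k2' x\<bar> = \<epsilon> * \<bar>k2' x\<bar>" using eps by (auto simp: abs_mult)
    ultimately show ?thesis unfolding \<delta>_def by linarith
  qed
  have Db: "\<epsilon> * (C11 + C21) \<le> T.D x \<and> T.D x \<le> \<epsilon> * (C12 + C22)" if "x \<in> ?I" for x
  proof -
    have "C11 + C21 \<le> k1 x + k2 x" "k1 x + k2 x \<le> C12 + C22" using kb[of x] that by auto
    then show ?thesis using eps by (simp add: D)
  qed
  have CC: "0 < C11 + C21" "0 < C12 + C22" using C kb[of a] ab by auto
  have whH: "H1_1 ?I wh" using whsol by blast
  \<comment> \<open>Here the load factor is \<open>\<epsilon> / p\<close>, and fibre lengths lie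
    between \<open>\<epsilon> * (C11 + C21)\<close> and
    \<open>\<epsilon> * (C12 + C22)\<close>.\<close>
  have comp: "L2norm T.R (\<lambda>z. w z - wh (fst z)) \<le> (\<epsilon> / p) * L2norm (\<theta> \<inter> T.R) f * sqrt \<tau> * (\<delta> / sqrt (\<epsilon> * (C11 + C21)) + 2 * sqrt (\<epsilon> * (C12 + C22)))"
  proof (rule T.comparison[OF th tau tau0 fR del Db])
    show "0 < \<epsilon> * (C11 + C21)" "0 \<le> \<epsilon> / p" using eps CC p by auto
    show "H1_2 T.R w" using wsol by (simp add: R)
    show "sint T.R (\<lambda>z. fst (wgrad T.R w) z * fst (wgrad T.R \<phi>) z + snd (wgrad T.R w) z * snd (wgrad T.R \<phi>) z + w z * \<phi> z)
       = \<epsilon> / p * sint (\<theta> \<inter> T.R) (\<lambda>z. f z * \<phi> z)" if "H1_2 T.R \<phi>" for \<phi>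
      using wsol that unfolding R pg \<theta>_def[symmetric] by blast
    show "H1_1 ?I wh" by (rule whH)
    fix \<phi> assume phi: "H1_1 ?I \<phi>"
    have "sint ?I (\<lambda>x. T.D x * wderiv ?I wh x * wderiv ?I \<phi> x + T.D x * wh x * \<phi> x)
      = sint ?I (\<lambda>x. \<epsilon> * ((k1 x + k2 x) * wderiv ?I wh x * wderiv ?I \<phi> x + (k1 x + k2 x) * wh x * \<phi> x))"
      by (simp add: D algebra_simps)
    also have "\<dots> = \<epsilon> / p * sint ?I (\<lambda>x. q x * \<phi> x)" unfolding set_integral_mult_right red[OF phi] by simp
    finally show "sint ?I (\<lambda>x. T.D x * wderiv ?I wh x * wderiv ?I \<phi> x + T.D x * wh x * \<phi> x)
      = \<epsilon> / p * sint ?I (\<lambda>x. T.fint (\<lambda>z. indicator \<theta> z * f z) x * \<phi> x)" unfolding q_def .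
  qed
  have delta0: "0 \<le> \<delta>" using S0 eps by (simp add: \<delta>_def)
  have main: "1 / sqrt \<epsilon> * L2norm T.R (\<lambda>z. w z - wh (fst z)) \<le> bound"
  proof -
    define Y where "Y = \<delta> / sqrt (\<epsilon> * (C11 + C21)) + 2 * sqrt (\<epsilon> * (C12 + C22))"
    have Y0: "0 \<le> Y" using delta0 eps CC by (simp add: Y_def)
    have "L2norm T.R (\<lambda>z. w z - wh (fst z)) \<le> (\<epsilon> / p) * (sqrt \<tau> * nf) * Y"
      using comp by (simp add: Y_def nf_def ac_simps)
    also have "\<dots> \<le> (\<epsilon> / p) * (p * sqrt (c * H1)) * Y"
      using st p eps Y0 by (intro mult_right_mono mult_left_mono) auto
    finally have "1 / sqrt \<epsilon> * L2norm T.R (\<lambda>z. w z - wh (fst z)) \<le> 1 / sqrt \<epsilon> * ((\<epsilon> / p) * (p * sqrt (c * H1)) * Y)"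
      using eps by (intro mult_left_mono) auto
    also have "\<dots> = sqrt (c * H1) * (\<epsilon> / sqrt \<epsilon> * Y)" using p by simp
    also have "\<epsilon> / sqrt \<epsilon> = sqrt \<epsilon>" using eps by (simp add: real_div_sqrt)
    \<comment> \<open>The power \<open>sqrt \<epsilon>\<close> left after rescaling removes the
      singular \<open>1 / sqrt \<epsilon>\<close> of the slope term and turns the thickness term
      into order \<open>\<epsilon>\<close>.\<close>
    also have "sqrt \<epsilon> * Y = \<delta> / sqrt (C11 + C21) + 2 * \<epsilon> * sqrt (C12 + C22)"
    proof -
      have "sqrt \<epsilon> * (\<delta> / sqrt (\<epsilon> * (C11 + C21))) = \<delta> / sqrt (C11 + C21)" using eps by (simp add: real_sqrt_mult)
      moreover have "sqrt \<epsilon> * (2 * sqrt (\<epsilon> * (C12 + C22))) = 2 * (sqrt \<epsilon> * sqrt \<epsilon>) * sqrt (C12 + C22)" by (simp add: real_sqrt_mult)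
      moreover have "sqrt \<epsilon> * sqrt \<epsilon> = \<epsilon>" using eps by simp
      ultimately show ?thesis unfolding Y_def by (simp only: distrib_left)
    qed
    finally show ?thesis .
  qed
  show "rnorm_L2 \<epsilon> (Rdom a b \<epsilon> k1 k2) (\<lambda>z. w z - u (fst z)) \<le> bound + sqrt (C12 + C22) * L2norm ?I (\<lambda>x. wh x - u x)"
    if u: "L2 ?I u" for u
  proof -
    have whL: "L2 ?I wh" by (rule H1_1_wderiv(1)[OF whH])
    have wL: "L2 T.R w" using wsol H1_2_wgrad(1) unfolding R by blast
    define r where "r x = wh x - u x" for x
    have rL: "L2 ?I r" unfolding r_def by (rule L2_diff[OF _ whL u]) simp
    have tri: "L2norm T.R (\<lambda>z. w z - u (fst z)) \<le> L2norm T.R (\<lambda>z. w z - wh (fst z)) + L2norm T.R (\<lambda>z. r (fst z))"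
      using L2norm_triangle[OF T.R_borel L2_diff[OF T.R_borel wL T.L2_fst(1)[OF whL]] T.L2_fst(1)[OF rL]]
      by (simp add: r_def)
    \<comment> \<open>The norm of a function of \<open>x\<close> on the domain carries
      \<open>sqrt \<epsilon>\<close> from the fibre length, precisely what the rescaled norm divides
      by.\<close>
    have r2: "L2norm T.R (\<lambda>z. r (fst z)) \<le> sqrt \<epsilon> * sqrt (C12 + C22) * L2norm ?I r"
    proof -
      have ri: "integrable (lon ?I) (\<lambda>x. (r x)^2)" using rL by (simp add: L2_iff)
      have "sint T.R (\<lambda>z. (r (fst z))^2) = integral\<^sup>L (lon ?I) (\<lambda>x. T.D x * (r x)^2)"
        unfolding T.L2_fst(2)[OF rL] by (simp add: sint_lon)
      also have "\<dots> \<le> integral\<^sup>L (lon ?I) (\<lambda>x. \<epsilon> * (C12 + C22) * (r x)^2)"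
      proof (rule integral_mono')
        show "integrable (lon ?I) (\<lambda>x. \<epsilon> * (C12 + C22) * (r x)^2)" using ri by simp
        show "T.D x * (r x)^2 \<le> \<epsilon> * (C12 + C22) * (r x)^2" "0 \<le> \<epsilon> * (C12 + C22) * (r x)^2" if "x \<in> space (lon ?I)" for x
          using Db[of x] that eps CC by (auto simp: space_restrict_space intro!: mult_right_mono)
      qed
      also have "\<dots> = \<epsilon> * (C12 + C22) * sint ?I (\<lambda>x. (r x)^2)" by (simp add: sint_lon)
      finally have "sqrt (sint T.R (\<lambda>z. (r (fst z))^2)) \<le> sqrt (\<epsilon> * (C12 + C22) * sint ?I (\<lambda>x. (r x)^2))"
        by (rule real_sqrt_le_mono)
      then show ?thesis by (simp add: L2norm_def real_sqrt_mult)
    qed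
    have "1 / sqrt \<epsilon> * L2norm T.R (\<lambda>z. w z - u (fst z))
       \<le> 1 / sqrt \<epsilon> * (L2norm T.R (\<lambda>z. w z - wh (fst z)) + sqrt \<epsilon> * sqrt (C12 + C22) * L2norm ?I r)"
      using tri r2 eps by (intro mult_left_mono) auto
    also have "\<dots> = 1 / sqrt \<epsilon> * L2norm T.R (\<lambda>z. w z - wh (fst z)) + sqrt (C12 + C22) * L2norm ?I r"
      using eps by (simp add: distrib_left)
    also have "\<dots> \<le> bound + sqrt (C12 + C22) * L2norm ?I r" using main by simp
    finally show ?thesis unfolding rn R r_def .
  qed
qed

end

text \<open>Solutions are functions rather than classes, so the limit is fixed only up to null sets;
  the convergences are therefore claimed for every solution \<open>u\<close> of the limit problem.
  Existence comes from the compactness argument along one concrete sequence.\<close>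

theorem theorem2p1:
  fixes a b \<gamma> :: real
    and k1 k2 H :: "real \<Rightarrow> real \<Rightarrow> real"
    and K1 K2 P f0 :: "real \<Rightarrow> real"
    and f w :: "real \<Rightarrow> real \<times> real \<Rightarrow> real"
    and wh :: "real \<Rightarrow> real \<Rightarrow> real"
    and C11 C12 C21 C22 H0 H1 c :: real
  assumes ab: "a < b" and gam: "\<gamma> > 0"
    \<comment> \<open>(H.1)\<close>
    and H1_1a: "\<And>\<epsilon>. 0 < \<epsilon> \<Longrightarrow> \<epsilon> < 1 \<Longrightarrow> C1_on {a..b} (k1 \<epsilon>) \<and> C1_on {a..b} (k2 \<epsilon>)"
    and H1_1b: "((\<lambda>\<epsilon>. \<epsilon> * (SUP x\<in>{a<..<b}. \<bar>deriv (k1 \<epsilon>) x\<bar>)) \<longlongrightarrow> 0) (at_right 0)"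
    and H1_2b: "((\<lambda>\<epsilon>. \<epsilon> * (SUP x\<in>{a<..<b}. \<bar>deriv (k2 \<epsilon>) x\<bar>)) \<longlongrightarrow> 0) (at_right 0)"
    \<comment> \<open>(H.2)\<close>
    and H2: "0 < C11" "C11 \<le> C12" "0 < C21" "C21 \<le> C22"
    and H2b: "\<And>\<epsilon> x. 0 < \<epsilon> \<Longrightarrow> \<epsilon> < 1 \<Longrightarrow> x \<in> {a..b} \<Longrightarrow>
                 C11 \<le> k1 \<epsilon> x \<and> k1 \<epsilon> x \<le> C12 \<and> C21 \<le> k2 \<epsilon> x \<and> k2 \<epsilon> x \<le> C22"
    \<comment> \<open>(H.3)\<close>
    and H3: "L2 {a<..<b} K1" "L2 {a<..<b} K2"
            "wconv_L2 {a<..<b} k1 K1" "wconv_L2 {a<..<b} k2 K2"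
    \<comment> \<open>(H.4)\<close>
    and H4: "L2 {a<..<b} P" "wconv_L2 {a<..<b} (\<lambda>\<epsilon> x. 1 / (k1 \<epsilon> x + k2 \<epsilon> x)) P"
    \<comment> \<open>the functions H_\<epsilon>\<close>
    and HH: "0 \<le> H0" "H0 \<le> H1"
    and HHb: "\<And>\<epsilon>. 0 < \<epsilon> \<Longrightarrow> \<epsilon> < 1 \<Longrightarrow> C1_on {a..b} (H \<epsilon>)
                 \<and> (\<forall>x\<in>{a..b}. H0 \<le> H \<epsilon> x \<and> H \<epsilon> x \<le> H1)"
    \<comment> \<open>f^\<epsilon> \<in> L^2(R^\<epsilon>) and (F)\<close>
    and fL2: "\<And>\<epsilon>. 0 < \<epsilon> \<Longrightarrow> \<epsilon> < 1 \<Longrightarrow> L2 (Rdom a b \<epsilon> (k1 \<epsilon>) (k2 \<epsilon>)) (f \<epsilon>)"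
    and F: "\<And>\<epsilon>. 0 < \<epsilon> \<Longrightarrow> \<epsilon> < 1 \<Longrightarrow>
              \<epsilon> powr (-\<gamma>) * (rnorm_L2 \<epsilon> (theta a b \<gamma> \<epsilon> (k2 \<epsilon>) (H \<epsilon>) \<inter> Rdom a b \<epsilon> (k1 \<epsilon>) (k2 \<epsilon>)) (f \<epsilon>))^2 \<le> c"
    \<comment> \<open>the additional hypothesis on f_0\<close>
    and f0: "L2 {a<..<b} f0"
    and f0conv: "wconv_L2 {a<..<b}
       (\<lambda>\<epsilon> x. \<epsilon> powr (-(\<gamma>+1)) * sint {-\<epsilon> * k1 \<epsilon> x<..<\<epsilon> * k2 \<epsilon> x}
          (\<lambda>y. indicator (theta a b \<gamma> \<epsilon> (k2 \<epsilon>) (H \<epsilon>)) (x,y) * f \<epsilon> (x,y))) f0"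
    \<comment> \<open>w^\<epsilon> solves (P_\<epsilon>)\<close>
    and wsol: "\<And>\<epsilon>. 0 < \<epsilon> \<Longrightarrow> \<epsilon> < 1 \<Longrightarrow>
       H1_2 (Rdom a b \<epsilon> (k1 \<epsilon>) (k2 \<epsilon>)) (w \<epsilon>) \<and>
       (\<forall>\<phi>. H1_2 (Rdom a b \<epsilon> (k1 \<epsilon>) (k2 \<epsilon>)) \<phi> \<longrightarrow>
          sint (Rdom a b \<epsilon> (k1 \<epsilon>) (k2 \<epsilon>))
            (\<lambda>z. fst (wgrad (Rdom a b \<epsilon> (k1 \<epsilon>) (k2 \<epsilon>)) (w \<epsilon>)) z
                   * fst (wgrad (Rdom a b \<epsilon> (k1 \<epsilon>) (k2 \<epsilon>)) \<phi>) z
                 + snd (wgrad (Rdom a b \<epsilon> (k1 \<epsilon>) (k2 \<epsilon>)) (w \<epsilon>)) z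
                   * snd (wgrad (Rdom a b \<epsilon> (k1 \<epsilon>) (k2 \<epsilon>)) \<phi>) z
                 + w \<epsilon> z * \<phi> z)
          = \<epsilon> powr (-\<gamma>) * sint (theta a b \<gamma> \<epsilon> (k2 \<epsilon>) (H \<epsilon>) \<inter> Rdom a b \<epsilon> (k1 \<epsilon>) (k2 \<epsilon>))
                                 (\<lambda>z. f \<epsilon> z * \<phi> z))"
    \<comment> \<open>wh^\<epsilon> solves the reduced problem\<close>
    and whsol: "\<And>\<epsilon>. 0 < \<epsilon> \<Longrightarrow> \<epsilon> < 1 \<Longrightarrow>
       H1_1 {a<..<b} (wh \<epsilon>) \<and>
       (\<forall>\<phi>. H1_1 {a<..<b} \<phi> \<longrightarrow>
          sint {a<..<b} (\<lambda>x. (k1 \<epsilon> x + k2 \<epsilon> x) * wderiv {a<..<b} (wh \<epsilon>) x * wderiv {a<..<b} \<phi> x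
                            + (k1 \<epsilon> x + k2 \<epsilon> x) * wh \<epsilon> x * \<phi> x)
          = \<epsilon> powr (-\<gamma>) * sint {a<..<b} (\<lambda>x. (k1 \<epsilon> x + k2 \<epsilon> x)
               * (1 / (\<epsilon> * (k1 \<epsilon> x + k2 \<epsilon> x)) * sint {-\<epsilon> * k1 \<epsilon> x<..<\<epsilon> * k2 \<epsilon> x}
                    (\<lambda>y. indicator (theta a b \<gamma> \<epsilon> (k2 \<epsilon>) (H \<epsilon>)) (x,y) * f \<epsilon> (x,y)))
               * \<phi> x))"
  shows "(\<exists>u. H1_1 {a<..<b} u \<and>
            (\<forall>\<phi>. H1_1 {a<..<b} \<phi> \<longrightarrow>
               sint {a<..<b} (\<lambda>x. 1 / P x * wderiv {a<..<b} u x * wderiv {a<..<b} \<phi> x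
                                 + (K1 x + K2 x) * u x * \<phi> x)
               = sint {a<..<b} (\<lambda>x. f0 x * \<phi> x)))
       \<and> (\<forall>u. (H1_1 {a<..<b} u \<and>
            (\<forall>\<phi>. H1_1 {a<..<b} \<phi> \<longrightarrow>
               sint {a<..<b} (\<lambda>x. 1 / P x * wderiv {a<..<b} u x * wderiv {a<..<b} \<phi> x
                                 + (K1 x + K2 x) * u x * \<phi> x)
               = sint {a<..<b} (\<lambda>x. f0 x * \<phi> x)))
          \<longrightarrow> wconv_H1 {a<..<b} wh u
            \<and> ((\<lambda>\<epsilon>. rnorm_L2 \<epsilon> (Rdom a b \<epsilon> (k1 \<epsilon>) (k2 \<epsilon>)) (\<lambda>z. w \<epsilon> z - u (fst z)))
                 \<longlongrightarrow> 0) (at_right 0))"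
proof -
  let ?I = "{a<..<b}"
  let ?K = "\<lambda>x. K1 x + K2 x"
  have TP: "thin_problem a b \<gamma> \<epsilon> (k1 \<epsilon>) (k2 \<epsilon>) (H \<epsilon>) (f \<epsilon>) (w \<epsilon>) (wh \<epsilon>) C11 C12 C21 C22 H0 H1 c"
    if "0 < \<epsilon>" "\<epsilon> < 1" for \<epsilon>
  proof (rule thin_problem.intro)
    show "C1_on {a..b} (k1 \<epsilon>)" "C1_on {a..b} (k2 \<epsilon>)" "C1_on {a..b} (H \<epsilon>)" using H1_1a[OF that] HHb[OF that] by auto
    show "H0 \<le> H \<epsilon> x \<and> H \<epsilon> x \<le> H1" if "x \<in> {a..b}" for x using HHb[OF \<open>0 < \<epsilon>\<close> \<open>\<epsilon> < 1\<close>] that by blast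
  qed (fact ab that H2(1) H2(3) HH(1) H2b[OF that] fL2[OF that] F[OF that] wsol[OF that] whsol[OF that])+
  define h where "h \<epsilon> = thin_problem.h a b \<gamma> \<epsilon> (k1 \<epsilon>) (k2 \<epsilon>) (H \<epsilon>) (f \<epsilon>)" for \<epsilon>
  have h_eq: "(\<lambda>\<epsilon> x. \<epsilon> powr (-(\<gamma>+1)) * sint {-\<epsilon> * k1 \<epsilon> x<..<\<epsilon> * k2 \<epsilon> x}
          (\<lambda>y. indicator (theta a b \<gamma> \<epsilon> (k2 \<epsilon>) (H \<epsilon>)) (x,y) * f \<epsilon> (x,y))) \<epsilon> = h \<epsilon>" if "0 < \<epsilon>" "\<epsilon> < 1" for \<epsilon>
    unfolding h_def using thin_problem.h_def[OF TP[OF that]] by auto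
  have RP: "reduced_problems a b (C11 + C21) (C12 + C22) (sqrt (c * H1)) (\<lambda>n x. k1 (S n) x + k2 (S n) x)
      (\<lambda>n. h (S n)) (\<lambda>n. wh (S n)) ?K P f0"
    if S: "\<And>n. 0 < S n \<and> S n < 1" "S \<longlonglongrightarrow> 0" for S :: "nat \<Rightarrow> real"
  proof -
    have T: "thin_problem a b \<gamma> (S n) (k1 (S n)) (k2 (S n)) (H (S n)) (f (S n)) (w (S n)) (wh (S n)) C11 C12 C21 C22 H0 H1 c" for n
      using TP S(1) by blast
    \<comment> \<open>Positivity of the terms upgrades convergence to \<open>0\<close> to
      convergence from the right, along which the weak limits are assumed.\<close>
    have fl: "filterlim S (at_right 0) sequentially"
    proof -
      have "S n \<in> {0<..} \<and> S n \<noteq> 0" for n using S(1)[of n] by auto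
      then show ?thesis using S(2) unfolding filterlim_at by (simp add: always_eventually)
    qed
    have wc: "(\<lambda>n. sint ?I (\<lambda>x. u (S n) x * g x)) \<longlonglongrightarrow> sint ?I (\<lambda>x. U x * g x)" if "wconv_L2 ?I u U" "L2 ?I g" for u U g
      using filterlim_compose[OF _ fl] that unfolding wconv_L2_def by blast
    have kL: "L2 ?I (k1 (S n))" "L2 ?I (k2 (S n))" for n
    proof -
      have e: "0 < S n" "S n < 1" using S(1) by auto
      have c: "continuous_on ?I (k1 (S n))" "continuous_on ?I (k2 (S n))"
        by (rule continuous_on_subset[OF C1_on_continuous[of "{a..b}"]]; use H1_1a[OF e] in force)+
      have bd: "\<bar>k1 (S n) x\<bar> \<le> C12" "\<bar>k2 (S n) x\<bar> \<le> C22" if "x \<in> ?I" for x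
        using H2b[OF e, of x] H2 that by auto
      show "L2 ?I (k1 (S n))"
        by (rule L2_bounded[OF _ _ continuous_on_measurable_lon[OF c(1)] bd(1)]) auto
      show "L2 ?I (k2 (S n))"
        by (rule L2_bounded[OF _ _ continuous_on_measurable_lon[OF c(2)] bd(2)]) auto
    qed
    show ?thesis
    proof (rule reduced_problems.intro)
      show "a < b" "0 < C11 + C21" using ab H2 by auto
      show "(\<lambda>x. k1 (S n) x + k2 (S n) x) \<in> borel_measurable (lon ?I)" for n by (rule thin_problem.k_measurable[OF T])
      show "C11 + C21 \<le> k1 (S n) x + k2 (S n) x \<and> k1 (S n) x + k2 (S n) x \<le> C12 + C22" if "x \<in> ?I" for n x
        using H2b[of "S n" x] S(1)[of n] that by auto
      show "L2 ?I (h (S n))" "L2norm ?I (h (S n)) \<le> sqrt (c * H1)" for n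
        unfolding h_def by (rule thin_problem.h_L2[OF T] thin_problem.h_bound[OF T])+
      show "L2 ?I ?K" by (rule L2_add[OF _ H3(1,2)]) simp
      show "L2 ?I P" "L2 ?I f0" by (fact H4 f0)+
      show "H1_1 ?I (wh (S n))" for n using whsol S(1) by blast
      show "sint ?I (\<lambda>x. (k1 (S n) x + k2 (S n) x) * wderiv ?I (wh (S n)) x * wderiv ?I \<phi> x + (k1 (S n) x + k2 (S n) x) * wh (S n) x * \<phi> x)
        = sint ?I (\<lambda>x. h (S n) x * \<phi> x)" if "H1_1 ?I \<phi>" for n \<phi>
        unfolding h_def by (rule thin_problem.h_equation[OF T that])
      fix g assume g: "L2 ?I g"
      note i = L2_mult_integrable[OF Ioo_borel _ g]
      have "(\<lambda>n. sint ?I (\<lambda>x. k1 (S n) x * g x) + sint ?I (\<lambda>x. k2 (S n) x * g x)) \<longlonglongrightarrow> sint ?I (\<lambda>x. K1 x * g x) + sint ?I (\<lambda>x. K2 x * g x)"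
        by (intro tendsto_add wc H3 g)
      then show "(\<lambda>n. sint ?I (\<lambda>x. (k1 (S n) x + k2 (S n) x) * g x)) \<longlonglongrightarrow> sint ?I (\<lambda>x. (K1 x + K2 x) * g x)"
        using i[OF kL(1)] i[OF kL(2)] i[OF H3(1)] i[OF H3(2)] by (simp add: sint_lon distrib_right)
      show "(\<lambda>n. sint ?I (\<lambda>x. 1 / (k1 (S n) x + k2 (S n) x) * g x)) \<longlonglongrightarrow> sint ?I (\<lambda>x. P x * g x)"
        by (rule wc[OF H4(2) g])
      have "h (S n) = (\<lambda>x. (S n) powr (-(\<gamma>+1)) * sint {-(S n) * k1 (S n) x<..<(S n) * k2 (S n) x}
          (\<lambda>y. indicator (theta a b \<gamma> (S n) (k2 (S n)) (H (S n))) (x,y) * f (S n) (x,y)))" for n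
        using h_eq[of "S n"] S(1) by simp
      then show "(\<lambda>n. sint ?I (\<lambda>x. h (S n) x * g x)) \<longlonglongrightarrow> sint ?I (\<lambda>x. f0 x * g x)"
        using wc[OF f0conv g] by simp
    qed
  qed
  have ex: "\<exists>u. solves_limit a b P ?K f0 u"
  proof -
    \<comment> \<open>The shift by \<open>2\<close> keeps even the term \<open>n = 0\<close>
      strictly below \<open>1\<close>.\<close>
    define S where "S n = 1 / (real n + 2)" for n
    have "\<And>n. 0 < S n \<and> S n < 1" by (simp add: S_def)
    moreover have "S \<longlonglongrightarrow> 0" unfolding S_def by real_asymp
    ultimately interpret reduced_problems a b "C11 + C21" "C12 + C22" "sqrt (c * H1)" "\<lambda>n x. k1 (S n) x + k2 (S n) x"
      "\<lambda>n. h (S n)" "\<lambda>n. wh (S n)" ?K P f0 by (rule RP)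
    show ?thesis using subsequence_converges by blast
  qed
  have main: "wconv_H1 ?I wh u \<and> ((\<lambda>\<epsilon>. rnorm_L2 \<epsilon> (Rdom a b \<epsilon> (k1 \<epsilon>) (k2 \<epsilon>)) (\<lambda>z. w \<epsilon> z - u (fst z))) \<longlongrightarrow> 0) (at_right 0)"
    if u: "solves_limit a b P ?K f0 u" for u
  proof
    have uH: "H1_1 ?I u" using u by (simp add: solves_limit_def)
    note U = H1_1_wderiv[OF uH]
    have sub: "\<exists>r. strict_mono (r :: nat \<Rightarrow> nat) \<and>
        (\<forall>\<phi>. L2 ?I \<phi> \<longrightarrow> (\<lambda>n. sint ?I (\<lambda>x. wh (S (r n)) x * \<phi> x)) \<longlonglongrightarrow> sint ?I (\<lambda>x. u x * \<phi> x)) \<and>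
        (\<forall>\<phi>. L2 ?I \<phi> \<longrightarrow> (\<lambda>n. sint ?I (\<lambda>x. wderiv ?I (wh (S (r n))) x * \<phi> x)) \<longlonglongrightarrow> sint ?I (\<lambda>x. wderiv ?I u x * \<phi> x)) \<and>
        (\<lambda>n. L2norm ?I (\<lambda>x. wh (S (r n)) x - u x)) \<longlonglongrightarrow> 0"
      if S: "\<And>n. 0 < S n \<and> S n < 1" "S \<longlonglongrightarrow> 0" for S :: "nat \<Rightarrow> real"
    proof -
      interpret reduced_problems a b "C11 + C21" "C12 + C22" "sqrt (c * H1)" "\<lambda>n x. k1 (S n) x + k2 (S n) x"
        "\<lambda>n. h (S n)" "\<lambda>n. wh (S n)" ?K P f0 by (rule RP[OF S])
      obtain r u0 where r: "strict_mono (r :: nat \<Rightarrow> nat)" and u0: "solves_limit a b P ?K f0 u0"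
        and c1: "\<And>\<phi>. L2 ?I \<phi> \<Longrightarrow> (\<lambda>n. sint ?I (\<lambda>x. wh (S (r n)) x * \<phi> x)) \<longlonglongrightarrow> sint ?I (\<lambda>x. u0 x * \<phi> x)"
        and c2: "\<And>\<phi>. L2 ?I \<phi> \<Longrightarrow> (\<lambda>n. sint ?I (\<lambda>x. wderiv ?I (wh (S (r n))) x * \<phi> x)) \<longlonglongrightarrow> sint ?I (\<lambda>x. wderiv ?I u0 x * \<phi> x)"
        and c3: "(\<lambda>n. L2norm ?I (\<lambda>x. wh (S (r n)) x - u0 x)) \<longlonglongrightarrow> 0"
        using subsequence_converges by blast
      have u0H: "H1_1 ?I u0" using u0 by (simp add: solves_limit_def)
      note U0 = H1_1_wderiv[OF u0H]
      \<comment> \<open>The limit \<open>u0\<close> depends on the sequence chosen; uniqueness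
        identifies it almost everywhere with the given \<open>u\<close>, so all subsequences share
        one limit.\<close>
      note ae = limit_unique[OF u0 u]
      have e: "sint ?I (\<lambda>x. p x * \<phi> x) = sint ?I (\<lambda>x. q x * \<phi> x)"
        if "L2 ?I p" "L2 ?I q" "L2 ?I \<phi>" "AE x in lon ?I. p x = q x" for p q \<phi>
        unfolding sint_lon[OF Ioo_borel]
      proof (rule integral_cong_AE)
        show "AE x in lon ?I. p x * \<phi> x = q x * \<phi> x" using that(4) by eventually_elim simp
      qed (use that in \<open>auto simp: L2_iff\<close>)
      have "L2norm ?I (\<lambda>x. wh (S n) x - u0 x) = L2norm ?I (\<lambda>x. wh (S n) x - u x)" for n
      proof (rule antisym)
        have L: "L2 ?I (\<lambda>x. wh (S n) x - u0 x)" "L2 ?I (\<lambda>x. wh (S n) x - u x)"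
          by (intro L2_diff Ioo_borel whL U0(1) U(1))+
        have a: "AE x in lon ?I. wh (S n) x - u0 x = wh (S n) x - u x" using ae(1) by eventually_elim simp
        show "L2norm ?I (\<lambda>x. wh (S n) x - u0 x) \<le> L2norm ?I (\<lambda>x. wh (S n) x - u x)"
          "L2norm ?I (\<lambda>x. wh (S n) x - u x) \<le> L2norm ?I (\<lambda>x. wh (S n) x - u0 x)"
          by (rule L2norm_mono[OF Ioo_borel]; use L a in auto)+
      qed
      then show ?thesis
        using r c1 c2 c3 e[OF U0(1) U(1) _ ae(1)] e[OF U0(2) U(2) _ ae(2)] by auto
    qed
    show "wconv_H1 ?I wh u" unfolding wconv_H1_def
    proof (intro allI impI tendsto_at_right_subsequence)
      fix g S assume "H1_1 ?I g" and S: "\<And>n::nat. 0 < S n \<and> S n < (1::real)" "S \<longlonglongrightarrow> 0"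
      note G = H1_1_wderiv[OF \<open>H1_1 ?I g\<close>]
      have split: "sint ?I (\<lambda>x. p x * g x + wderiv ?I p x * wderiv ?I g x) = sint ?I (\<lambda>x. p x * g x) + sint ?I (\<lambda>x. wderiv ?I p x * wderiv ?I g x)"
        if "H1_1 ?I p" for p
        using L2_mult_integrable[OF _ H1_1_wderiv(1)[OF that] G(1)] L2_mult_integrable[OF _ H1_1_wderiv(2)[OF that] G(2)]
        by (simp add: sint_lon)
      obtain r where r: "strict_mono (r :: nat \<Rightarrow> nat)"
        "(\<lambda>n. sint ?I (\<lambda>x. wh (S (r n)) x * g x)) \<longlonglongrightarrow> sint ?I (\<lambda>x. u x * g x)"
        "(\<lambda>n. sint ?I (\<lambda>x. wderiv ?I (wh (S (r n))) x * wderiv ?I g x)) \<longlonglongrightarrow> sint ?I (\<lambda>x. wderiv ?I u x * wderiv ?I g x)"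
        using sub[OF S] G(1,2) by blast
      have "H1_1 ?I (wh (S (r n)))" for n using whsol S(1) by blast
      then show "\<exists>r. strict_mono r \<and> (\<lambda>n. sint ?I (\<lambda>x. wh (S (r n)) x * g x + wderiv ?I (wh (S (r n))) x * wderiv ?I g x))
          \<longlonglongrightarrow> sint ?I (\<lambda>x. u x * g x + wderiv ?I u x * wderiv ?I g x)"
        using r(1) tendsto_add[OF r(2,3)] uH by (auto simp: split)
    qed
    have nrm: "((\<lambda>\<epsilon>. L2norm ?I (\<lambda>x. wh \<epsilon> x - u x)) \<longlongrightarrow> 0) (at_right 0)"
      by (rule tendsto_at_right_subsequence) (use sub in blast)
    \<comment> \<open>The bound from \<open>distance\<close>: slopes vanish by (H.1), thickness by
      the factor \<open>\<epsilon>\<close>, and the last term by the strong \<open>L2\<close>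
      convergence \<open>nrm\<close>.\<close>
    let ?B = "\<lambda>\<epsilon>. sqrt (c * H1) * ((\<epsilon> * (SUP x\<in>?I. \<bar>deriv (k1 \<epsilon>) x\<bar>) + \<epsilon> * (SUP x\<in>?I. \<bar>deriv (k2 \<epsilon>) x\<bar>)) / sqrt (C11 + C21)
       + 2 * \<epsilon> * sqrt (C12 + C22)) + sqrt (C12 + C22) * L2norm ?I (\<lambda>x. wh \<epsilon> x - u x)"
    have "(?B \<longlongrightarrow> sqrt (c * H1) * ((0 + 0) / sqrt (C11 + C21) + 2 * 0 * sqrt (C12 + C22)) + sqrt (C12 + C22) * 0) (at_right 0)"
      using H2 by (intro tendsto_intros H1_1b H1_2b nrm) auto
    then have B0: "(?B \<longlongrightarrow> 0) (at_right 0)" by simp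
    have ev: "eventually (\<lambda>\<epsilon>::real. 0 < \<epsilon> \<and> \<epsilon> < 1) (at_right 0)"
      using eventually_at_right_less[of 0] eventually_at_right_real[of 0 1] by (auto elim: eventually_mono)
    show "((\<lambda>\<epsilon>. rnorm_L2 \<epsilon> (Rdom a b \<epsilon> (k1 \<epsilon>) (k2 \<epsilon>)) (\<lambda>z. w \<epsilon> z - u (fst z))) \<longlongrightarrow> 0) (at_right 0)"
    proof (rule tendsto_sandwich[OF _ _ tendsto_const B0])
      show "eventually (\<lambda>\<epsilon>. 0 \<le> rnorm_L2 \<epsilon> (Rdom a b \<epsilon> (k1 \<epsilon>) (k2 \<epsilon>)) (\<lambda>z. w \<epsilon> z - u (fst z))) (at_right 0)"
        unfolding rnorm_L2_def L2norm_def[symmetric] using L2norm_nonneg by (intro always_eventually allI mult_nonneg_nonneg) auto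
      show "eventually (\<lambda>\<epsilon>. rnorm_L2 \<epsilon> (Rdom a b \<epsilon> (k1 \<epsilon>) (k2 \<epsilon>)) (\<lambda>z. w \<epsilon> z - u (fst z)) \<le> ?B \<epsilon>) (at_right 0)"
        using ev
      proof eventually_elim
        case (elim \<epsilon>)
        show ?case using thin_problem.distance[OF TP U(1), of \<epsilon>] elim
          unfolding thin_problem.\<delta>_def[OF TP[OF conjunct1[OF elim] conjunct2[OF elim]]] by blast
      qed
    qed
  qed
  show ?thesis using ex main unfolding solves_limit_def by blast
qed

end
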